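(* Let $\mathsf H$, $T$, $V$, $L$, $F=T+V$, $\mathsf S=\{x\in\mathsf H:0\in F(x)\}$, the stochastic oracle and the RISFBF process be as in the context, and assume: $\mathsf S\neq\emptyset$; $\mathbb E_\xi[\hat V(x,\xi)]=V(x)$ and $\mathbb E_\xi[\|\hat V(x,\xi)-V(x)\|^2]\le\sigma^2$ for some $\sigma>0$ and all $x\in\mathsf H$; the batch sizes $(m_k)_{k\ge1}$ are non-decreasing with $\sum_{k\ge1}1/m_k<\infty$. Let $\bar\alpha,\bar\varepsilon\in(0,1)$, let $(\alpha_k)$ be a non-decreasing (nonnegative) sequence with $\lim_k\alpha_k=\bar\alpha$, let $(\lambda_k)$ be a sequence in $(0,\frac1{4L})$ converging to some $\lambda\in(0,\frac1{4L})$, and let $\rho_k=\frac{5(1-\bar\varepsilon)(1-\bar\alpha)^2}{4(2\alpha_k^2-\alpha_k+1)(1+L\lambda_k)}$ for all $k\ge1$. If $F=T+V$ is demiregular, then $(X_k)_{k\in\mathbb N}$ converges strongly, $\mathbb P$-a.s., to an $\mathsf S$-valued random variable.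
   Context: $\mathsf H$ is a real separable Hilbert space with inner product $\langle\cdot,\cdot\rangle$ and norm $\|\cdot\|$. $T:\mathsf H\to2^{\mathsf H}$ is maximally monotone; $V:\mathsf H\to\mathsf H$ is maximally monotone and $L$-Lipschitz continuous ($L>0$) with full domain. $F=T+V$ and $J_{\lambda T}=(\mathrm{Id}+\lambda T)^{-1}$ is the resolvent. Demiregularity: $F:\mathsf H\to2^{\mathsf H}$ is demiregular at $y\in\operatorname{dom}F$ if for every sequence $(y_n,u_n)_{n}$ in the graph of $F$ and every $u\in F(y)$ such that $y_n\rightharpoonup y$ (weakly) and $u_n\to u$ (strongly), one has $y_n\to y$ strongly; $F$ is demiregular if this holds at every $y\in\operatorname{dom}F$. Oracle: on a complete probability space $(\Omega,\mathcal F,\mathbb P)$, $\xi$ is a random variable with values in a measurable set $\Xi\subseteq\mathbb R^d$ and law $\mathsf P$; $\hat V:\mathsf H\times\Xi\to\mathsf H$ is a (measurable) random operator estimating $V$. RISFBF algorithm: given initial points $X_0,X_1\in\operatorname{dom}T$, nonnegative sequences $(\alpha_k)$, $(\rho_k)$, step sizes $\lambda_k>0$ and batch sizes $m_k\in\mathbb N$, $m_k\geq 1$, for $k\ge1$: $Z_k=X_k+\alpha_k(X_k-X_{k-1})$; $Y_k=J_{\lambda_kT}(Z_k-\lambda_kA_k)$ with $A_k=\frac1{m_k}\sum_{t=1}^{m_k}\hat V(Z_k,\xi_k^{(t)})$; $X_{k+1}=(1-\rho_k)Z_k+\rho_k[Y_k+\lambda_k(A_k-B_k)]$ with $B_k=\frac1{m_k}\sum_{t=1}^{m_k}\hat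 V(Y_k,\eta_k^{(t)})$; where all samples $\xi_k^{(t)},\eta_k^{(t)}$ ($1\le t\le m_k$, $k\ge1$) are independent draws from $\mathsf P$, independent of the past. *)

theory Defs
  imports "HOL-Probability.Probability"
begin

type_synonym 'h set_operator = "'h \<Rightarrow> 'h set"

definition op_dom :: "'h set_operator \<Rightarrow> 'h set"
  where "op_dom T = {x. T x \<noteq> {}}"

definition op_zeros :: "'h::zero set_operator \<Rightarrow> 'h set"
  where "op_zeros T = {x. 0 \<in> T x}"

definition op_inverse :: "'h set_operator \<Rightarrow> 'h set_operator"
  where "op_inverse T u = {x. u \<in> T x}"

definition op_sum :: "'h::plus set_operator \<Rightarrow> 'h set_operator \<Rightarrow> 'h set_operator"
  where "op_sum S T x = {u + v | u v. u \<in> S x \<and> v \<in> T x}"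

definition op_scale :: "real \<Rightarrow> 'h::real_vector set_operator \<Rightarrow> 'h set_operator"
  where "op_scale c T x = {c *\<^sub>R u | u. u \<in> T x}"

definition op_of_fun :: "('h \<Rightarrow> 'h) \<Rightarrow> 'h set_operator"
  where "op_of_fun V x = {V x}"

definition monotone_operator :: "'h::real_inner set_operator \<Rightarrow> bool"
  where "monotone_operator T \<longleftrightarrow>
    (\<forall>x y u v. u \<in> T x \<longrightarrow> v \<in> T y \<longrightarrow> 0 \<le> inner (x - y) (u - v))"

definition maximally_monotone :: "'h::real_inner set_operator \<Rightarrow> bool"
  where "maximally_monotone T \<longleftrightarrow> monotone_operator T \<and>
    (\<forall>T'. monotone_operator T' \<longrightarrow> (\<forall>x. T x \<subseteq> T' x) \<longrightarrow> T' = T)"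

text \<open>For maximally monotone \<open>T\<close> and \<open>c > 0\<close> the operator \<open>(Id + cT)\<^sup>-\<^sup>1\<close> has exactly one
  value at every point (Minty), so there \<^const>\<open>the_elem\<close> selects that value; otherwise the
  value of \<open>resolvent c T z\<close> is unspecified.\<close>

definition resolvent :: "real \<Rightarrow> 'h::real_vector set_operator \<Rightarrow> 'h \<Rightarrow> 'h"
  where "resolvent c T z = the_elem (op_inverse (op_sum (op_of_fun id) (op_scale c T)) z)"

definition weakly_tendsto :: "(nat \<Rightarrow> 'h::real_inner) \<Rightarrow> 'h \<Rightarrow> bool"
  where "weakly_tendsto y l \<longleftrightarrow> (\<forall>z. (\<lambda>n. inner (y n) z) \<longlonglongrightarrow> inner l z)"

definition demiregular_at :: "'h::real_inner set_operator \<Rightarrow> 'h \<Rightarrow> bool"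
  where "demiregular_at F y \<longleftrightarrow>
    (\<forall>ys us u. (\<forall>n. us n \<in> F (ys n)) \<longrightarrow> u \<in> F y \<longrightarrow> weakly_tendsto ys y \<longrightarrow> us \<longlonglongrightarrow> u
      \<longrightarrow> ys \<longlonglongrightarrow> y)"

definition demiregular :: "'h::real_inner set_operator \<Rightarrow> bool"
  where "demiregular F \<longleftrightarrow> (\<forall>y\<in>op_dom F. demiregular_at F y)"

definition batch_average :: "('h \<Rightarrow> 's \<Rightarrow> 'h::real_vector) \<Rightarrow> nat \<Rightarrow> 'h \<Rightarrow> (nat \<Rightarrow> 's) \<Rightarrow> 'h"
  where "batch_average Vhat m z s = (1 / real m) *\<^sub>R (\<Sum>t=1..m. Vhat z (s t))"

text \<open>The index \<open>0\<close> of \<open>Z\<close>, \<open>Y\<close>, \<open>A\<close>, \<open>B\<close> and of all parameter sequences is never used.\<close>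

definition risfbf_process ::
  "'w measure \<Rightarrow> 'h::real_vector set_operator \<Rightarrow> ('h \<Rightarrow> 's \<Rightarrow> 'h)
    \<Rightarrow> (nat \<Rightarrow> real) \<Rightarrow> (nat \<Rightarrow> real) \<Rightarrow> (nat \<Rightarrow> real) \<Rightarrow> (nat \<Rightarrow> nat)
    \<Rightarrow> (nat \<Rightarrow> nat \<Rightarrow> 'w \<Rightarrow> 's) \<Rightarrow> (nat \<Rightarrow> nat \<Rightarrow> 'w \<Rightarrow> 's) \<Rightarrow> (nat \<Rightarrow> 'w \<Rightarrow> 'h) \<Rightarrow> bool"
  where "risfbf_process M T Vhat \<alpha> \<rho> lam m \<xi> \<eta> X \<longleftrightarrow>
    (\<exists>Z Y A B. \<forall>k\<ge>1. \<forall>\<omega>\<in>space M.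
      Z k \<omega> = X k \<omega> + \<alpha> k *\<^sub>R (X k \<omega> - X (k - 1) \<omega>) \<and>
      A k \<omega> = batch_average Vhat (m k) (Z k \<omega>) (\<lambda>t. \<xi> k t \<omega>) \<and>
      Y k \<omega> = resolvent (lam k) T (Z k \<omega> - lam k *\<^sub>R A k \<omega>) \<and>
      B k \<omega> = batch_average Vhat (m k) (Y k \<omega>) (\<lambda>t. \<eta> k t \<omega>) \<and>
      X (k + 1) \<omega> = (1 - \<rho> k) *\<^sub>R Z k \<omega>
                      + \<rho> k *\<^sub>R (Y k \<omega> + lam k *\<^sub>R (A k \<omega> - B k \<omega>)))"

text \<open>Labels for the sources of randomness: the pair of initial points, and the
  \<open>t\<close>-th draw of the batch used at \<open>Z\<^sub>k\<close> and at \<open>Y\<^sub>k\<close>, respectively.\<close>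

datatype source = Initial | Draw_Z nat nat | Draw_Y nat nat

definition sources :: "(nat \<Rightarrow> nat) \<Rightarrow> source set"
  where "sources m = {Initial} \<union> {Draw_Z k t | k t. 1 \<le> k \<and> 1 \<le> t \<and> t \<le> m k}
                              \<union> {Draw_Y k t | k t. 1 \<le> k \<and> 1 \<le> t \<and> t \<le> m k}"

fun source_events ::
  "'w measure \<Rightarrow> 's measure \<Rightarrow> (nat \<Rightarrow> nat \<Rightarrow> 'w \<Rightarrow> 's) \<Rightarrow> (nat \<Rightarrow> nat \<Rightarrow> 'w \<Rightarrow> 's)
    \<Rightarrow> (nat \<Rightarrow> 'w \<Rightarrow> 'h::topological_space) \<Rightarrow> source \<Rightarrow> 'w set set"
  where
    "source_events M N \<xi> \<eta> X Initial =
      sets (vimage_algebra (space M) (\<lambda>\<omega>. (X 0 \<omega>, X 1 \<omega>)) (borel \<Otimes>\<^sub>M borel))"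
  | "source_events M N \<xi> \<eta> X (Draw_Z k t) = sets (vimage_algebra (space M) (\<xi> k t) N)"
  | "source_events M N \<xi> \<eta> X (Draw_Y k t) = sets (vimage_algebra (space M) (\<eta> k t) N)"

text \<open>The initial points may be random, but not correlated with the draws. Joint independence of
  all sources makes every draw independent of what was generated before it.\<close>

definition risfbf_sampling ::
  "'w measure \<Rightarrow> 's measure \<Rightarrow> 's measure \<Rightarrow> (nat \<Rightarrow> nat) \<Rightarrow> (nat \<Rightarrow> nat \<Rightarrow> 'w \<Rightarrow> 's)
    \<Rightarrow> (nat \<Rightarrow> nat \<Rightarrow> 'w \<Rightarrow> 's) \<Rightarrow> (nat \<Rightarrow> 'w \<Rightarrow> 'h::topological_space) \<Rightarrow> bool"
  where "risfbf_sampling M N P m \<xi> \<eta> X \<longleftrightarrow>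
    (\<forall>k\<ge>1. \<forall>t\<in>{1..m k}. \<xi> k t \<in> measurable M N \<and> distr M N (\<xi> k t) = P
                     \<and> \<eta> k t \<in> measurable M N \<and> distr M N (\<eta> k t) = P) \<and>
    prob_space.indep_sets M (source_events M N \<xi> \<eta> X) (sources m)"

end

theory Submission
  imports Defs "HOL-Library.Diagonal_Subsequence"
begin

text \<open>For a zero \<open>p\<close> of \<open>F\<close>, the energy
  \<open>H p k = \<parallel>X\<^sub>k - p\<parallel>\<^sup>2 - \<alpha>\<^sub>k \<parallel>X\<^sub>k\<^sub>-\<^sub>1 - p\<parallel>\<^sup>2 + a\<^sub>k \<parallel>X\<^sub>k - X\<^sub>k\<^sub>-\<^sub>1\<parallel>\<^sup>2\<close> is eventually nonnegative, and it decreases up to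
  a summable noise term and a martingale difference. The initial points need not be integrable and
  the martingale part may grow like \<open>H\<close>, so the logarithm of \<open>1 + H\<close> is followed instead: it is perturbed
  by a martingale with summable variances, which converges almost surely by a maximal inequality. Hence \<open>H p k\<close>
  converges, \<open>X\<^sub>k - X\<^sub>k\<^sub>-\<^sub>1\<close> and \<open>Z\<^sub>k - Y\<^sub>k\<close> vanish, and the distances \<open>\<parallel>X\<^sub>k - p\<parallel>\<close> converge, simultaneously for all
  \<open>p\<close> of a countable dense set of zeros. A weak cluster point of \<open>Y\<^sub>k\<close> is then a zero, demiregularity makes
  the convergence of the subsequence strong, and convergence of the distances extends it to the whole sequence.\<close>

section \<open>Monotone operators and weak convergence in Hilbert spaces\<close>

text \<open>The formula for \<open>\<rho> k\<close> is reverse-engineered. One iteration leaves the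
  coefficient \<kappa> = 5 / (4 \<rho> (1 + L lam)) - 1 in front of -|X' - Z|^2, and in the limit
  the energy is coercive and strictly dissipative exactly when \<kappa> (1 - \<alpha>)^2 > \<alpha>
  (1 + \<alpha>), that is, when (\<kappa> + 1) (1 - \<alpha>)^2 > 2 \<alpha>^2 - \<alpha> + 1. With
  the given \<open>\<rho>\<close> the limit of the left side is the right side divided by 1 -
  \<open>\<epsilon>bar\<close>: this is the whole margin, and it is secured only for large k. The
  two batches act differently. The noise W at Z enters only through |W|^2, but the noise U at Y has
  a linear term whose coefficient Y - p already contains W and is unbounded. Replacing Y by a point
  computed without noise costs a product |W| |U|; dividing by 1 + H, which is known before the
  draws, bounds the coefficient. So only the noise needs moments, never the iterates. Each zero p
  has its own exceptional null set, hence the restriction to countably many zeros.\<close>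

text \<open>Completeness replaces compactness: the quadratic term makes a minimizing sequence Cauchy
  in the first component, and the second component converges because the objective does.
  \<open>C\<close> plays the role of the epigraph of a convex function that may be infinite
  somewhere. The surplus \<open>(norm (w - w0))\<^sup>2 / 2\<close> is what the applications (Minty,
  Riesz) exploit.\<close>

lemma strongly_convex_minimizer:
  fixes C :: "('a::{real_inner,banach} \<times> real) set"
  assumes "closed C" "convex C" "C \<noteq> {}"
    and lower: "\<And>w r. (w, r) \<in> C \<Longrightarrow> b \<le> r + (norm w)\<^sup>2 / 2"
  obtains w0 r0 where "(w0, r0) \<in> C"
    "\<And>w r. (w, r) \<in> C \<Longrightarrow> r0 + (norm w0)\<^sup>2 / 2 + (norm (w - w0))\<^sup>2 / 2 \<le> r + (norm w)\<^sup>2 / 2"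
proof -
  define g :: "'a \<times> real \<Rightarrow> real" where "g c = snd c + (norm (fst c))\<^sup>2 / 2" for c
  define m where "m = Inf (g ` C)"
  have bdd: "bdd_below (g ` C)"
    unfolding bdd_below_def g_def using lower by (intro exI[of _ b]) auto
  have m_le: "m \<le> g c" if "c \<in> C" for c
    unfolding m_def using bdd that by (intro cInf_lower) auto
  \<comment> \<open>\<open>snd\<close> is affine, and for half the squared norm the convexity defect
    on a segment is exactly t (1 - t) / 2 times the squared length.\<close>
  have segment: "m \<le> (1 - t) * g c + t * g c' - t * (1 - t) / 2 * (norm (fst c' - fst c))\<^sup>2"
    if "c \<in> C" "c' \<in> C" "0 \<le> t" "t \<le> 1" for c c' t
  proof -
    have "(1 - t) *\<^sub>R c + t *\<^sub>R c' \<in> C"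
      using \<open>convex C\<close> that by (intro convexD) auto
    from m_le[OF this] show ?thesis
      unfolding g_def
      by (simp add: power2_norm_eq_inner inner_add inner_diff inner_commute field_simps)
  qed
  have "\<exists>c\<in>C. g c < m + 1 / real (Suc n)" for n
    using cInf_lessD[of "g ` C" "m + 1 / real (Suc n)"] \<open>C \<noteq> {}\<close> by (auto simp: m_def)
  then obtain c where cC: "\<And>n. c n \<in> C" and c: "\<And>n. g (c n) < m + 1 / real (Suc n)"
    by metis
  have g_lim: "(\<lambda>n. g (c n)) \<longlonglongrightarrow> m"
  proof (rule tendsto_sandwich)
    show "\<forall>\<^sub>F n in sequentially. m \<le> g (c n)" using m_le cC by simp
    show "\<forall>\<^sub>F n in sequentially. g (c n) \<le> m + 1 / real (Suc n)" using c by (simp add: less_imp_le)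
    show "(\<lambda>n. m + 1 / real (Suc n)) \<longlonglongrightarrow> m"
      using tendsto_add[OF tendsto_const[of m] LIMSEQ_Suc[OF lim_1_over_n]] by simp
  qed simp
  have dist: "(norm (fst (c i) - fst (c j)))\<^sup>2 \<le> 4 * ((g (c i) - m) + (g (c j) - m))" for i j
    using segment[OF cC[of j] cC[of i], of "1/2"] by (simp add: field_simps)
  have "Cauchy (\<lambda>n. fst (c n))"
  proof (rule metric_CauchyI)
    fix e :: real assume e: "0 < e"
    then have "\<forall>\<^sub>F n in sequentially. g (c n) < m + e\<^sup>2 / 8"
      using g_lim by (intro order_tendstoD(2)[of _ m]) auto
    then obtain N where N: "\<And>n. N \<le> n \<Longrightarrow> g (c n) < m + e\<^sup>2 / 8"
      by (auto simp: eventually_sequentially)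
    show "\<exists>N. \<forall>i\<ge>N. \<forall>j\<ge>N. dist (fst (c i)) (fst (c j)) < e"
    proof (intro exI[of _ N] allI impI)
      fix i j assume "N \<le> i" "N \<le> j"
      then have "(norm (fst (c i) - fst (c j)))\<^sup>2 < e\<^sup>2"
        using dist[of i j] N[of i] N[of j] by simp
      then show "dist (fst (c i)) (fst (c j)) < e"
        using e by (simp add: dist_norm power_less_imp_less_base)
    qed
  qed
  then obtain w0 where w0: "(\<lambda>n. fst (c n)) \<longlonglongrightarrow> w0"
    by (auto simp: Cauchy_convergent_iff convergent_def)
  define r0 where "r0 = m - (norm w0)\<^sup>2 / 2"
  have "(\<lambda>n. g (c n) - (norm (fst (c n)))\<^sup>2 / 2) \<longlonglongrightarrow> r0"
    unfolding r0_def by (intro tendsto_intros g_lim w0) auto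
  then have "(\<lambda>n. snd (c n)) \<longlonglongrightarrow> r0"
    by (simp add: g_def)
  from tendsto_Pair[OF w0 this] have "c \<longlonglongrightarrow> (w0, r0)" by simp
  then have in_C: "(w0, r0) \<in> C"
    using \<open>closed C\<close> cC closed_sequentially by blast
  moreover have "r0 + (norm w0)\<^sup>2 / 2 + (norm (w - w0))\<^sup>2 / 2 \<le> r + (norm w)\<^sup>2 / 2"
    if wr: "(w, r) \<in> C" for w r
  proof -
    \<comment> \<open>Division of the segment inequality by t leaves a factor 1 - t, which the limit
      t -> 0 removes.\<close>
    have "m + (1 - t) / 2 * (norm (w - w0))\<^sup>2 \<le> g (w, r)" if "0 < t" "t < 1" for t
    proof -
      have "t * (m + (1 - t) / 2 * (norm (w - w0))\<^sup>2) \<le> t * g (w, r)"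
        using segment[OF in_C wr, of t] that
        by (simp add: g_def r0_def field_simps)
      then show ?thesis using that by simp
    qed
    then have ev: "\<forall>\<^sub>F t in at_right 0. m + (1 - t) / 2 * (norm (w - w0))\<^sup>2 \<le> g (w, r)"
      by (intro eventually_at_rightI[of 0 1]) auto
    have "((\<lambda>t. m + (1 - t) / 2 * (norm (w - w0))\<^sup>2) \<longlongrightarrow> m + (1 - 0) / 2 * (norm (w - w0))\<^sup>2)
        (at_right 0)"
      by (intro tendsto_intros) simp_all
    from tendsto_upperbound[OF this ev] show ?thesis
      by (simp add: g_def r0_def field_simps)
  qed
  ultimately show ?thesis using that by blast
qed

lemma maximally_monotone_nonneg:
  assumes "maximally_monotone T" "u \<in> T x" "v \<in> T y"
  shows "0 \<le> inner (x - y) (u - v)"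
  using assms unfolding maximally_monotone_def monotone_operator_def by blast

lemma maximally_monotoneD:
  assumes T: "maximally_monotone T" and rel: "\<And>y v. v \<in> T y \<Longrightarrow> 0 \<le> inner (x - y) (u - v)"
  shows "u \<in> T x"
proof -
  let ?T' = "T(x := insert u (T x))"
  have "monotone_operator ?T'"
    unfolding monotone_operator_def
  proof (intro allI impI)
    fix y z v w assume "v \<in> ?T' y" "w \<in> ?T' z"
    then consider "v \<in> T y" "w \<in> T z" | "y = x" "v = u" "w \<in> T z"
      | "v \<in> T y" "z = x" "w = u" | "y = x" "v = u" "z = x" "w = u"
      by (auto split: if_splits)
    then show "0 \<le> inner (y - z) (v - w)"
    proof cases
      case 3
      then show ?thesis using rel[of v y] by (simp add: inner_diff inner_commute)
    qed (use maximally_monotone_nonneg[OF T] rel in auto)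
  qed
  then have "?T' = T"
    using T unfolding maximally_monotone_def by auto
  then have "?T' x = T x" by simp
  then show ?thesis by auto
qed

text \<open>The pairs \<open>(x, u)\<close> with \<open>r\<close> form the epigraph of the Fitzpatrick function of \<open>T\<close>, which
  dominates \<open>inner x u\<close> by maximality. A minimizer of that function plus half the squared norm
  is, up to sign and swapping the components, monotonically related to \<open>T\<close>.\<close>

lemma Minty_zero:
  fixes G :: "('a::{real_inner,banach} \<times> 'a) set"
  assumes mono: "\<And>x u y v. (x, u) \<in> G \<Longrightarrow> (y, v) \<in> G \<Longrightarrow> 0 \<le> inner (x - y) (u - v)"
    and maximal: "\<And>x u. (\<And>y v. (y, v) \<in> G \<Longrightarrow> 0 \<le> inner (x - y) (u - v)) \<Longrightarrow> (x, u) \<in> G"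
  shows "\<exists>x. (x, - x) \<in> G"
proof -
  define C :: "(('a \<times> 'a) \<times> real) set"
    where "C = (\<Inter>(y, v)\<in>G. {c. inner (fst (fst c)) v + inner y (snd (fst c)) - inner y v \<le> snd c})"
  have C_iff: "((x, u), r) \<in> C \<longleftrightarrow> (\<forall>(y, v)\<in>G. inner x v + inner y u - inner y v \<le> r)" for x u r
    by (auto simp: C_def)
  have "closed C"
    unfolding C_def by (auto intro!: closed_INT closed_Collect_le continuous_intros)
  moreover have "convex C"
    unfolding C_def
  proof (intro convex_INT, clarify)
    fix y v :: 'a
    have *: "{c :: ('a \<times> 'a) \<times> real. inner (fst (fst c)) v + inner y (snd (fst c)) - inner y v \<le> snd c}
      = {c. inner ((v, y), - 1) c \<le> inner y v}"
      by (auto simp: inner_prod_def inner_commute)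
    show "convex {c :: ('a \<times> 'a) \<times> real. inner (fst (fst c)) v + inner y (snd (fst c)) - inner y v \<le> snd c}"
      unfolding * by (rule convex_halfspace_le)
  qed
  moreover have graph: "((x, u), inner x u) \<in> C" if "(x, u) \<in> G" for x u
    unfolding C_iff using mono[OF that] by (auto simp: inner_diff inner_commute algebra_simps)
  moreover have dominates: "inner x u \<le> r" if "((x, u), r) \<in> C" for x u r
  proof (cases "(x, u) \<in> G")
    case True
    then show ?thesis using that unfolding C_iff by force
  next
    case False
    then obtain y v where "(y, v) \<in> G" "inner (x - y) (u - v) < 0"
      using maximal[of x u] by force
    then show ?thesis using that unfolding C_iff
      by (auto simp: inner_diff inner_commute algebra_simps)
  qed
  \<comment> \<open>Every pair is vacuously related to an empty \<open>G\<close>, hence would be a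
    member.\<close>
  moreover have "G \<noteq> {}" using maximal by auto
  then have "C \<noteq> {}" using graph by fastforce
  moreover have nonneg: "0 \<le> r + (norm w)\<^sup>2 / 2" if "(w, r) \<in> C" for w r
  proof -
    have "0 \<le> (norm (fst w + snd w))\<^sup>2" by simp
    then show ?thesis
      using dominates[of "fst w" "snd w" r] that
      by (simp add: norm_prod_def power2_norm_eq_inner inner_add inner_commute field_simps)
  qed
  ultimately obtain w0 r0 where w0: "(w0, r0) \<in> C" and
    min: "\<And>w r. (w, r) \<in> C \<Longrightarrow> r0 + (norm w0)\<^sup>2 / 2 + (norm (w - w0))\<^sup>2 / 2 \<le> r + (norm w)\<^sup>2 / 2"
    using strongly_convex_minimizer[of C 0] by blast
  obtain x0 u0 where [simp]: "w0 = (x0, u0)" by fastforce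
  have [simp]: "(norm w)\<^sup>2 = (norm (fst w))\<^sup>2 + (norm (snd w))\<^sup>2" for w :: "'a \<times> 'a"
    by (simp add: norm_prod_def)
  \<comment> \<open>By \<open>nonneg\<close> the minimum is at least 0. In the comparison with a
    graph point of height \<open>inner y v\<close> the squares of y and v cancel; adding
    \<open>inner x0 u0\<close> on both sides gives the product form.\<close>
  have rel: "(norm (x0 + u0))\<^sup>2 / 2 \<le> inner (y + u0) (v + x0)" if "(y, v) \<in> G" for y v
    using min[OF graph[OF that]] nonneg[OF w0]
    by (simp add: power2_norm_eq_inner inner_add inner_diff inner_commute field_simps)
  have "(- u0, - x0) \<in> G"
  proof (rule maximal)
    fix y v assume "(y, v) \<in> G"
    from rel[OF this] have "0 \<le> inner (y + u0) (v + x0)"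
      by (rule order_trans[rotated]) simp
    then show "0 \<le> inner (- u0 - y) (- x0 - v)"
      by (simp add: inner_diff inner_add algebra_simps)
  qed
  \<comment> \<open>At the pair just found the right-hand side of \<open>rel\<close> is 0.\<close>
  moreover from rel[OF this] have "x0 + u0 = 0" by simp
  ultimately show ?thesis by (auto simp: add_eq_0_iff2 intro!: exI[of _ "- u0"])
qed

section \<open>Resolvents of maximally monotone operators\<close>

text \<open>\<open>Minty_zero\<close> applied to the graph of \<open>T\<close> with its argument
  translated by z and its values scaled by c; maximality survives both changes.\<close>

lemma resolvent_exists:
  fixes T :: "'a::{real_inner,banach} \<Rightarrow> 'a set"
  assumes T: "maximally_monotone T" and c: "0 < c"
  shows "\<exists>x. (1 / c) *\<^sub>R (z - x) \<in> T x"
proof -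
  define G where "G = {(x, u). (1 / c) *\<^sub>R u \<in> T (x + z)}"
  have "\<exists>x. (x, - x) \<in> G"
  proof (rule Minty_zero)
    fix x u y v assume "(x, u) \<in> G" "(y, v) \<in> G"
    then have "0 \<le> inner (x + z - (y + z)) ((1 / c) *\<^sub>R u - (1 / c) *\<^sub>R v)"
      unfolding G_def by (intro maximally_monotone_nonneg[OF T]) auto
    also have "\<dots> = inner (x - y) (u - v) / c"
      by (simp add: inner_diff_right diff_divide_distrib)
    finally show "0 \<le> inner (x - y) (u - v)"
      using c by (simp add: zero_le_divide_iff)
  next
    fix x u assume rel: "\<And>y v. (y, v) \<in> G \<Longrightarrow> 0 \<le> inner (x - y) (u - v)"
    have "(1 / c) *\<^sub>R u \<in> T (x + z)"
    proof (rule maximally_monotoneD[OF T])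
      fix y v assume "v \<in> T y"
      then have "(y - z, c *\<^sub>R v) \<in> G" using c by (simp add: G_def)
      from rel[OF this] have "0 \<le> inner (x + z - y) (u - c *\<^sub>R v) / c"
        using c by (simp add: algebra_simps)
      also have "\<dots> = inner (x + z - y) ((1 / c) *\<^sub>R u - v)"
        using c by (simp add: inner_diff field_simps)
      finally show "0 \<le> inner (x + z - y) ((1 / c) *\<^sub>R u - v)" .
    qed
    then show "(x, u) \<in> G" by (simp add: G_def)
  qed
  then obtain x where "(1 / c) *\<^sub>R (- x) \<in> T (x + z)" by (auto simp: G_def)
  then show ?thesis by (intro exI[of _ "x + z"]) simp
qed

text \<open>Phrased for graph points rather than for \<open>resolvent\<close>, because the case z =
  z' is the uniqueness that gives \<open>the_elem\<close> in the definition of the resolvent its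
  meaning.\<close>

lemma resolvent_nonexpansive_graph:
  assumes "maximally_monotone T" "0 < c"
    "(1 / c) *\<^sub>R (z - x) \<in> T x" "(1 / c) *\<^sub>R (z' - x') \<in> T x'"
  shows "norm (x - x') \<le> norm (z - z')"
proof -
  have "0 \<le> inner (x - x') ((1 / c) *\<^sub>R (z - x) - (1 / c) *\<^sub>R (z' - x'))"
    using assms by (intro maximally_monotone_nonneg)
  also have "\<dots> = inner (x - x') ((z - x) - (z' - x')) / c"
    by (simp add: inner_diff_right diff_divide_distrib)
  finally have "inner (x - x') (x - x') \<le> inner (x - x') (z - z')"
    using assms(2) by (simp add: zero_le_divide_iff inner_diff algebra_simps)
  also have "\<dots> \<le> norm (x - x') * norm (z - z')"
    by (rule norm_cauchy_schwarz)
  finally show ?thesis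
    by (cases "x = x'") (auto simp: dot_square_norm power2_eq_square)
qed

lemma resolvent_in_graph:
  fixes T :: "'a::{real_inner,banach} \<Rightarrow> 'a set"
  assumes T: "maximally_monotone T" and c: "0 < c"
  shows "(1 / c) *\<^sub>R (z - resolvent c T z) \<in> T (resolvent c T z)"
proof -
  obtain x where x: "(1 / c) *\<^sub>R (z - x) \<in> T x"
    using resolvent_exists[OF assms] by blast
  have mem_iff: "z \<in> op_sum (op_of_fun id) (op_scale c T) y \<longleftrightarrow> (1 / c) *\<^sub>R (z - y) \<in> T y" for y
  proof -
    have *: "z = y + c *\<^sub>R u \<longleftrightarrow> u = (1 / c) *\<^sub>R (z - y)" for u
    proof
      assume "u = (1 / c) *\<^sub>R (z - y)"
      then show "z = y + c *\<^sub>R u" using c by simp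
    qed (use c in simp)
    have "z \<in> op_sum (op_of_fun id) (op_scale c T) y \<longleftrightarrow> (\<exists>u\<in>T y. z = y + c *\<^sub>R u)"
      by (auto simp: op_sum_def op_of_fun_def op_scale_def)
    then show ?thesis unfolding * by simp
  qed
  have "y = x" if "(1 / c) *\<^sub>R (z - y) \<in> T y" for y
    using resolvent_nonexpansive_graph[OF assms that x] by simp
  then have "op_inverse (op_sum (op_of_fun id) (op_scale c T)) z = {x}"
    unfolding op_inverse_def mem_iff using x by blast
  then show ?thesis using x by (simp add: resolvent_def)
qed

lemma resolvent_nonexpansive:
  fixes T :: "'a::{real_inner,banach} \<Rightarrow> 'a set"
  assumes "maximally_monotone T" "0 < c"
  shows "norm (resolvent c T z - resolvent c T z') \<le> norm (z - z')"
  using assms by (intro resolvent_nonexpansive_graph[OF assms] resolvent_in_graph)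

lemma resolvent_eqI:
  fixes T :: "'a::{real_inner,banach} \<Rightarrow> 'a set"
  assumes "maximally_monotone T" "0 < c" "(1 / c) *\<^sub>R (z - x) \<in> T x"
  shows "resolvent c T z = x"
  using resolvent_nonexpansive_graph[OF assms(1,2) resolvent_in_graph[OF assms(1,2), of z] assms(3)]
  by simp

lemma continuous_on_resolvent:
  fixes T :: "'a::{real_inner,banach} \<Rightarrow> 'a set"
  assumes "maximally_monotone T" "0 < c"
  shows "continuous_on UNIV (resolvent c T)"
proof -
  have "1-lipschitz_on UNIV (resolvent c T)"
    using resolvent_nonexpansive[OF assms] by (intro lipschitz_onI) (auto simp: dist_norm)
  then show ?thesis by (rule lipschitz_on_continuous_on)
qed

section \<open>Riesz representation and weak sequential compactness\<close>

text \<open>Minimize (norm w)^2 / 2 - f w, with the epigraph of -f as \<open>C\<close>. The surplus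
  at the minimizer x cancels the square of the displacement and leaves f z <= inner x z; replacing z
  by -z gives equality.\<close>

lemma Riesz_representation:
  fixes f :: "'a::{real_inner,banach} \<Rightarrow> real"
  assumes f: "bounded_linear f"
  obtains x where "\<And>z. f z = inner x z"
proof -
  interpret bounded_linear f by fact
  define C where "C = {c. - f (fst c) \<le> snd c}"
  have "closed C" unfolding C_def
    by (intro closed_Collect_le continuous_intros bounded_linear.continuous_on[OF f])
  moreover have "convex C"
  proof (rule convexI)
    fix c d and s t :: real assume *: "c \<in> C" "d \<in> C" "0 \<le> s" "0 \<le> t" "s + t = 1"
    have "s * - f (fst c) \<le> s * snd c" "t * - f (fst d) \<le> t * snd d"
      using * by (auto simp only: C_def mem_Collect_eq intro!: mult_left_mono)
    then show "s *\<^sub>R c + t *\<^sub>R d \<in> C" by (simp add: C_def add scaleR)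
  qed
  moreover have "C \<noteq> {}" by (auto simp: C_def intro!: exI[of _ "0"] simp: zero)
  moreover obtain K where K: "\<And>x. norm (f x) \<le> norm x * K"
    using bounded by blast
  \<comment> \<open>Young's inequality applied to |f w| <= norm w * K bounds the objective
    below.\<close>
  have "- (K\<^sup>2) / 2 \<le> r + (norm w)\<^sup>2 / 2" if "(w, r) \<in> C" for w r
  proof -
    have "0 \<le> (norm w - K)\<^sup>2" by simp
    then have "2 * (norm w * K) \<le> (norm w)\<^sup>2 + K\<^sup>2" by (simp add: power2_diff)
    then show ?thesis using that K[of w] by (simp add: C_def abs_le_iff)
  qed
  ultimately obtain x r where "(x, r) \<in> C" and
    min: "\<And>w s. (w, s) \<in> C \<Longrightarrow> r + (norm x)\<^sup>2 / 2 + (norm (w - x))\<^sup>2 / 2 \<le> s + (norm w)\<^sup>2 / 2"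
    using strongly_convex_minimizer[of C] by blast
  then have r: "- f x \<le> r" by (simp add: C_def)
  have le: "f z \<le> inner x z" for z
    using min[of "x + z" "- f (x + z)"] r
    by (simp add: C_def add power2_norm_eq_inner inner_add inner_commute field_simps)
  have "f z = inner x z" for z
    using le[of z] le[of "- z"] by (simp add: linear_neg[OF bounded_linear.linear[OF f]])
  then show ?thesis using that by blast
qed

text \<open>Separability reduces the claim to countably many test vectors, which a diagonal
  subsequence handles; boundedness of y carries convergence over to their closure.\<close>

lemma bounded_imp_inner_convergent_subseq:
  fixes y :: "nat \<Rightarrow> 'a::{real_inner,second_countable_topology}"
  assumes y: "bounded (range y)"
  obtains r where "strict_mono r" "\<And>z. convergent (\<lambda>n. inner (y (r n)) z)"
proof -
  obtain K where K: "\<And>n. norm (y n) \<le> K"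
    using y by (auto simp: bounded_iff)
  have "0 \<le> K" using K[of 0] norm_ge_zero order_trans by blast
  obtain D :: "'a set" where D: "countable D" "\<And>X. open X \<Longrightarrow> X \<noteq> {} \<Longrightarrow> \<exists>d\<in>D. d \<in> X"
    using countable_dense_setE by blast
  then have "D \<noteq> {}" using D(2)[of UNIV] by auto
  interpret subseqs "\<lambda>i s. convergent (\<lambda>n. inner (y (s n)) (from_nat_into D i))"
  proof
    fix i :: nat and s :: "nat \<Rightarrow> nat"
    have "\<bar>inner (y (s n)) (from_nat_into D i)\<bar> \<le> K * norm (from_nat_into D i)" for n
      by (rule order_trans[OF Cauchy_Schwarz_ineq2 mult_right_mono[OF K norm_ge_zero]])
    then have "bounded (range (\<lambda>n. inner (y (s n)) (from_nat_into D i)))"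
      by (auto simp: bounded_iff)
    then show "\<exists>r'. strict_mono r' \<and> convergent (\<lambda>n. inner (y ((s \<circ> r') n)) (from_nat_into D i))"
      using bounded_imp_convergent_subsequence[of "\<lambda>n. inner (y (s n)) (from_nat_into D i)"]
      by (auto simp: convergent_def o_def)
  qed
  have dense: "convergent (\<lambda>n. inner (y (diagseq n)) d)" if "d \<in> D" for d
  proof -
    obtain i where i: "from_nat_into D i = d"
      using from_nat_into_surj[OF D(1) \<open>d \<in> D\<close>] by blast
    \<comment> \<open>The diagonal sequence is a subsequence of the i-th one only beyond index i,
      hence the shift by Suc i.\<close>
    have "convergent (\<lambda>n. inner (y ((diagseq \<circ> ((+) (Suc i))) n)) (from_nat_into D i))"
      by (rule diagseq_holds)
        (auto simp: o_def intro: convergent_subseq_convergent[unfolded o_def])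
    then have "convergent (\<lambda>n. inner (y (diagseq (n + Suc i))) d)"
      by (simp add: o_def i add.commute)
    then show ?thesis
      using convergent_ignore_initial_segment[of "\<lambda>n. inner (y (diagseq n)) d" "Suc i"] by blast
  qed
  have "Cauchy (\<lambda>n. inner (y (diagseq n)) z)" for z
  proof (rule metric_CauchyI)
    fix e :: real assume e: "0 < e"
    \<comment> \<open>K + 1 instead of K avoids a division by zero; replacing z by d then costs less
      than e / 3 at each of the two indices.\<close>
    define \<delta> where "\<delta> = e / (3 * (K + 1))"
    have "0 < \<delta>" using e \<open>0 \<le> K\<close> by (simp add: \<delta>_def)
    then obtain d where d: "d \<in> D" "dist z d < \<delta>"
      using D(2)[of "ball z \<delta>"] by auto
    have close: "\<bar>inner (y n) z - inner (y n) d\<bar> < e / 3" for n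
    proof -
      have "\<bar>inner (y n) z - inner (y n) d\<bar> \<le> norm (y n) * norm (z - d)"
        using Cauchy_Schwarz_ineq2[of "y n" "z - d"] by (simp add: inner_diff_right)
      also have "\<dots> \<le> K * \<delta>"
        using K[of n] d(2) \<open>0 \<le> K\<close> by (intro mult_mono) (auto simp: dist_norm)
      also have "\<dots> < (K + 1) * \<delta>" using \<open>0 < \<delta>\<close> by simp
      also have "\<dots> = e / 3" using \<open>0 \<le> K\<close> by (simp add: \<delta>_def field_simps)
      finally show ?thesis .
    qed
    have "Cauchy (\<lambda>n. inner (y (diagseq n)) d)"
      using dense[OF d(1)] by (rule convergent_Cauchy)
    then obtain N where N: "\<And>i j. N \<le> i \<Longrightarrow> N \<le> j \<Longrightarrow>
        dist (inner (y (diagseq i)) d) (inner (y (diagseq j)) d) < e / 3"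
      using e by (meson metric_CauchyD divide_pos_pos zero_less_numeral)
    show "\<exists>N. \<forall>i\<ge>N. \<forall>j\<ge>N. dist (inner (y (diagseq i)) z) (inner (y (diagseq j)) z) < e"
    proof (intro exI[of _ N] allI impI)
      fix i j assume "N \<le> i" "N \<le> j"
      from N[OF this] close[of "diagseq i"] close[of "diagseq j"]
      show "dist (inner (y (diagseq i)) z) (inner (y (diagseq j)) z) < e"
        unfolding dist_real_def by linarith
    qed
  qed
  then show ?thesis
    using that[OF subseq_diagseq] by (simp add: Cauchy_convergent_iff)
qed

lemma bounded_imp_weakly_convergent_subseq:
  fixes y :: "nat \<Rightarrow> 'a::{real_inner,banach,second_countable_topology}"
  assumes y: "bounded (range y)"
  obtains l r where "strict_mono r" "weakly_tendsto (y \<circ> r) l"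
proof -
  obtain r where r: "strict_mono r" and conv: "\<And>z. convergent (\<lambda>n. inner (y (r n)) z)"
    using bounded_imp_inner_convergent_subseq[OF y] by blast
  define f where "f z = lim (\<lambda>n. inner (y (r n)) z)" for z
  have f: "(\<lambda>n. inner (y (r n)) z) \<longlonglongrightarrow> f z" for z
    unfolding f_def using conv by (simp add: convergent_LIMSEQ_iff)
  obtain K where K: "\<And>n. norm (y n) \<le> K"
    using y by (auto simp: bounded_iff)
  have "bounded_linear f"
  proof (rule bounded_linear_intro)
    show "f (x + z) = f x + f z" for x z
      using f[of "x + z"] tendsto_add[OF f[of x] f[of z]]
      by (auto simp: inner_add_right intro: LIMSEQ_unique)
    show "f (c *\<^sub>R x) = c *\<^sub>R f x" for c x
      using f[of "c *\<^sub>R x"] tendsto_mult_left[OF f[of x], of c]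
      by (auto intro: LIMSEQ_unique)
    have "\<bar>inner (y (r n)) x\<bar> \<le> norm x * K" for n x
      using order_trans[OF Cauchy_Schwarz_ineq2 mult_right_mono[OF K norm_ge_zero]]
      by (simp add: mult.commute)
    then show "norm (f x) \<le> norm x * K" for x
      using tendsto_rabs[OF f[of x]] by (intro tendsto_upperbound[of _ _ sequentially]) auto
  qed
  then obtain l where "\<And>z. f z = inner l z"
    using Riesz_representation by blast
  then have "weakly_tendsto (y \<circ> r) l"
    using f by (simp add: weakly_tendsto_def)
  with r show ?thesis using that by blast
qed

lemma weakly_tendsto_inner_tendsto:
  assumes y: "weakly_tendsto y l" "bounded (range y)" and u: "u \<longlonglongrightarrow> u0"
  shows "(\<lambda>n. inner (y n) (u n)) \<longlonglongrightarrow> inner l u0"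
proof -
  obtain K where K: "\<And>n. norm (y n) \<le> K"
    using y by (auto simp: bounded_iff)
  have "(\<lambda>n. inner (y n) (u n - u0)) \<longlonglongrightarrow> 0"
  proof (rule Lim_null_comparison)
    show "\<forall>\<^sub>F n in sequentially. norm (inner (y n) (u n - u0)) \<le> K * norm (u n - u0)"
      using order_trans[OF Cauchy_Schwarz_ineq2 mult_right_mono[OF K norm_ge_zero]]
      by (intro always_eventually allI) simp
    show "(\<lambda>n. K * norm (u n - u0)) \<longlonglongrightarrow> 0"
      using tendsto_mult_left[OF tendsto_norm[OF LIM_zero[OF u]], of K] by simp
  qed
  moreover have "(\<lambda>n. inner (y n) u0) \<longlonglongrightarrow> inner l u0"
    using y(1) by (simp add: weakly_tendsto_def)
  ultimately have "(\<lambda>n. inner (y n) (u n - u0) + inner (y n) u0) \<longlonglongrightarrow> 0 + inner l u0"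
    by (rule tendsto_add)
  then show ?thesis by (simp add: inner_diff_right)
qed

section \<open>Weak limits and zeros of T + V\<close>

text \<open>Surjectivity of Id + c (T + V) for small c, which stands in for maximality of the sum.
  The map w -> J(x - c V w) is a contraction with constant c L, and its fixed point solves the
  inclusion.\<close>

lemma regularized_zero_exists:
  fixes T :: "'a::{real_inner,banach} \<Rightarrow> 'a set"
  assumes T: "maximally_monotone T" and V: "L-lipschitz_on UNIV V" and c: "0 < c" "c * L < 1"
  shows "\<exists>w. (1 / c) *\<^sub>R (x - w) - V w \<in> T w"
proof -
  have L: "0 \<le> L" using V by (rule lipschitz_on_nonneg)
  have "\<exists>!w. resolvent c T (x - c *\<^sub>R V w) = w"
  proof (rule banach_fix_type[where c = "c * L"])
    show "\<forall>w. \<forall>v. dist (resolvent c T (x - c *\<^sub>R V w)) (resolvent c T (x - c *\<^sub>R V v))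
        \<le> c * L * dist w v"
    proof (intro allI)
      fix w v
      have "dist (resolvent c T (x - c *\<^sub>R V w)) (resolvent c T (x - c *\<^sub>R V v))
          \<le> norm ((x - c *\<^sub>R V w) - (x - c *\<^sub>R V v))"
        unfolding dist_norm by (rule resolvent_nonexpansive[OF T c(1)])
      also have "\<dots> = norm (c *\<^sub>R (V v - V w))"
        by (simp add: algebra_simps)
      also have "\<dots> = c * dist (V w) (V v)"
        using c(1) by (simp add: dist_norm norm_minus_commute)
      also have "\<dots> \<le> c * (L * dist w v)"
        using lipschitz_onD[OF V, of w v] c(1) by (intro mult_left_mono) auto
      finally show "dist (resolvent c T (x - c *\<^sub>R V w)) (resolvent c T (x - c *\<^sub>R V v))
        \<le> c * L * dist w v" by simp
    qed
  qed (use c L in auto)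
  then obtain w where "resolvent c T (x - c *\<^sub>R V w) = w" by blast
  then have "(1 / c) *\<^sub>R (x - c *\<^sub>R V w - w) \<in> T w"
    using resolvent_in_graph[OF T c(1), of "x - c *\<^sub>R V w"] by simp
  also have "(1 / c) *\<^sub>R (x - c *\<^sub>R V w - w) = (1 / c) *\<^sub>R (x - w) - V w"
    using c(1) by (simp add: algebra_simps)
  finally show ?thesis by blast
qed

lemma monotone_op_of_fun:
  assumes "maximally_monotone (op_of_fun V)"
  shows "0 \<le> inner (x - y) (V x - V y)"
  using maximally_monotone_nonneg[OF assms] by (auto simp: op_of_fun_def)

lemma op_sum_op_of_fun_iff: "u \<in> op_sum T (op_of_fun V) x \<longleftrightarrow> u - V x \<in> T x"
  for u :: "'a::group_add"
proof
  assume "u - V x \<in> T x"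
  then have "\<exists>a b. u = a + b \<and> a \<in> T x \<and> b \<in> op_of_fun V x"
    by (intro exI[of _ "u - V x"] exI[of _ "V x"]) (simp add: op_of_fun_def)
  then show "u \<in> op_sum T (op_of_fun V) x" by (simp add: op_sum_def)
qed (auto simp: op_sum_def op_of_fun_def)

text \<open>The graph inequalities at y n pass to the limit because one factor converges weakly and
  boundedly and the other strongly. The limit x is thus monotonically related to the graph of the
  sum, and one well-chosen test point turns this into membership.\<close>

lemma weak_limit_in_op_zeros:
  fixes T :: "'a::{real_inner,banach} \<Rightarrow> 'a set"
  assumes T: "maximally_monotone T" and V: "maximally_monotone (op_of_fun V)"
    and lip: "L-lipschitz_on UNIV V"
    and u: "\<And>n. u n \<in> op_sum T (op_of_fun V) (y n)" "u \<longlonglongrightarrow> 0"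
    and y: "weakly_tendsto y x" "bounded (range y)"
  shows "x \<in> op_zeros (op_sum T (op_of_fun V))"
proof -
  have L: "0 \<le> L" using lip by (rule lipschitz_on_nonneg)
  have rel: "0 \<le> inner (x - w) (- V w - v)" if v: "v \<in> T w" for w v
  proof -
    have "weakly_tendsto (\<lambda>n. y n - w) (x - w)"
      using y(1) by (simp add: weakly_tendsto_def inner_diff_left tendsto_diff)
    moreover have "bounded (range (\<lambda>n. y n - w))"
      using bounded_translation[OF y(2), of "- w"] by (simp add: image_image)
    moreover have "(\<lambda>n. u n + (- V w - v)) \<longlonglongrightarrow> 0 + (- V w - v)"
      using u(2) by (intro tendsto_intros)
    ultimately have "(\<lambda>n. inner (y n - w) (u n + (- V w - v))) \<longlonglongrightarrow> inner (x - w) (0 + (- V w - v))"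
      by (rule weakly_tendsto_inner_tendsto)
    moreover have "0 \<le> inner (y n - w) (u n + (- V w - v))" for n
    proof -
      have "0 \<le> inner (y n - w) (u n - V (y n) - v)"
        using u(1)[of n] v by (intro maximally_monotone_nonneg[OF T]) (simp_all add: op_sum_op_of_fun_iff)
      moreover have "0 \<le> inner (y n - w) (V (y n) - V w)"
        by (rule monotone_op_of_fun[OF V])
      ultimately show ?thesis by (simp add: inner_add inner_diff)
    qed
    ultimately show ?thesis
      using LIMSEQ_le_const[of _ "inner (x - w) (- V w - v)" 0] by simp
  qed
  \<comment> \<open>The test point w satisfies (x - w) / c in F w, so \<open>rel\<close> at w reads
    0 <= -|x - w|^2 / c and forces x = w.\<close>
  define c where "c = 1 / (L + 1)"
  have c: "0 < c" "c * L < 1" using L by (auto simp: c_def)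
  then obtain w where w: "(1 / c) *\<^sub>R (x - w) - V w \<in> T w"
    using regularized_zero_exists[OF T lip] by blast
  have "inner (x - w) (- V w - ((1 / c) *\<^sub>R (x - w) - V w)) = - ((norm (x - w))\<^sup>2 / c)"
    by (simp add: power2_norm_eq_inner inner_diff)
  with rel[OF w] c(1) have "x = w" by (simp add: divide_le_0_iff)
  with w show ?thesis by (simp add: op_zeros_def op_sum_op_of_fun_iff)
qed

section \<open>Convergence of square integrable martingales\<close>

lemma le_one_plus_square: "y \<le> 1 + y\<^sup>2" for y :: real
proof -
  have "0 \<le> (2 * y - 1)\<^sup>2" by simp
  then show ?thesis by (simp add: power2_diff power_mult_distrib)
qed

lemma integrable_mult_square_integrable:
  fixes f g :: "'a \<Rightarrow> real"
  assumes [measurable]: "f \<in> borel_measurable M" "g \<in> borel_measurable M"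
    and "integrable M (\<lambda>x. (f x)\<^sup>2)" "integrable M (\<lambda>x. (g x)\<^sup>2)"
  shows "integrable M (\<lambda>x. f x * g x)"
proof (rule Bochner_Integration.integrable_bound)
  show "integrable M (\<lambda>x. (f x)\<^sup>2 + (g x)\<^sup>2)" using assms by simp
  have "norm (f x * g x) \<le> norm ((f x)\<^sup>2 + (g x)\<^sup>2)" for x
  proof -
    have "0 \<le> (\<bar>f x\<bar> - \<bar>g x\<bar>)\<^sup>2" by simp
    then have "2 * (\<bar>f x\<bar> * \<bar>g x\<bar>) \<le> (f x)\<^sup>2 + (g x)\<^sup>2" by (simp add: power2_diff)
    moreover have "0 \<le> \<bar>f x\<bar> * \<bar>g x\<bar>" by simp
    ultimately have "\<bar>f x\<bar> * \<bar>g x\<bar> \<le> (f x)\<^sup>2 + (g x)\<^sup>2" by linarith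
    then show ?thesis by (simp add: abs_mult)
  qed
  then show "AE x in M. norm (f x * g x) \<le> norm ((f x)\<^sup>2 + (g x)\<^sup>2)" by simp
qed measurable

text \<open>A martingale difference sequence: orthogonality to the square integrable functions of the
  past replaces conditional expectations.\<close>

locale martingale_differences = prob_space M for M :: "'a measure" +
  fixes F :: "nat \<Rightarrow> 'a measure" and D :: "nat \<Rightarrow> 'a \<Rightarrow> real"
  assumes subalg: "\<And>k. subalgebra M (F k)"
    and filtration: "\<And>j k. j \<le> k \<Longrightarrow> sets (F j) \<subseteq> sets (F k)"
    and adapted: "\<And>j k. j < k \<Longrightarrow> D j \<in> borel_measurable (F k)"
    and square_integrable: "\<And>k. integrable M (\<lambda>x. (D k x)\<^sup>2)"
    and orthogonal: "\<And>k g. g \<in> borel_measurable (F k) \<Longrightarrow> integrable M (\<lambda>x. (g x)\<^sup>2)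
      \<Longrightarrow> expectation (\<lambda>x. g x * D k x) = 0"
begin

lemma space_F: "space (F k) = space M"
  using subalg by (simp add: subalgebra_def)

lemma measurable_D [measurable]: "D k \<in> borel_measurable M"
  using measurable_from_subalg[OF subalg adapted[of k "Suc k"]] by simp

lemma adapted_sum: "j \<le> k \<Longrightarrow> (\<lambda>x. \<Sum>i<j. D i x) \<in> borel_measurable (F k)"
  by (intro borel_measurable_sum adapted) auto

lemma sum_square:
  "integrable M (\<lambda>x. (\<Sum>i<n. D i x)\<^sup>2) \<and>
    expectation (\<lambda>x. (\<Sum>i<n. D i x)\<^sup>2) = (\<Sum>i<n. expectation (\<lambda>x. (D i x)\<^sup>2))"
proof (induction n)
  case (Suc n)
  have *: "(\<Sum>i<Suc n. D i x)\<^sup>2 = (\<Sum>i<n. D i x)\<^sup>2 + 2 * ((\<Sum>i<n. D i x) * D n x) + (D n x)\<^sup>2" for x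
    by (simp add: power2_sum algebra_simps)
  have "integrable M (\<lambda>x. (\<Sum>i<n. D i x) * D n x)"
    using Suc square_integrable by (intro integrable_mult_square_integrable) auto
  moreover have "expectation (\<lambda>x. (\<Sum>i<n. D i x) * D n x) = 0"
    using Suc by (intro orthogonal adapted_sum) auto
  ultimately show ?case
    unfolding * using Suc square_integrable[of n] by simp
qed simp

lemma shift: "martingale_differences M (\<lambda>k. F (n + k)) (\<lambda>k. D (n + k))"
proof
  show "subalgebra M (F (n + k))" for k by (rule subalg)
  show "sets (F (n + j)) \<subseteq> sets (F (n + k))" if "j \<le> k" for j k
    using that by (intro filtration) simp
  show "D (n + j) \<in> borel_measurable (F (n + k))" if "j < k" for j k
    using that by (intro adapted) simp
  show "integrable M (\<lambda>x. (D (n + k) x)\<^sup>2)" for k by (rule square_integrable)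
  show "expectation (\<lambda>x. g x * D (n + k) x) = 0"
    if "g \<in> borel_measurable (F (n + k))" "integrable M (\<lambda>x. (g x)\<^sup>2)" for k g
    using that by (rule orthogonal)
qed

text \<open>Stopping the sum once it has left the interval \<open>(-e, e)\<close> does not increase its variance.\<close>

lemma maximal_inequality:
  assumes e: "0 < e"
  shows "prob {x\<in>space M. \<exists>k\<le>n. e \<le> \<bar>\<Sum>i<k. D i x\<bar>} \<le> (\<Sum>i<n. expectation (\<lambda>x. (D i x)\<^sup>2)) / e\<^sup>2"
proof -
  define S where "S k x = (\<Sum>i<k. D i x)" for k x
  define B where "B k = {x\<in>space M. \<forall>j\<le>k. \<bar>S j x\<bar> < e}" for k
  \<comment> \<open>\<open>B k\<close> uses only the sums up to \<open>S k\<close>, whose last term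
    is \<open>D (k - 1)\<close>; it is therefore known before \<open>D k\<close>, and
    \<open>D'\<close> is again a martingale difference sequence.\<close>
  define D' where "D' k x = indicator (B k) x * D k x" for k x
  have S_meas: "S j \<in> borel_measurable (F k)" if "j \<le> k" for j k
    unfolding S_def using adapted_sum[OF that] .
  have S_M [measurable]: "S j \<in> borel_measurable M" for j
    unfolding S_def by measurable
  have B_meas: "B k \<in> sets (F k)" for k
  proof -
    have "B k = (\<Inter>j\<in>{..k}. {x\<in>space (F k). \<bar>S j x\<bar> < e})"
      by (auto simp: B_def space_F)
    also have "\<dots> \<in> sets (F k)"
      using S_meas by (intro sets.finite_INT) (auto intro!: borel_measurable_less borel_measurable_abs)
    finally show ?thesis .
  qed
  have B_M [measurable]: "B k \<in> sets M" for k
    using B_meas subalg by (auto simp: subalgebra_def)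
  have D'_sq: "(D' k x)\<^sup>2 = indicator (B k) x * (D k x)\<^sup>2" for k x
    by (simp add: D'_def indicator_def)
  have sq_int: "integrable M (\<lambda>x. (D' k x)\<^sup>2)" for k
    unfolding D'_sq using integrable_mult_indicator[OF B_M square_integrable, of k k] by simp
  interpret D': martingale_differences M F D'
  proof
    show "subalgebra M (F k)" for k by (rule subalg)
    show "sets (F j) \<subseteq> sets (F k)" if "j \<le> k" for j k using that by (rule filtration)
    show "integrable M (\<lambda>x. (D' k x)\<^sup>2)" for k by (rule sq_int)
    show "D' j \<in> borel_measurable (F k)" if "j < k" for j k
      unfolding D'_def using that B_meas[of j] filtration[of j k] adapted[OF that]
      by (intro borel_measurable_times borel_measurable_indicator) auto
    show "expectation (\<lambda>x. g x * D' k x) = 0"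
      if g: "g \<in> borel_measurable (F k)" "integrable M (\<lambda>x. (g x)\<^sup>2)" for g k
    proof -
      have "expectation (\<lambda>x. g x * indicator (B k) x * D k x) = 0"
      proof (rule orthogonal)
        show "(\<lambda>x. g x * indicator (B k) x) \<in> borel_measurable (F k)"
          using g(1) B_meas by measurable
        have "(g x * indicator (B k) x)\<^sup>2 = indicator (B k) x * (g x)\<^sup>2" for x
          by (simp add: indicator_def)
        then show "integrable M (\<lambda>x. (g x * indicator (B k) x)\<^sup>2)"
          using integrable_mult_indicator[OF B_M g(2), of k] by simp
      qed
      then show ?thesis by (simp add: D'_def mult.assoc)
    qed
  qed
  \<comment> \<open>From the first exit index onwards the stopped sum is frozen at a value outside
    the interval, so leaving at any time is visible at time n and Chebyshev's inequality applies
    there.\<close>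
  have stopped: "e \<le> \<bar>\<Sum>i<n. D' i x\<bar>" if x: "x \<in> space M" and exit: "\<exists>k\<le>n. e \<le> \<bar>S k x\<bar>" for x
  proof -
    define k where "k = (LEAST k. e \<le> \<bar>S k x\<bar>)"
    obtain k' where k': "k' \<le> n" "e \<le> \<bar>S k' x\<bar>" using exit by blast
    have k: "e \<le> \<bar>S k x\<bar>" "k \<le> n"
      unfolding k_def using LeastI[of "\<lambda>k. e \<le> \<bar>S k x\<bar>", OF k'(2)] Least_le[of "\<lambda>k. e \<le> \<bar>S k x\<bar>", OF k'(2)] k'(1)
      by auto
    have before: "\<bar>S j x\<bar> < e" if "j < k" for j
      using not_less_Least[of j "\<lambda>k. e \<le> \<bar>S k x\<bar>"] that by (auto simp: k_def)
    have "D' i x = (if i < k then D i x else 0)" for i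
      using k(1) before x by (auto simp: D'_def B_def indicator_def not_less)
    then have "(\<Sum>i<n. D' i x) = (\<Sum>i\<in>{..<n} \<inter> {i. i < k}. D i x)"
      by (simp add: sum.If_cases)
    also have "{..<n} \<inter> {i. i < k} = {..<k}" using k(2) by auto
    finally show ?thesis using k(1) by (simp add: S_def)
  qed
  have "e\<^sup>2 * prob {x\<in>space M. \<exists>k\<le>n. e \<le> \<bar>S k x\<bar>} = expectation (\<lambda>x. e\<^sup>2 * indicator {x\<in>space M. \<exists>k\<le>n. e \<le> \<bar>S k x\<bar>} x)"
    by simp
  also have "\<dots> \<le> expectation (\<lambda>x. (\<Sum>i<n. D' i x)\<^sup>2)"
  proof (rule integral_mono)
    show "integrable M (\<lambda>x. (\<Sum>i<n. D' i x)\<^sup>2)" using D'.sum_square by blast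
    show "e\<^sup>2 * indicator {x\<in>space M. \<exists>k\<le>n. e \<le> \<bar>S k x\<bar>} x \<le> (\<Sum>i<n. D' i x)\<^sup>2" if "x \<in> space M" for x
    proof (cases "\<exists>k\<le>n. e \<le> \<bar>S k x\<bar>")
      case True
      then have "e\<^sup>2 \<le> \<bar>\<Sum>i<n. D' i x\<bar>\<^sup>2"
        using stopped[OF that] e by (intro power_mono) auto
      then show ?thesis by (simp add: indicator_def)
    qed simp
  qed (simp add: emeasure_eq_measure)
  also have "\<dots> = (\<Sum>i<n. expectation (\<lambda>x. (D' i x)\<^sup>2))" using D'.sum_square by blast
  also have "\<dots> \<le> (\<Sum>i<n. expectation (\<lambda>x. (D i x)\<^sup>2))"
    by (intro sum_mono integral_mono sq_int square_integrable) (simp add: D'_sq indicator_def)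
  finally show ?thesis
    using e by (simp add: S_def field_simps)
qed

lemma maximal_inequality_tail:
  assumes e: "0 < e" and sum: "summable (\<lambda>i. expectation (\<lambda>x. (D i x)\<^sup>2))"
  shows "prob {x\<in>space M. \<exists>k. e \<le> \<bar>\<Sum>i<k. D (n + i) x\<bar>}
    \<le> (\<Sum>i. expectation (\<lambda>x. (D (n + i) x)\<^sup>2)) / e\<^sup>2"
proof -
  interpret shifted: martingale_differences M "\<lambda>k. F (n + k)" "\<lambda>k. D (n + k)" by (rule shift)
  define A where "A N = {x\<in>space M. \<exists>k\<le>N. e \<le> \<bar>\<Sum>i<k. D (n + i) x\<bar>}" for N
  have "(\<lambda>N. prob (A N)) \<longlonglongrightarrow> prob (\<Union>N. A N)"
  proof (rule finite_Lim_measure_incseq)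
    show "incseq A"
      by (rule incseq_SucI) (auto simp: A_def intro: le_SucI)
    have "A N \<in> events" for N unfolding A_def by measurable
    then show "range A \<subseteq> events" by blast
  qed
  moreover have "prob (A N) \<le> (\<Sum>i. expectation (\<lambda>x. (D (n + i) x)\<^sup>2)) / e\<^sup>2" for N
  proof -
    have "prob (A N) \<le> (\<Sum>i<N. expectation (\<lambda>x. (D (n + i) x)\<^sup>2)) / e\<^sup>2"
      unfolding A_def using e by (rule shifted.maximal_inequality)
    also have "\<dots> \<le> (\<Sum>i. expectation (\<lambda>x. (D (n + i) x)\<^sup>2)) / e\<^sup>2"
      using summable_ignore_initial_segment[OF sum, of n]
      by (intro divide_right_mono sum_le_suminf) (auto simp: add.commute)
    finally show ?thesis .
  qed
  ultimately have "prob (\<Union>N. A N) \<le> (\<Sum>i. expectation (\<lambda>x. (D (n + i) x)\<^sup>2)) / e\<^sup>2"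
    by (intro LIMSEQ_le_const2) auto
  also have "(\<Union>N. A N) = {x\<in>space M. \<exists>k. e \<le> \<bar>\<Sum>i<k. D (n + i) x\<bar>}"
    by (auto simp: A_def)
  finally show ?thesis .
qed

text \<open>For fixed e, the event that the sums restarted at n reach size e for every n has
  probability at most each tail of the variances over e^2, hence zero. Taking e = 1 / (j + 1) for
  all j gives the Cauchy property almost surely.\<close>

theorem AE_summable:
  assumes sum: "summable (\<lambda>i. expectation (\<lambda>x. (D i x)\<^sup>2))"
  shows "AE x in M. summable (\<lambda>i. D i x)"
proof -
  have "AE x in M. \<exists>n. \<forall>k. \<bar>\<Sum>i<k. D (n + i) x\<bar> < e" if e: "0 < e" for e
  proof (rule AE_I')
    let ?A = "{x\<in>space M. \<forall>n. \<exists>k. e \<le> \<bar>\<Sum>i<k. D (n + i) x\<bar>}"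
    have "prob ?A \<le> (\<Sum>i. expectation (\<lambda>x. (D (n + i) x)\<^sup>2)) / e\<^sup>2" for n
    proof -
      have "prob ?A \<le> prob {x\<in>space M. \<exists>k. e \<le> \<bar>\<Sum>i<k. D (n + i) x\<bar>}"
        by (rule finite_measure_mono) auto
      also have "\<dots> \<le> (\<Sum>i. expectation (\<lambda>x. (D (n + i) x)\<^sup>2)) / e\<^sup>2"
        using e sum by (rule maximal_inequality_tail)
      finally show ?thesis .
    qed
    moreover have "(\<lambda>n. (\<Sum>i. expectation (\<lambda>x. (D (n + i) x)\<^sup>2)) / e\<^sup>2) \<longlonglongrightarrow> 0 / e\<^sup>2"
      using e suminf_exist_split2[OF sum] by (intro tendsto_intros) (auto simp: add.commute)
    ultimately have "prob ?A \<le> 0"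
      by (intro LIMSEQ_le_const[of _ 0]) auto
    then have "emeasure M ?A = 0"
      by (simp add: emeasure_eq_measure measure_le_0_iff)
    then show "?A \<in> null_sets M" by (intro null_setsI) auto
  qed (auto simp: not_less)
  then have "AE x in M. \<forall>j::nat. \<exists>n. \<forall>k. \<bar>\<Sum>i<k. D (n + i) x\<bar> < 1 / real (Suc j)"
    unfolding AE_all_countable by simp
  then show ?thesis
  proof (rule AE_mp, intro AE_I2 impI)
    fix x assume *: "\<forall>j::nat. \<exists>n. \<forall>k. \<bar>\<Sum>i<k. D (n + i) x\<bar> < 1 / real (Suc j)"
    have "Cauchy (\<lambda>k. \<Sum>i<k. D i x)"
    proof (rule metric_CauchyI)
      fix e :: real assume "0 < e"
      then obtain j where j: "1 / real (Suc j) < e / 2"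
        using reals_Archimedean[of "e / 2"] by (auto simp: inverse_eq_divide)
      obtain n where n: "\<And>k. \<bar>\<Sum>i<k. D (n + i) x\<bar> < 1 / real (Suc j)" using * by blast
      have split: "(\<Sum>i<n + k. D i x) = (\<Sum>i<n. D i x) + (\<Sum>i<k. D (n + i) x)" for k
        by (induction k) auto
      have near: "\<bar>(\<Sum>i<k. D i x) - (\<Sum>i<n. D i x)\<bar> < e / 2" if "n \<le> k" for k
        using n[of "k - n"] j split[of "k - n"] that by simp
      have "dist (\<Sum>i<k. D i x) (\<Sum>i<l. D i x) < e" if "n \<le> k" "n \<le> l" for k l
        unfolding dist_real_def using near[OF that(1)] near[OF that(2)] by linarith
      then show "\<exists>n. \<forall>k\<ge>n. \<forall>l\<ge>n. dist (\<Sum>i<k. D i x) (\<Sum>i<l. D i x) < e" by blast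
    qed
    then show "summable (\<lambda>i. D i x)"
      by (simp add: summable_iff_convergent Cauchy_convergent_iff)
  qed
qed

end

section \<open>Unbiased oracles with independent draws\<close>

locale independent_sources = prob_space M for M :: "'a measure" +
  fixes I :: "'i set" and E :: "'i \<Rightarrow> 'a set set"
  assumes indep: "indep_sets E I"
    and sigma: "\<And>i. i \<in> I \<Longrightarrow> sigma_algebra (space M) (E i)"
begin

definition G :: "'i set \<Rightarrow> 'a measure"
  where "G J = sigma (space M) (\<Union>i\<in>J. E i)"

lemma E_events: "i \<in> I \<Longrightarrow> E i \<subseteq> events"
  using indep by (auto simp: indep_sets_def)

lemma space_G [simp]: "space (G J) = space M"
  by (simp add: G_def space_measure_of_conv)

lemma sets_G: "J \<subseteq> I \<Longrightarrow> sets (G J) = sigma_sets (space M) (\<Union>i\<in>J. E i)"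
  unfolding G_def using E_events sets.sets_into_space by (intro sets_measure_of) blast

lemma sets_G_events: "J \<subseteq> I \<Longrightarrow> sets (G J) \<subseteq> events"
  unfolding sets_G using E_events by (intro sets.sigma_sets_subset) auto

lemma subalgebra_G: "J \<subseteq> I \<Longrightarrow> subalgebra M (G J)"
  using sets_G_events by (simp add: subalgebra_def)

lemma sets_G_mono: "J \<subseteq> J' \<Longrightarrow> J' \<subseteq> I \<Longrightarrow> sets (G J) \<subseteq> sets (G J')"
  by (subst (1 2) sets_G) (auto intro!: sigma_sets_mono')

lemma measurable_G_mono:
  "f \<in> measurable (G J) N \<Longrightarrow> J \<subseteq> J' \<Longrightarrow> J' \<subseteq> I \<Longrightarrow> f \<in> measurable (G J') N"
  using sets_G_mono[of J J'] by (auto simp: measurable_def)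

lemma measurable_G_M: "f \<in> measurable (G J) N \<Longrightarrow> J \<subseteq> I \<Longrightarrow> f \<in> measurable M N"
  using measurable_from_subalg[OF subalgebra_G] .

lemma source_measurable_G:
  assumes "i \<in> J" "J \<subseteq> I" "f \<in> space M \<rightarrow> space N" "sets (vimage_algebra (space M) f N) \<subseteq> E i"
  shows "f \<in> measurable (G J) N"
proof (rule measurableI)
  fix A assume "A \<in> sets N"
  then have "f -` A \<inter> space M \<in> E i"
    using assms(4) in_vimage_algebra by blast
  then show "f -` A \<inter> space (G J) \<in> sets (G J)"
    using assms by (auto simp: sets_G intro: sigma_sets.Basic)
qed (use assms in auto)

section \<open>Integrating out a draw that is independent of the past\<close>

text \<open>Disjoint blocks of independent families generate independent sigma-algebras; the two
  blocks \<open>J\<close> and \<open>{i}\<close> are indexed by \<open>bool\<close>.\<close>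

lemma prob_past_Int:
  assumes J: "J \<subseteq> I" and i: "i \<in> I - J" and A: "A \<in> sets (G J)" and B: "B \<in> E i"
  shows "prob (A \<inter> B) = prob A * prob B"
proof -
  have "indep_sets (\<lambda>b. sigma_sets (space M) (\<Union>i\<in>(if b then J else {i}). E i)) UNIV"
  proof (rule indep_sets_collect_sigma)
    show "indep_sets E (\<Union>b. if b then J else {i})"
      using indep_sets_mono_index[OF _ indep, of "\<Union>b. if b then J else {i}"] J i by auto
    show "Int_stable (E j)" if "j \<in> (if b then J else {i})" for b j
    proof -
      have "j \<in> I" using that J i by (auto split: if_splits)
      then interpret sigma_algebra "space M" "E j" by (rule sigma)
      show ?thesis by (auto simp: Int_stable_def)
    qed
    show "disjoint_family_on (\<lambda>b. if b then J else {i}) UNIV"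
      using i by (auto simp: disjoint_family_on_def)
  qed
  then have "indep_set (sets (G J)) (E i)"
    unfolding indep_set_def
  proof (rule indep_sets_mono_sets)
    fix b :: bool
    show "(case b of True \<Rightarrow> sets (G J) | False \<Rightarrow> E i)
      \<subseteq> sigma_sets (space M) (\<Union>i\<in>(if b then J else {i}). E i)"
      by (cases b) (auto simp: sets_G[OF J])
  qed
  then show ?thesis using A B by (rule indep_setD)
qed

text \<open>Fubini in place of conditional expectation: the joint law of \<omega>, seen through the
  past, and of the new draw is a product, so the past can be frozen while the draw is
  averaged.\<close>

lemma
  assumes J: "J \<subseteq> I" and i: "i \<in> I - J" and f: "f \<in> measurable M N"
    and E: "sets (vimage_algebra (space M) f N) \<subseteq> E i"
  shows nn_integral_past: "g \<in> borel_measurable (G J \<Otimes>\<^sub>M N) \<Longrightarrow>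
      (\<integral>\<^sup>+\<omega>. g (\<omega>, f \<omega>) \<partial>M) = (\<integral>\<^sup>+\<omega>. (\<integral>\<^sup>+s. g (\<omega>, s) \<partial>distr M N f) \<partial>M)"
    and integral_past_eq_0: "\<And>g :: _ \<Rightarrow> real. g \<in> borel_measurable (G J \<Otimes>\<^sub>M N) \<Longrightarrow>
      integrable M (\<lambda>\<omega>. g (\<omega>, f \<omega>)) \<Longrightarrow>
      (\<And>\<omega>. \<omega> \<in> space M \<Longrightarrow> (\<integral>s. g (\<omega>, s) \<partial>distr M N f) = 0) \<Longrightarrow> (\<integral>\<omega>. g (\<omega>, f \<omega>) \<partial>M) = 0"
proof -
  \<comment> \<open>\<open>?M1\<close> is M restricted to the sigma-algebra of the past, written as
    the law of the identity map.\<close>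
  let ?M1 = "distr M (G J) (\<lambda>\<omega>. \<omega>)" and ?M2 = "distr M N f"
  have [measurable]: "(\<lambda>\<omega>. \<omega>) \<in> measurable M (G J)"
    using sets_G_events[OF J] by (auto simp: measurable_def)
  note f [measurable]
  interpret M1: prob_space ?M1 by (rule prob_space_distr) measurable
  interpret M2: prob_space ?M2 by (rule prob_space_distr) measurable
  interpret M12: pair_sigma_finite ?M1 ?M2 ..
  have sets_joint: "sets (?M1 \<Otimes>\<^sub>M ?M2) = sets (G J \<Otimes>\<^sub>M N)"
    by (intro sets_pair_measure_cong) auto
  have joint: "distr M (G J \<Otimes>\<^sub>M N) (\<lambda>\<omega>. (\<omega>, f \<omega>)) = ?M1 \<Otimes>\<^sub>M ?M2"
  proof (rule pair_measure_eqI[symmetric])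
    show "sigma_finite_measure ?M1" "sigma_finite_measure ?M2" by unfold_locales
    show "sets (?M1 \<Otimes>\<^sub>M ?M2) = sets (distr M (G J \<Otimes>\<^sub>M N) (\<lambda>\<omega>. (\<omega>, f \<omega>)))"
      using sets_joint by simp
    fix A B assume "A \<in> sets ?M1" "B \<in> sets ?M2"
    then have A: "A \<in> sets (G J)" and B: "B \<in> sets N" by auto
    have "A \<subseteq> space M" using sets.sets_into_space[OF A] by simp
    then have "(\<lambda>\<omega>. (\<omega>, f \<omega>)) -` (A \<times> B) \<inter> space M = A \<inter> (f -` B \<inter> space M)" by auto
    moreover have "f -` B \<inter> space M \<in> E i"
      using E in_vimage_algebra[OF B] by blast
    ultimately have "emeasure M ((\<lambda>\<omega>. (\<omega>, f \<omega>)) -` (A \<times> B) \<inter> space M)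
        = emeasure M A * emeasure M (f -` B \<inter> space M)"
      using prob_past_Int[OF J i A] by (simp add: emeasure_eq_measure ennreal_mult)
    then show "emeasure ?M1 A * emeasure ?M2 B
        = emeasure (distr M (G J \<Otimes>\<^sub>M N) (\<lambda>\<omega>. (\<omega>, f \<omega>))) (A \<times> B)"
      using A B \<open>A \<subseteq> space M\<close> by (simp add: emeasure_distr Int_absorb2)
  qed
  show "(\<integral>\<^sup>+\<omega>. g (\<omega>, f \<omega>) \<partial>M) = (\<integral>\<^sup>+\<omega>. (\<integral>\<^sup>+s. g (\<omega>, s) \<partial>?M2) \<partial>M)"
    if g [measurable]: "g \<in> borel_measurable (G J \<Otimes>\<^sub>M N)" for g
  proof -
    have g': "g \<in> borel_measurable (?M1 \<Otimes>\<^sub>M ?M2)"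
      using g by (simp add: measurable_cong_sets[OF sets_joint refl])
    have "(\<integral>\<^sup>+\<omega>. g (\<omega>, f \<omega>) \<partial>M) = integral\<^sup>N (?M1 \<Otimes>\<^sub>M ?M2) g"
      unfolding joint[symmetric] by (subst nn_integral_distr) auto
    also have "\<dots> = (\<integral>\<^sup>+\<omega>. (\<integral>\<^sup>+s. g (\<omega>, s) \<partial>?M2) \<partial>?M1)"
      using M2.nn_integral_fst[OF g'] by simp
    also have "\<dots> = (\<integral>\<^sup>+\<omega>. (\<integral>\<^sup>+s. g (\<omega>, s) \<partial>?M2) \<partial>M)"
      using M2.borel_measurable_nn_integral_fst[OF g']
      by (subst nn_integral_distr) auto
    finally show ?thesis .
  qed
  show "(\<integral>\<omega>. g (\<omega>, f \<omega>) \<partial>M) = 0"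
    if g [measurable]: "g \<in> borel_measurable (G J \<Otimes>\<^sub>M N)"
      and int: "integrable M (\<lambda>\<omega>. g (\<omega>, f \<omega>))"
      and zero: "\<And>\<omega>. \<omega> \<in> space M \<Longrightarrow> (\<integral>s. g (\<omega>, s) \<partial>?M2) = 0" for g :: "_ \<Rightarrow> real"
  proof -
    have "(\<integral>\<omega>. g (\<omega>, f \<omega>) \<partial>M) = integral\<^sup>L (?M1 \<Otimes>\<^sub>M ?M2) g"
      unfolding joint[symmetric] by (subst integral_distr) auto
    also have "\<dots> = (\<integral>\<omega>. (\<integral>s. g (\<omega>, s) \<partial>?M2) \<partial>?M1)"
    proof (rule M12.integral_fst'[symmetric])
      show "integrable (?M1 \<Otimes>\<^sub>M ?M2) g"
        unfolding joint[symmetric] using int by (subst integrable_distr_eq) auto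
    qed
    also have "\<dots> = (\<integral>\<omega>. 0 \<partial>?M1)"
      by (intro Bochner_Integration.integral_cong) (auto simp: zero)
    finally show ?thesis by simp
  qed
qed

end

section \<open>Noise of a single draw and of a batch\<close>

text \<open>\<open>K\<close> holds the sources that are oracle draws; the other members of
  \<open>I\<close>, such as the initial points, carry independent information of any kind.\<close>

locale stochastic_oracle = independent_sources M I E
  for M :: "'a measure" and I :: "'i set" and E :: "'i \<Rightarrow> 'a set set" +
  fixes N P :: "'s measure" and K :: "'i set" and draw :: "'i \<Rightarrow> 'a \<Rightarrow> 's"
    and Vhat :: "'h::{real_inner,banach,second_countable_topology} \<Rightarrow> 's \<Rightarrow> 'h" and V :: "'h \<Rightarrow> 'h"
    and \<sigma> :: real
  assumes K: "K \<subseteq> I"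
    and draw: "\<And>i. i \<in> K \<Longrightarrow> draw i \<in> measurable M N" "\<And>i. i \<in> K \<Longrightarrow> distr M N (draw i) = P"
      "\<And>i. i \<in> K \<Longrightarrow> sets (vimage_algebra (space M) (draw i) N) \<subseteq> E i"
    and Vhat_measurable: "(\<lambda>(x, s). Vhat x s) \<in> borel_measurable (borel \<Otimes>\<^sub>M N)"
    and V_measurable: "V \<in> borel_measurable borel"
    and mean: "\<And>x. has_bochner_integral P (Vhat x) (V x)"
    and variance: "\<And>x. integrable P (\<lambda>s. (norm (Vhat x s - V x))\<^sup>2)"
      "\<And>x. (\<integral>s. (norm (Vhat x s - V x))\<^sup>2 \<partial>P) \<le> \<sigma>\<^sup>2"
begin

lemma draw_measurable_G: "i \<in> J \<Longrightarrow> J \<subseteq> I \<Longrightarrow> i \<in> K \<Longrightarrow> draw i \<in> measurable (G J) N"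
  using draw[of i] by (intro source_measurable_G[of i]) (auto dest: measurable_space)

lemma noise_measurable:
  assumes "z \<in> borel_measurable A" "y \<in> measurable A N"
  shows "(\<lambda>\<omega>. Vhat (z \<omega>) (y \<omega>) - V (z \<omega>)) \<in> borel_measurable A"
proof -
  have "(\<lambda>\<omega>. (z \<omega>, y \<omega>)) \<in> measurable A (borel \<Otimes>\<^sub>M N)"
    using assms by measurable
  from measurable_compose[OF this Vhat_measurable]
  have "(\<lambda>\<omega>. Vhat (z \<omega>) (y \<omega>)) \<in> borel_measurable A" by simp
  then show ?thesis
    using measurable_compose[OF assms(1) V_measurable] by measurable
qed

context
  fixes J i and z :: "'a \<Rightarrow> 'h"
  assumes J: "J \<subseteq> I" and i: "i \<in> K - J" and z: "z \<in> borel_measurable (G J)"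
begin

lemma single_noise_measurable:
  "(\<lambda>\<omega>. Vhat (z \<omega>) (draw i \<omega>) - V (z \<omega>)) \<in> borel_measurable (G (insert i J))"
  using J i K by (intro noise_measurable measurable_G_mono[OF z] draw_measurable_G) auto

lemma single_noise_measurable_M:
  "(\<lambda>\<omega>. Vhat (z \<omega>) (draw i \<omega>) - V (z \<omega>)) \<in> borel_measurable M"
  using J i K by (intro measurable_G_M[OF single_noise_measurable]) auto

lemma pair_noise_measurable:
  "(\<lambda>(\<omega>, s). Vhat (z \<omega>) s - V (z \<omega>)) \<in> borel_measurable (G J \<Otimes>\<^sub>M N)"
  using noise_measurable[OF measurable_compose[OF measurable_fst z] measurable_snd]
  by (simp add: case_prod_beta)

lemma prob_space_P: "prob_space P"
  using draw[of i] i prob_space_distr[of "draw i" N] by simp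

lemma nn_integral_variance: "(\<integral>\<^sup>+s. ennreal ((norm (Vhat x s - V x))\<^sup>2) \<partial>P) \<le> ennreal (\<sigma>\<^sup>2)"
  using variance(1) by (subst nn_integral_eq_integral) (auto intro: ennreal_leI variance(2))

text \<open>The variance bound is uniform in the query point, so averaging over the draw first gives
  it at the random point z with no integrability of z.\<close>

lemma single_noise_variance:
  "integrable M (\<lambda>\<omega>. (norm (Vhat (z \<omega>) (draw i \<omega>) - V (z \<omega>)))\<^sup>2)"
  "expectation (\<lambda>\<omega>. (norm (Vhat (z \<omega>) (draw i \<omega>) - V (z \<omega>)))\<^sup>2) \<le> \<sigma>\<^sup>2"
proof -
  let ?e = "\<lambda>\<omega>. (norm (Vhat (z \<omega>) (draw i \<omega>) - V (z \<omega>)))\<^sup>2"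
  note single_noise_measurable_M [measurable] and pair_noise_measurable [measurable]
  have "(\<integral>\<^sup>+\<omega>. ennreal (?e \<omega>) \<partial>M) = (\<integral>\<^sup>+\<omega>. (\<integral>\<^sup>+s. ennreal ((norm (Vhat (z \<omega>) s - V (z \<omega>)))\<^sup>2) \<partial>P) \<partial>M)"
  proof -
    have meas: "(\<lambda>x. ennreal ((norm ((\<lambda>(\<omega>, s). Vhat (z \<omega>) s - V (z \<omega>)) x))\<^sup>2)) \<in> borel_measurable (G J \<Otimes>\<^sub>M N)"
      by measurable
    show ?thesis
      using nn_integral_past[OF J _ draw(1) draw(3) meas, of i] i K draw(2)[of i] by auto
  qed
  also have "\<dots> \<le> (\<integral>\<^sup>+\<omega>. ennreal (\<sigma>\<^sup>2) \<partial>M)"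
    by (intro nn_integral_mono nn_integral_variance)
  also have "\<dots> = ennreal (\<sigma>\<^sup>2)" by (simp add: emeasure_space_1)
  finally have le: "(\<integral>\<^sup>+\<omega>. ennreal (?e \<omega>) \<partial>M) \<le> ennreal (\<sigma>\<^sup>2)" .
  show int: "integrable M ?e"
    using le by (intro integrableI_nonneg) (auto intro: le_less_trans)
  show "expectation ?e \<le> \<sigma>\<^sup>2"
    using le int by (simp add: nn_integral_eq_integral)
qed

text \<open>With the past frozen, the norm of the noise has mean at most 1 + \<sigma>^2. A
  coefficient \<open>b\<close> with a first moment therefore gives an integrable product, and
  unbiasedness makes the inner integral vanish.\<close>

lemma single_noise_orthogonal:
  assumes b: "b \<in> borel_measurable (G J)" "integrable M (\<lambda>\<omega>. norm (b \<omega>))"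
  shows "integrable M (\<lambda>\<omega>. inner (b \<omega>) (Vhat (z \<omega>) (draw i \<omega>) - V (z \<omega>)))"
    "expectation (\<lambda>\<omega>. inner (b \<omega>) (Vhat (z \<omega>) (draw i \<omega>) - V (z \<omega>))) = 0"
proof -
  interpret P: prob_space P by (rule prob_space_P)
  let ?e = "\<lambda>\<omega>. inner (b \<omega>) (Vhat (z \<omega>) (draw i \<omega>) - V (z \<omega>))"
  define e where "e = (\<lambda>(\<omega>, s). Vhat (z \<omega>) s - V (z \<omega>))"
  note single_noise_measurable_M [measurable]
  have e [measurable]: "e \<in> borel_measurable (G J \<Otimes>\<^sub>M N)"
    unfolding e_def by (rule pair_noise_measurable)
  note b(1) [measurable]
  have b_M [measurable]: "b \<in> borel_measurable M" using b(1) J by (rule measurable_G_M)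
  have meas: "(\<lambda>x. norm (b (fst x)) * norm (e x)) \<in> borel_measurable (G J \<Otimes>\<^sub>M N)"
    by measurable
  have "(\<integral>\<^sup>+\<omega>. ennreal (norm (?e \<omega>)) \<partial>M) \<le> (\<integral>\<^sup>+\<omega>. ennreal (norm (b \<omega>) * norm (e (\<omega>, draw i \<omega>))) \<partial>M)"
    by (intro nn_integral_mono ennreal_leI) (simp add: e_def Cauchy_Schwarz_ineq2)
  also have "\<dots> = (\<integral>\<^sup>+\<omega>. (\<integral>\<^sup>+s. ennreal (norm (b \<omega>) * norm (e (\<omega>, s))) \<partial>P) \<partial>M)"
    using nn_integral_past[OF J _ draw(1) draw(3) measurable_compose[OF meas measurable_ennreal], of i]
      i K draw(2)[of i] by auto
  also have "\<dots> \<le> (\<integral>\<^sup>+\<omega>. ennreal (norm (b \<omega>)) * ennreal (1 + \<sigma>\<^sup>2) \<partial>M)"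
  proof (intro nn_integral_mono)
    fix \<omega> assume "\<omega> \<in> space M"
    have sec: "e (\<omega>, s) = Vhat (z \<omega>) s - V (z \<omega>)" for s by (simp add: e_def)
    have "sets P = sets N" using draw(2)[of i] i by auto
    moreover have "(\<lambda>s. e (\<omega>, s)) \<in> borel_measurable N"
      using \<open>\<omega> \<in> space M\<close> by (intro measurable_compose[OF measurable_Pair1' e]) simp
    ultimately have [measurable]: "(\<lambda>s. e (\<omega>, s)) \<in> borel_measurable P"
      using measurable_cong_sets[of P N borel borel] by blast
    have "(\<integral>\<^sup>+s. ennreal (norm (e (\<omega>, s))) \<partial>P) \<le> (\<integral>\<^sup>+s. ennreal 1 + ennreal ((norm (e (\<omega>, s)))\<^sup>2) \<partial>P)"
    proof (intro nn_integral_mono)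
      show "ennreal (norm (e (\<omega>, s))) \<le> ennreal 1 + ennreal ((norm (e (\<omega>, s)))\<^sup>2)" for s
        using ennreal_leI[OF le_one_plus_square[of "norm (e (\<omega>, s))"]] by simp
    qed
    also have "\<dots> = 1 + (\<integral>\<^sup>+s. ennreal ((norm (e (\<omega>, s)))\<^sup>2) \<partial>P)"
      by (subst nn_integral_add) (auto simp: P.emeasure_space_1)
    also have "\<dots> \<le> 1 + ennreal (\<sigma>\<^sup>2)"
      unfolding sec by (intro add_left_mono nn_integral_variance)
    also have "\<dots> = ennreal (1 + \<sigma>\<^sup>2)" by simp
    finally have "(\<integral>\<^sup>+s. ennreal (norm (e (\<omega>, s))) \<partial>P) \<le> ennreal (1 + \<sigma>\<^sup>2)" .
    then show "(\<integral>\<^sup>+s. ennreal (norm (b \<omega>) * norm (e (\<omega>, s))) \<partial>P) \<le> ennreal (norm (b \<omega>)) * ennreal (1 + \<sigma>\<^sup>2)"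
      by (simp add: ennreal_mult nn_integral_cmult mult_left_mono)
  qed
  also have "\<dots> = (\<integral>\<^sup>+\<omega>. ennreal (norm (b \<omega>)) \<partial>M) * ennreal (1 + \<sigma>\<^sup>2)"
    by (intro nn_integral_multc) measurable
  also have "\<dots> < \<infinity>"
    using b(2) by (simp add: integrable_iff_bounded ennreal_mult_less_top)
  finally show int: "integrable M ?e"
    by (intro integrableI_bounded) auto
  have inner_meas: "(\<lambda>x. inner (b (fst x)) (e x)) \<in> borel_measurable (G J \<Otimes>\<^sub>M N)"
    by measurable
  have "expectation (\<lambda>\<omega>. inner (b (fst (\<omega>, draw i \<omega>))) (e (\<omega>, draw i \<omega>))) = 0"
  proof (rule integral_past_eq_0[OF J _ draw(1) draw(3) inner_meas])
    show "integrable M (\<lambda>\<omega>. inner (b (fst (\<omega>, draw i \<omega>))) (e (\<omega>, draw i \<omega>)))"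
      using int by (simp add: e_def)
    fix \<omega>
    have "has_bochner_integral P (\<lambda>s. inner (b \<omega>) (Vhat (z \<omega>) s - V (z \<omega>)))
        (inner (b \<omega>) (V (z \<omega>) - V (z \<omega>)))"
      using has_bochner_integral_diff[OF mean[of "z \<omega>"], of "\<lambda>_. V (z \<omega>)" "V (z \<omega>)"]
      by (intro has_bochner_integral_inner_right)
        (auto simp: has_bochner_integral_iff P.prob_space)
    then show "(\<integral>s. inner (b (fst (\<omega>, s))) (e (\<omega>, s)) \<partial>distr M N (draw i)) = 0"
      using draw(2)[of i] i by (simp add: e_def has_bochner_integral_iff)
  qed (use i K in auto)
  then show "expectation ?e = 0" by (simp add: e_def)
qed

end

context
  fixes J idx m and z :: "'a \<Rightarrow> 'h"
  assumes J: "J \<subseteq> I" and idx: "inj_on idx {1..m::nat}" "idx ` {1..m} \<subseteq> K - J"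
    and z: "z \<in> borel_measurable (G J)"
begin

text \<open>The earlier draws of the batch are absorbed into the past of the next one. The partial
  sum is then an admissible coefficient in \<open>single_noise_orthogonal\<close>, the cross term
  vanishes, and variances add.\<close>

lemma partial_batch_noise:
  assumes "n \<le> m"
  defines "S \<equiv> \<lambda>\<omega>. \<Sum>t=1..n. Vhat (z \<omega>) (draw (idx t) \<omega>) - V (z \<omega>)"
  shows "S \<in> borel_measurable (G (J \<union> idx ` {1..n}))"
    "integrable M (\<lambda>\<omega>. (norm (S \<omega>))\<^sup>2)" "expectation (\<lambda>\<omega>. (norm (S \<omega>))\<^sup>2) \<le> real n * \<sigma>\<^sup>2"
    "\<And>b. b \<in> borel_measurable (G J) \<Longrightarrow> integrable M (\<lambda>\<omega>. norm (b \<omega>)) \<Longrightarrow>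
      integrable M (\<lambda>\<omega>. inner (b \<omega>) (S \<omega>)) \<and> expectation (\<lambda>\<omega>. inner (b \<omega>) (S \<omega>)) = 0"
  using \<open>n \<le> m\<close> unfolding S_def
proof (induction n)
  case 0
  {
    case 1
    then show ?case by simp
  next
    case 2
    then show ?case by simp
  next
    case 3
    then show ?case by simp
  next
    case 4
    then show ?case by simp
  }
next
  case (Suc n)
  define S where "S \<omega> = (\<Sum>t=1..n. Vhat (z \<omega>) (draw (idx t) \<omega>) - V (z \<omega>))" for \<omega>
  define e where "e \<omega> = Vhat (z \<omega>) (draw (idx (Suc n)) \<omega>) - V (z \<omega>)" for \<omega>
  have split: "(\<Sum>t=1..Suc n. Vhat (z \<omega>) (draw (idx t) \<omega>) - V (z \<omega>)) = S \<omega> + e \<omega>" for \<omega>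
    by (simp add: S_def e_def)
  {
    assume n: "Suc n \<le> m"
    let ?J = "J \<union> idx ` {1..n}"
    have IH: "S \<in> borel_measurable (G ?J)" "integrable M (\<lambda>\<omega>. (norm (S \<omega>))\<^sup>2)"
      "expectation (\<lambda>\<omega>. (norm (S \<omega>))\<^sup>2) \<le> real n * \<sigma>\<^sup>2"
      "\<And>b. b \<in> borel_measurable (G J) \<Longrightarrow> integrable M (\<lambda>\<omega>. norm (b \<omega>)) \<Longrightarrow>
        integrable M (\<lambda>\<omega>. inner (b \<omega>) (S \<omega>)) \<and> expectation (\<lambda>\<omega>. inner (b \<omega>) (S \<omega>)) = 0"
      using Suc.IH n unfolding S_def by auto
    have "idx ` {1..n} \<subseteq> K - J" using idx(2) n by force
    then have sub: "?J \<subseteq> I" using J K by blast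
    have "idx (Suc n) \<notin> idx ` {1..n}"
    proof
      assume "idx (Suc n) \<in> idx ` {1..n}"
      then obtain t where "t \<in> {1..n}" "idx (Suc n) = idx t" by blast
      with inj_onD[OF idx(1), of "Suc n" t] n show False by auto
    qed
    moreover have "idx (Suc n) \<in> K - J" using idx(2) n by force
    ultimately have new: "idx (Suc n) \<in> K - ?J" by blast
    have z': "z \<in> borel_measurable (G ?J)" using z sub by (intro measurable_G_mono[OF z]) auto
    note e_meas = single_noise_measurable[OF sub new z', folded e_def]
    note e_var = single_noise_variance[OF sub new z', folded e_def]
    note e_orth = single_noise_orthogonal[OF sub new z', folded e_def]
    have set_eq: "J \<union> idx ` {1..Suc n} = insert (idx (Suc n)) ?J"
      by (auto simp: atLeastAtMostSuc_conv)
    have sub': "insert (idx (Suc n)) ?J \<subseteq> I" using sub new K by auto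
    have S_meas: "(\<lambda>\<omega>. S \<omega> + e \<omega>) \<in> borel_measurable (G (J \<union> idx ` {1..Suc n}))"
      unfolding set_eq by (intro borel_measurable_add measurable_G_mono[OF IH(1) _ sub'] e_meas) auto
    have S_M [measurable]: "S \<in> borel_measurable M" using IH(1) sub by (rule measurable_G_M)
    have int_S: "integrable M (\<lambda>\<omega>. norm (S \<omega>))"
    proof (rule Bochner_Integration.integrable_bound)
      show "integrable M (\<lambda>\<omega>. 1 + (norm (S \<omega>))\<^sup>2)" using IH(2) by simp
      show "AE \<omega> in M. norm (norm (S \<omega>)) \<le> norm (1 + (norm (S \<omega>))\<^sup>2)"
        using le_one_plus_square by simp
    qed measurable
    have *: "(norm (S \<omega> + e \<omega>))\<^sup>2 = (norm (S \<omega>))\<^sup>2 + 2 * inner (S \<omega>) (e \<omega>) + (norm (e \<omega>))\<^sup>2" for \<omega>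
      by (simp add: power2_norm_eq_inner inner_add inner_commute)
    note cross = e_orth[OF IH(1) int_S]
    have "integrable M (\<lambda>\<omega>. (norm (S \<omega> + e \<omega>))\<^sup>2)"
      unfolding * using IH(2) cross e_var(1) by simp
    moreover have "expectation (\<lambda>\<omega>. (norm (S \<omega> + e \<omega>))\<^sup>2) \<le> real (Suc n) * \<sigma>\<^sup>2"
      unfolding * using IH(2,3) cross e_var by (simp add: algebra_simps)
    moreover have "integrable M (\<lambda>\<omega>. inner (b \<omega>) (S \<omega> + e \<omega>)) \<and>
        expectation (\<lambda>\<omega>. inner (b \<omega>) (S \<omega> + e \<omega>)) = 0"
      if b: "b \<in> borel_measurable (G J)" "integrable M (\<lambda>\<omega>. norm (b \<omega>))" for b
    proof -
      have "b \<in> borel_measurable (G ?J)" using b(1) sub by (auto intro: measurable_G_mono)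
      from e_orth[OF this b(2)] IH(4)[OF b] show ?thesis
        by (simp add: inner_add_right)
    qed
    moreover note S_meas
    ultimately have "(\<lambda>\<omega>. S \<omega> + e \<omega>) \<in> borel_measurable (G (J \<union> idx ` {1..Suc n}))"
      "integrable M (\<lambda>\<omega>. (norm (S \<omega> + e \<omega>))\<^sup>2)"
      "expectation (\<lambda>\<omega>. (norm (S \<omega> + e \<omega>))\<^sup>2) \<le> real (Suc n) * \<sigma>\<^sup>2"
      "\<And>b. b \<in> borel_measurable (G J) \<Longrightarrow> integrable M (\<lambda>\<omega>. norm (b \<omega>)) \<Longrightarrow>
        integrable M (\<lambda>\<omega>. inner (b \<omega>) (S \<omega> + e \<omega>)) \<and> expectation (\<lambda>\<omega>. inner (b \<omega>) (S \<omega> + e \<omega>)) = 0"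
      by blast+
  } note step = this
  {
    case 1
    then show ?case unfolding split by (rule step)
  next
    case 2
    then show ?case unfolding split by (rule step)
  next
    case 3
    then show ?case unfolding split by (rule step)
  next
    case 4
    show ?case unfolding split by (rule step(4)[OF 4(3) 4(1) 4(2)])
  }
qed

lemma batch_noise:
  assumes m: "1 \<le> m"
  defines "U \<equiv> \<lambda>\<omega>. batch_average Vhat m (z \<omega>) (\<lambda>t. draw (idx t) \<omega>) - V (z \<omega>)"
  shows "U \<in> borel_measurable (G (J \<union> idx ` {1..m}))"
    "integrable M (\<lambda>\<omega>. (norm (U \<omega>))\<^sup>2)" "expectation (\<lambda>\<omega>. (norm (U \<omega>))\<^sup>2) \<le> \<sigma>\<^sup>2 / real m"
    "\<And>b. b \<in> borel_measurable (G J) \<Longrightarrow> integrable M (\<lambda>\<omega>. norm (b \<omega>)) \<Longrightarrow>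
      expectation (\<lambda>\<omega>. inner (b \<omega>) (U \<omega>)) = 0"
proof -
  define S where "S \<omega> = (\<Sum>t=1..m. Vhat (z \<omega>) (draw (idx t) \<omega>) - V (z \<omega>))" for \<omega>
  note S = partial_batch_noise[OF order_refl, folded S_def]
  have U: "U = (\<lambda>\<omega>. (1 / real m) *\<^sub>R S \<omega>)"
    using m by (auto simp: U_def S_def batch_average_def sum_subtractf scaleR_diff_right sum_constant_scaleR)
  show "U \<in> borel_measurable (G (J \<union> idx ` {1..m}))"
    unfolding U using S(1) by measurable
  have sq: "(norm (U \<omega>))\<^sup>2 = (norm (S \<omega>))\<^sup>2 / (real m)\<^sup>2" for \<omega>
    by (simp add: U power_divide)
  show "integrable M (\<lambda>\<omega>. (norm (U \<omega>))\<^sup>2)"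
    unfolding sq using S(2) by simp
  have "expectation (\<lambda>\<omega>. (norm (U \<omega>))\<^sup>2) = expectation (\<lambda>\<omega>. (norm (S \<omega>))\<^sup>2) / (real m)\<^sup>2"
    unfolding sq by simp
  also have "\<dots> \<le> real m * \<sigma>\<^sup>2 / (real m)\<^sup>2"
    using S(3) by (intro divide_right_mono) auto
  also have "\<dots> = \<sigma>\<^sup>2 / real m" using m by (simp add: power2_eq_square)
  finally show "expectation (\<lambda>\<omega>. (norm (U \<omega>))\<^sup>2) \<le> \<sigma>\<^sup>2 / real m" .
  show "expectation (\<lambda>\<omega>. inner (b \<omega>) (U \<omega>)) = 0"
    if "b \<in> borel_measurable (G J)" "integrable M (\<lambda>\<omega>. norm (b \<omega>))" for b
    using S(4)[OF that] by (simp add: U)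
qed

end

end

section \<open>The deterministic part of the analysis\<close>

lemma norm_add_square_le: "(norm (x + y))\<^sup>2 \<le> 2 * (norm x)\<^sup>2 + 2 * (norm y)\<^sup>2"
  for x y :: "'a::real_inner"
proof -
  have "0 \<le> (norm (x - y))\<^sup>2" by simp
  then show ?thesis by (simp add: power2_norm_eq_inner inner_add inner_diff inner_commute)
qed

lemma sum_square_le: "(x + y)\<^sup>2 \<le> 2 * x\<^sup>2 + 2 * y\<^sup>2" for x y :: real
  using norm_add_square_le[of x y] by simp

text \<open>The factor \<open>5 / 4\<close> leaves enough of \<open>norm (Z - Y)\<close> to
  absorb the noise with Young's inequality, because \<open>lam * L \<le> 1 / 4\<close>.\<close>

lemma forward_backward_forward_step:
  fixes T :: "'a::real_inner \<Rightarrow> 'a set"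
  assumes T: "maximally_monotone T" and V: "maximally_monotone (op_of_fun V)"
    and L: "0 < L" "L-lipschitz_on UNIV V"
    and lam: "0 < lam" "lam * L \<le> 1 / 4" and \<rho>: "0 < \<rho>"
    and p: "- V p \<in> T p" and Y: "(1 / lam) *\<^sub>R (Z - lam *\<^sub>R A - Y) \<in> T Y"
    and X': "X' = (1 - \<rho>) *\<^sub>R Z + \<rho> *\<^sub>R (Y + lam *\<^sub>R (A - B))"
  shows "(norm (X' - p))\<^sup>2 \<le> (norm (Z - p))\<^sup>2 - 2 * \<rho> * lam * inner (B - V Y) (Y - p)
    - 3 / 8 * \<rho> * (norm (Z - Y))\<^sup>2 + 5 * \<rho> * lam\<^sup>2 * ((norm (A - V Z))\<^sup>2 + (norm (B - V Y))\<^sup>2)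
    - (5 / (4 * \<rho> * (1 + L * lam)) - 1) * (norm (X' - Z))\<^sup>2"
proof -
  \<comment> \<open>\<open>R\<close> is the step before relaxation: X' is the affine combination of
    Z and \<open>R\<close> with weight \<rho>.\<close>
  define R where "R = Y + lam *\<^sub>R (A - B)"
  define s where "s = L * lam"
  have s: "0 < s" "s \<le> 1 / 4" using L lam by (auto simp: s_def mult.commute)
  define d n where "d = norm (Z - Y)" and "n = lam * norm ((A - V Z) - (B - V Y))"
  have nonneg: "0 \<le> d" "0 \<le> n" using lam by (auto simp: d_def n_def)
  have "0 \<le> inner (Y - p) ((1 / lam) *\<^sub>R (Z - lam *\<^sub>R A - Y) - (- V p))"
    by (rule maximally_monotone_nonneg[OF T Y p])
  also have "\<dots> = inner (Y - p) (Z - lam *\<^sub>R A - Y + lam *\<^sub>R V p) / lam"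
    using lam(1) by (simp add: inner_diff_right inner_add_right add_divide_distrib diff_divide_distrib)
  finally have "0 \<le> inner (Y - p) (Z - lam *\<^sub>R A - Y + lam *\<^sub>R V p)"
    using lam(1) by (simp add: zero_le_divide_iff)
  moreover have "0 \<le> lam * inner (Y - p) (V Y - V p)"
    using monotone_op_of_fun[OF V] lam(1) by simp
  \<comment> \<open>Monotonicity of \<open>T\<close> and of \<open>V\<close> removes
    \<open>V Y - V p\<close>; of \<open>B\<close> only its noise remains.\<close>
  ultimately have key: "lam * inner (B - V Y) (Y - p) \<le> inner (Z - R) (Y - p)"
    unfolding R_def by (simp add: inner_diff inner_add inner_commute algebra_simps)
  have R_p: "(norm (R - p))\<^sup>2 = (norm (Z - p))\<^sup>2 - 2 * inner (Z - R) (Y - p) - d\<^sup>2 + (norm (R - Y))\<^sup>2"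
    unfolding d_def by (simp add: power2_norm_eq_inner inner_diff inner_commute algebra_simps)
  have "norm (R - Y) = lam * norm (A - B)" using lam(1) by (simp add: R_def)
  also have "A - B = (V Z - V Y) + ((A - V Z) - (B - V Y))" by simp
  also have "lam * norm \<dots> \<le> lam * (L * norm (Z - Y) + norm ((A - V Z) - (B - V Y)))"
    using lam(1) lipschitz_onD[OF L(2), of Z Y]
    by (intro mult_left_mono norm_triangle_le add_mono) (auto simp: dist_norm)
  also have "\<dots> = s * d + n" by (simp add: s_def d_def n_def algebra_simps)
  finally have R_Y: "norm (R - Y) \<le> s * d + n" .
  then have "(norm (R - Y))\<^sup>2 \<le> (s * d + n)\<^sup>2" by (intro power_mono) auto
  also have "\<dots> \<le> 2 * s\<^sup>2 * d\<^sup>2 + 2 * n\<^sup>2"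
    using sum_square_le[of "s * d" n] by (simp add: power_mult_distrib)
  finally have R_Y_sq: "(norm (R - Y))\<^sup>2 \<le> 2 * s\<^sup>2 * d\<^sup>2 + 2 * n\<^sup>2" .
  have "norm (Z - R) \<le> norm (Z - Y) + norm (R - Y)"
    by (metis norm_minus_commute norm_triangle_ineq diff_add_cancel add_diff_eq)
  also have "\<dots> \<le> (1 + s) * d + n" using R_Y by (simp add: d_def algebra_simps)
  finally have "(norm (Z - R))\<^sup>2 \<le> ((1 + s) * d + n)\<^sup>2" by (intro power_mono) auto
  also have "\<dots> \<le> 2 * (1 + s)\<^sup>2 * d\<^sup>2 + 2 * n\<^sup>2"
    using sum_square_le[of "(1 + s) * d" n] by (simp add: power_mult_distrib)
  finally have Z_R_sq: "(norm (Z - R))\<^sup>2 \<le> 2 * (1 + s)\<^sup>2 * d\<^sup>2 + 2 * n\<^sup>2" .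
  \<comment> \<open>The coefficient is nonnegative because s <= 1/4, so the upper bound for |Z - R|
    may be inserted.\<close>
  have "(5 / (4 * (1 + s)) - 1) * (norm (Z - R))\<^sup>2 = (1 / 4 - s) / (1 + s) * (norm (Z - R))\<^sup>2"
    using s by (simp add: field_simps)
  also have "\<dots> \<le> (1 / 4 - s) / (1 + s) * (2 * (1 + s)\<^sup>2 * d\<^sup>2 + 2 * n\<^sup>2)"
    using s by (intro mult_left_mono Z_R_sq) auto
  also have "\<dots> = (1 / 2 - 3 / 2 * s - 2 * s\<^sup>2) * d\<^sup>2 + 2 * ((1 / 4 - s) / (1 + s)) * n\<^sup>2"
  proof -
    have "(1 / 4 - s) / (1 + s) * (2 * (1 + s)\<^sup>2 * d\<^sup>2) = 2 * (1 / 4 - s) * (1 + s) * d\<^sup>2"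
      using s by (simp add: power2_eq_square)
    also have "2 * (1 / 4 - s) * (1 + s) = 1 / 2 - 3 / 2 * s - 2 * s\<^sup>2"
      by (simp add: field_simps power2_eq_square)
    finally show ?thesis by (simp add: distrib_left)
  qed
  \<comment> \<open>The term -2 s^2 cancels the 2 s^2 of \<open>R_Y_sq\<close>. Together with -d^2
    from \<open>R_p\<close> this leaves -3/8 d^2, and 2 + 1/2 = 5/2 times n^2, which
    \<open>n_sq\<close> turns into the constant 5.\<close>
  also have "\<dots> \<le> (5 / 8 - 2 * s\<^sup>2) * d\<^sup>2 + 1 / 2 * n\<^sup>2"
    using s by (intro add_mono mult_right_mono) (auto simp: field_simps)
  finally have absorb: "(5 / (4 * (1 + s)) - 1) * (norm (Z - R))\<^sup>2 \<le> (5 / 8 - 2 * s\<^sup>2) * d\<^sup>2 + 1 / 2 * n\<^sup>2" .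
  have "n\<^sup>2 = lam\<^sup>2 * (norm ((A - V Z) + - (B - V Y)))\<^sup>2"
    by (simp add: n_def power_mult_distrib diff_conv_add_uminus del: add_uminus_conv_diff minus_diff_eq)
  also have "\<dots> \<le> lam\<^sup>2 * (2 * (norm (A - V Z))\<^sup>2 + 2 * (norm (- (B - V Y)))\<^sup>2)"
    by (intro mult_left_mono norm_add_square_le) simp
  finally have n_sq: "n\<^sup>2 \<le> 2 * lam\<^sup>2 * ((norm (A - V Z))\<^sup>2 + (norm (B - V Y))\<^sup>2)"
    by (simp only: norm_minus_cancel) (simp add: algebra_simps)
  have X'_Z: "(norm (X' - Z))\<^sup>2 = \<rho>\<^sup>2 * (norm (Z - R))\<^sup>2"
  proof -
    have "X' - Z = - (\<rho> *\<^sub>R (Z - R))" by (simp add: X' R_def algebra_simps)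
    then show ?thesis by (simp only: norm_minus_cancel norm_scaleR power_mult_distrib power2_abs)
  qed
  have "X' - p = (1 - \<rho>) *\<^sub>R (Z - p) + \<rho> *\<^sub>R (R - p)"
    by (simp add: X' R_def algebra_simps)
  then have "(norm (X' - p))\<^sup>2 = (norm (Z - p))\<^sup>2 + \<rho> * ((norm (R - p))\<^sup>2 - (norm (Z - p))\<^sup>2)
      - \<rho> * (norm (Z - R))\<^sup>2 + \<rho>\<^sup>2 * (norm (Z - R))\<^sup>2"
    by (simp only:) (simp add: power2_norm_eq_inner power2_eq_square[of \<rho>] inner_add inner_diff
        inner_commute algebra_simps)
  \<comment> \<open>The term 5 \<rho> / (4 (1 + s)) |Z - R|^2 is added and subtracted: one copy is
    absorbed by \<open>absorb\<close>, the other becomes a multiple of |X' - Z|^2.\<close>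
  also have "\<dots> = (norm (Z - p))\<^sup>2 + \<rho> * ((norm (R - p))\<^sup>2 - (norm (Z - p))\<^sup>2
      + (5 / (4 * (1 + s)) - 1) * (norm (Z - R))\<^sup>2)
      - (5 / (4 * \<rho> * (1 + s)) - 1) * (\<rho>\<^sup>2 * (norm (Z - R))\<^sup>2)"
  proof -
    have "5 / (4 * \<rho> * (1 + s)) * (\<rho>\<^sup>2 * (norm (Z - R))\<^sup>2) = \<rho> * (5 / (4 * (1 + s)) * (norm (Z - R))\<^sup>2)"
      using \<rho> by (simp add: power2_eq_square[of \<rho>])
    then show ?thesis by (simp add: left_diff_distrib distrib_left right_diff_distrib)
  qed
  also have "\<dots> \<le> (norm (Z - p))\<^sup>2 + \<rho> * (- 2 * (lam * inner (B - V Y) (Y - p)) - 3 / 8 * d\<^sup>2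
      + 5 * lam\<^sup>2 * ((norm (A - V Z))\<^sup>2 + (norm (B - V Y))\<^sup>2))
      - (5 / (4 * \<rho> * (1 + s)) - 1) * (\<rho>\<^sup>2 * (norm (Z - R))\<^sup>2)"
    using \<rho> key R_p R_Y_sq absorb n_sq
    by (intro diff_right_mono add_left_mono mult_left_mono) (auto simp: algebra_simps)
  finally show ?thesis
    unfolding X'_Z d_def s_def by (simp add: algebra_simps)
qed

text \<open>Both |Z - p|^2 and |X' - Z|^2 are expanded exactly in terms of the iterates. The only
  loss is the nonnegative term \<alpha> |(X' - X) - (X - Xprev)|^2, dropped from the second
  expansion.\<close>

lemma inertial_step:
  fixes X X' Xprev p :: "'a::real_inner"
  assumes \<alpha>: "0 \<le> \<alpha>" and \<kappa>: "0 \<le> \<kappa>" and Z: "Z = X + \<alpha> *\<^sub>R (X - Xprev)"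
    and step: "(norm (X' - p))\<^sup>2 \<le> (norm (Z - p))\<^sup>2 + c - \<kappa> * (norm (X' - Z))\<^sup>2"
  shows "(norm (X' - p))\<^sup>2 \<le> (1 + \<alpha>) * (norm (X - p))\<^sup>2 - \<alpha> * (norm (Xprev - p))\<^sup>2
    + (\<alpha> * (1 + \<alpha>) + \<kappa> * \<alpha> * (1 - \<alpha>)) * (norm (X - Xprev))\<^sup>2 - \<kappa> * (1 - \<alpha>) * (norm (X' - X))\<^sup>2 + c"
proof -
  have Z_p: "(norm (Z - p))\<^sup>2 = (1 + \<alpha>) * (norm (X - p))\<^sup>2 - \<alpha> * (norm (Xprev - p))\<^sup>2
      + \<alpha> * (1 + \<alpha>) * (norm (X - Xprev))\<^sup>2"
    unfolding Z by (simp add: power2_norm_eq_inner inner_add inner_diff inner_commute algebra_simps)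
  define u v where "u = X' - X" and "v = X - Xprev"
  have "X' - Z = u - \<alpha> *\<^sub>R v" by (simp add: Z u_def v_def)
  then have "(norm (X' - Z))\<^sup>2
      = (1 - \<alpha>) * (norm u)\<^sup>2 - \<alpha> * (1 - \<alpha>) * (norm v)\<^sup>2 + \<alpha> * (norm (u - v))\<^sup>2"
    by (simp only:) (simp add: power2_norm_eq_inner inner_diff inner_commute algebra_simps)
  also have "\<dots> \<ge> (1 - \<alpha>) * (norm u)\<^sup>2 - \<alpha> * (1 - \<alpha>) * (norm v)\<^sup>2" using \<alpha> by simp
  finally have "\<kappa> * ((1 - \<alpha>) * (norm u)\<^sup>2 - \<alpha> * (1 - \<alpha>) * (norm v)\<^sup>2) \<le> \<kappa> * (norm (X' - Z))\<^sup>2"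
    by (rule mult_left_mono[OF _ \<kappa>])
  then show ?thesis using step unfolding Z_p u_def v_def by (simp add: algebra_simps)
qed

text \<open>The negative term \<alpha> |Xprev - p|^2 is split by Young's inequality with the weight
  that spends half of 1 - \<alpha> on |X - p|^2; the rest falls on the increment with coefficient
  \<alpha> (1 + \<alpha>) / (1 - \<alpha>).\<close>

lemma lyapunov_lower_bound:
  fixes X Xprev p :: "'a::real_inner"
  assumes \<alpha>: "0 \<le> \<alpha>" "\<alpha> < 1" and \<delta>: "\<delta> \<le> (1 - \<alpha>) / 2" "\<alpha> * (1 + \<alpha>) / (1 - \<alpha>) + \<delta> \<le> a"
  shows "\<delta> * ((norm (X - p))\<^sup>2 + (norm (X - Xprev))\<^sup>2)
    \<le> (norm (X - p))\<^sup>2 - \<alpha> * (norm (Xprev - p))\<^sup>2 + a * (norm (X - Xprev))\<^sup>2"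
proof -
  define u v where "u = X - p" and "v = X - Xprev"
  have "Xprev - p = u - v" by (simp add: u_def v_def)
  define \<beta> where "\<beta> = 1 - \<alpha>"
  have \<beta>: "0 < \<beta>" using \<alpha> by (simp add: \<beta>_def)
  have "0 \<le> (norm (\<beta> *\<^sub>R u + (2 * \<alpha>) *\<^sub>R v))\<^sup>2 / (2 * \<beta>)" using \<beta> by simp
  also have "\<dots> = \<beta> / 2 * (norm u)\<^sup>2 + 2 * \<alpha> * inner u v + 2 * \<alpha>\<^sup>2 / \<beta> * (norm v)\<^sup>2"
  proof -
    have "(norm (\<beta> *\<^sub>R u + (2 * \<alpha>) *\<^sub>R v))\<^sup>2
        = \<beta> * \<beta> * (norm u)\<^sup>2 + 4 * \<beta> * \<alpha> * inner u v + 4 * \<alpha>\<^sup>2 * (norm v)\<^sup>2"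
      by (simp add: power2_norm_eq_inner power2_eq_square[of \<alpha>] inner_add inner_commute algebra_simps)
    then show ?thesis using \<beta> by (simp add: add_divide_distrib)
  qed
  finally have "\<alpha> * (norm (u - v))\<^sup>2 \<le> (\<alpha> + \<beta> / 2) * (norm u)\<^sup>2 + (\<alpha> + 2 * \<alpha>\<^sup>2 / \<beta>) * (norm v)\<^sup>2"
    by (simp add: power2_norm_eq_inner inner_diff inner_commute algebra_simps)
  also have "\<alpha> + 2 * \<alpha>\<^sup>2 / \<beta> = \<alpha> * (1 + \<alpha>) / (1 - \<alpha>)"
    using \<alpha> by (simp add: \<beta>_def field_simps power2_eq_square)
  finally have "\<alpha> * (norm (u - v))\<^sup>2 \<le> (1 - \<beta> / 2) * (norm u)\<^sup>2 + \<alpha> * (1 + \<alpha>) / (1 - \<alpha>) * (norm v)\<^sup>2"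
    by (simp add: \<beta>_def field_simps)
  moreover have "\<delta> * (norm u)\<^sup>2 \<le> \<beta> / 2 * (norm u)\<^sup>2"
    using \<delta>(1) by (intro mult_right_mono) (auto simp: \<beta>_def)
  moreover have "(\<alpha> * (1 + \<alpha>) / (1 - \<alpha>) + \<delta>) * (norm v)\<^sup>2 \<le> a * (norm v)\<^sup>2"
    using \<delta>(2) by (intro mult_right_mono) auto
  ultimately show ?thesis
    unfolding \<open>Xprev - p = u - v\<close> u_def[symmetric] v_def[symmetric]
    by (simp add: algebra_simps)
qed

section \<open>Pathwise convergence from one-step inequalities\<close>

lemma ln_step:
  fixes H H' :: real
  assumes "0 \<le> H" "0 \<le> H'"
  shows "ln (1 + H') \<le> ln (1 + H) + (H' - H) / (1 + H)"
proof -
  have "ln ((1 + H') / (1 + H)) \<le> (1 + H') / (1 + H) - 1"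
    using assms by (intro ln_le_minus_one) auto
  then show ?thesis using assms by (simp add: ln_div field_simps)
qed

text \<open>A pathwise substitute for the Robbins--Siegmund theorem: the logarithm turns the perturbation
  \<open>g k\<close>, which may grow with \<open>H k\<close>, into a convergent series.\<close>

lemma almost_supermartingale_path:
  fixes H r w g :: "nat \<Rightarrow> real"
  assumes H: "\<And>k. 0 \<le> H k" and r: "\<And>k. 0 \<le> r k" and w: "\<And>k. 0 \<le> w k" "summable w"
    and g: "summable (\<lambda>k. g k / (1 + H k))"
    and step: "\<And>k. H (Suc k) \<le> H k - r k + w k + g k"
  shows "convergent H" "summable r"
proof -
  define e where "e k = w k / (1 + H k) + g k / (1 + H k)" for k
  have pos: "0 < 1 + H k" for k using H[of k] by simp
  have "summable (\<lambda>k. w k / (1 + H k))"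
  proof (rule summable_comparison_test'[OF w(2)])
    show "norm (w k / (1 + H k)) \<le> w k" for k
      using mult_left_mono[of 1 "1 + H k" "w k"] w(1)[of k] H[of k] pos[of k]
      by (simp add: pos_divide_le_eq)
  qed
  then have e: "summable e" unfolding e_def using g by (rule summable_add)
  define l where "l k = ln (1 + H k)" for k
  have l_nonneg: "0 \<le> l k" for k using H by (simp add: l_def)
  have l_step: "l (Suc k) + r k / (1 + H k) \<le> l k + e k" for k
  proof -
    have "l (Suc k) \<le> l k + (H (Suc k) - H k) / (1 + H k)"
      unfolding l_def using H by (intro ln_step)
    also have "\<dots> \<le> l k + (- r k + w k + g k) / (1 + H k)"
      using step[of k] pos[of k] by (intro add_left_mono divide_right_mono) auto
    finally show ?thesis by (simp add: e_def add_divide_distrib diff_divide_distrib)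
  qed
  have telescope: "l n + (\<Sum>k<n. r k / (1 + H k)) \<le> l 0 + (\<Sum>k<n. e k)" for n
  proof (induction n)
    case (Suc n)
    then show ?case using l_step[of n] by simp
  qed simp
  obtain B where B: "\<And>n. \<bar>\<Sum>k<n. e k\<bar> \<le> B"
    using summable_imp_sums_bounded[OF e] by (auto simp: bounded_iff)
  \<comment> \<open>After subtracting the partial sums of \<open>e\<close>, the logarithm decreases,
    and it is bounded below because \<open>l\<close> is nonnegative and those sums are
    bounded.\<close>
  have "convergent (\<lambda>n. l n - (\<Sum>k<n. e k))"
  proof (rule Bseq_monoseq_convergent)
    have "l n - (\<Sum>k<n. e k) \<le> l 0" for n
    proof -
      have "0 \<le> (\<Sum>k<n. r k / (1 + H k))"
        using r pos by (intro sum_nonneg divide_nonneg_pos) auto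
      then show ?thesis using telescope[of n] by simp
    qed
    moreover have "- B \<le> l n - (\<Sum>k<n. e k)" for n
      using B[of n] l_nonneg[of n] by (simp add: abs_le_iff)
    ultimately have "\<bar>l n - (\<Sum>k<n. e k)\<bar> \<le> \<bar>B\<bar> + \<bar>l 0\<bar>" for n
      by (smt (verit))
    then show "Bseq (\<lambda>n. l n - (\<Sum>k<n. e k))"
      by (intro BseqI'[of _ "\<bar>B\<bar> + \<bar>l 0\<bar>"]) simp
    have "l (Suc n) - (\<Sum>k<Suc n. e k) \<le> l n - (\<Sum>k<n. e k)" for n
      using l_step[of n] divide_nonneg_pos[OF r pos, of n n] by simp
    then show "monoseq (\<lambda>n. l n - (\<Sum>k<n. e k))"
      by (intro decseq_imp_monoseq decseq_SucI)
  qed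
  then have "convergent (\<lambda>n. (l n - (\<Sum>k<n. e k)) + (\<Sum>k<n. e k))"
    using e by (intro convergent_add) (simp_all add: summable_iff_convergent)
  then have "convergent l" by simp
  then obtain l' where "l \<longlonglongrightarrow> l'" by (auto simp: convergent_def)
  then have "(\<lambda>n. exp (l n) - 1) \<longlonglongrightarrow> exp l' - 1" by (intro tendsto_intros)
  then have "H \<longlonglongrightarrow> exp l' - 1" using pos by (simp add: l_def)
  then show "convergent H" by (auto simp: convergent_def)
  then obtain C where C: "\<And>k. H k \<le> C"
    using convergent_imp_Bseq[OF \<open>convergent H\<close>] by (force simp: Bseq_def abs_le_iff)
  have "summable (\<lambda>k. r k / (1 + H k))"
  proof (rule bounded_imp_summable)
    show "0 \<le> r k / (1 + H k)" for k using divide_nonneg_pos[OF r pos] .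
    show "(\<Sum>k\<le>n. r k / (1 + H k)) \<le> l 0 + B" for n
      using telescope[of "Suc n"] B[of "Suc n"] l_nonneg[of "Suc n"]
      by (simp add: lessThan_Suc_atMost abs_le_iff)
  qed
  \<comment> \<open>Convergence of \<open>H\<close> bounds the weights 1 + H, so they can be removed
    from the series.\<close>
  then have "summable (\<lambda>k. (1 + C) * (r k / (1 + H k)))" by (rule summable_mult)
  then show "summable r"
  proof (rule summable_comparison_test'[where N = 0])
    show "norm (r k) \<le> (1 + C) * (r k / (1 + H k))" for k
    proof -
      have "r k * (1 + H k) \<le> r k * (1 + C)"
        using C[of k] r[of k] by (intro mult_left_mono) auto
      then show ?thesis using pos[of k] r[of k] by (simp add: pos_le_divide_eq mult.commute)
    qed
  qed
qed

text \<open>Vanishing increments and boundedness make consecutive squared distances asymptotically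
  equal. The energy then has the same limit as (1 - \<alpha> k) times one squared distance, and 1 -
  \<open>\<alpha>bar\<close> > 0 allows the division.\<close>

lemma inertial_distance_convergent:
  fixes X :: "nat \<Rightarrow> 'a::real_inner" and \<alpha> a :: "nat \<Rightarrow> real"
  assumes \<alpha>: "\<alpha> \<longlonglongrightarrow> \<alpha>bar" "\<alpha>bar < 1" and a: "convergent a"
    and diff: "(\<lambda>k. X (Suc k) - X k) \<longlonglongrightarrow> 0" and bounded: "bounded (range X)"
    and H: "convergent (\<lambda>k. (norm (X (Suc k) - p))\<^sup>2 - \<alpha> k * (norm (X k - p))\<^sup>2
      + a k * (norm (X (Suc k) - X k))\<^sup>2)"
  shows "convergent (\<lambda>k. norm (X k - p))"
proof -
  obtain C where C: "\<And>k. norm (X k) \<le> C" using bounded by (auto simp: bounded_iff)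
  define \<phi> where "\<phi> k = (norm (X k - p))\<^sup>2" for k
  obtain h where h: "(\<lambda>k. \<phi> (Suc k) - \<alpha> k * \<phi> k + a k * (norm (X (Suc k) - X k))\<^sup>2) \<longlonglongrightarrow> h"
    using H by (auto simp: convergent_def \<phi>_def)
  obtain abar where abar: "a \<longlonglongrightarrow> abar" using a by (auto simp: convergent_def)
  have "(\<lambda>k. a k * (norm (X (Suc k) - X k))\<^sup>2) \<longlonglongrightarrow> abar * (norm (0::'a))\<^sup>2"
    by (intro tendsto_intros abar diff)
  from tendsto_diff[OF h this] have h': "(\<lambda>k. \<phi> (Suc k) - \<alpha> k * \<phi> k) \<longlonglongrightarrow> h" by simp
  have "(\<lambda>k. \<phi> (Suc k) - \<phi> k) \<longlonglongrightarrow> 0"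
  proof (rule Lim_null_comparison)
    have "norm (\<phi> (Suc k) - \<phi> k) \<le> norm (X (Suc k) - X k) * (2 * (C + norm p))" for k
    proof -
      have "\<phi> (Suc k) - \<phi> k
          = (norm (X (Suc k) - p) - norm (X k - p)) * (norm (X (Suc k) - p) + norm (X k - p))"
        by (simp add: \<phi>_def power2_eq_square algebra_simps)
      moreover have "\<bar>norm (X (Suc k) - p) - norm (X k - p)\<bar> \<le> norm (X (Suc k) - X k)"
        using norm_triangle_ineq3[of "X (Suc k) - p" "X k - p"] by simp
      moreover have "norm (X k - p) \<le> C + norm p" for k
        using norm_triangle_ineq4[of "X k" p] C[of k] by simp
      from this[of k] this[of "Suc k"]
      have "norm (X (Suc k) - p) + norm (X k - p) \<le> 2 * (C + norm p)" by simp
      ultimately show ?thesis by (simp add: abs_mult mult_mono)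
    qed
    then show "\<forall>\<^sub>F k in sequentially. norm (\<phi> (Suc k) - \<phi> k) \<le> norm (X (Suc k) - X k) * (2 * (C + norm p))"
      by simp
    show "(\<lambda>k. norm (X (Suc k) - X k) * (2 * (C + norm p))) \<longlonglongrightarrow> 0"
      using tendsto_mult_right[OF tendsto_norm[OF diff], of "2 * (C + norm p)"] by simp
  qed
  from tendsto_diff[OF h' this]
  have "(\<lambda>k. (1 - \<alpha> k) * \<phi> k) \<longlonglongrightarrow> h" by (simp add: algebra_simps)
  moreover have "(\<lambda>k. 1 - \<alpha> k) \<longlonglongrightarrow> 1 - \<alpha>bar" by (intro tendsto_intros \<alpha>)
  ultimately have "(\<lambda>k. (1 - \<alpha> k) * \<phi> k / (1 - \<alpha> k)) \<longlonglongrightarrow> h / (1 - \<alpha>bar)"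
    using \<alpha>(2) by (intro tendsto_divide) auto
  moreover have "\<forall>\<^sub>F k in sequentially. (1 - \<alpha> k) * \<phi> k / (1 - \<alpha> k) = \<phi> k"
    using order_tendstoD(2)[OF \<alpha>] by eventually_elim simp
  ultimately have "\<phi> \<longlonglongrightarrow> h / (1 - \<alpha>bar)" by (rule Lim_transform_eventually)
  then have "(\<lambda>k. sqrt (\<phi> k)) \<longlonglongrightarrow> sqrt (h / (1 - \<alpha>bar))" by (rule tendsto_real_sqrt)
  then show ?thesis by (auto simp: \<phi>_def convergent_def)
qed

section \<open>Limits of the parameters\<close>

text \<open>Strict inequalities are checked for the limits only and transferred to all large k by
  continuity. They all come from \<open>excess\<close>, the gap that division by 1 -
  \<open>\<epsilon>bar\<close> opens above D = (1 - \<alpha>)^2 + \<alpha> (1 + \<alpha>) at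
  \<alpha> = \<open>\<alpha>bar\<close>.\<close>

lemma risfbf_parameters:
  fixes \<alpha> :: "nat \<Rightarrow> real"
  assumes bars: "0 < \<alpha>bar" "\<alpha>bar < 1" "0 < \<epsilon>bar" "\<epsilon>bar < 1" and \<alpha>: "\<alpha> \<longlonglongrightarrow> \<alpha>bar"
  defines "\<kappa> \<equiv> \<lambda>k. (2 * (\<alpha> k)\<^sup>2 - \<alpha> k + 1) / ((1 - \<epsilon>bar) * (1 - \<alpha>bar)\<^sup>2) - 1"
  defines "a \<equiv> \<lambda>k. \<alpha> k * (1 + \<alpha> k) + \<kappa> k * \<alpha> k * (1 - \<alpha> k)"
  obtains \<delta> where "0 < \<delta>" "convergent a"
    "\<forall>\<^sub>F k in sequentially. \<alpha> k < 1 \<and> 0 \<le> \<kappa> k \<and> \<delta> \<le> \<kappa> k * (1 - \<alpha> k) - a (Suc k) \<and>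
      \<delta> \<le> (1 - \<alpha> k) / 2 \<and> \<alpha> k * (1 + \<alpha> k) / (1 - \<alpha> k) + \<delta> \<le> a k"
proof -
  define D where "D = 2 * \<alpha>bar\<^sup>2 - \<alpha>bar + 1"
  define \<kappa>bar where "\<kappa>bar = D / ((1 - \<epsilon>bar) * (1 - \<alpha>bar)\<^sup>2) - 1"
  define abar where "abar = \<alpha>bar * (1 + \<alpha>bar) + \<kappa>bar * \<alpha>bar * (1 - \<alpha>bar)"
  have \<kappa>_lim: "\<kappa> \<longlonglongrightarrow> \<kappa>bar"
    unfolding \<kappa>_def \<kappa>bar_def D_def using bars by (intro tendsto_intros \<alpha>) auto
  have a_lim: "a \<longlonglongrightarrow> abar"
    unfolding a_def abar_def by (intro tendsto_intros \<alpha> \<kappa>_lim)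
  \<comment> \<open>The right-hand side is 2 D.\<close>
  have "0 < (2 * \<alpha>bar - 1 / 2)\<^sup>2 + 7 / 4" by (rule add_nonneg_pos) auto
  then have D: "0 < D" by (simp add: D_def power2_eq_square algebra_simps)
  have x: "\<kappa>bar * (1 - \<alpha>bar)\<^sup>2 = D / (1 - \<epsilon>bar) - (1 - \<alpha>bar)\<^sup>2"
  proof -
    have "D / ((1 - \<epsilon>bar) * (1 - \<alpha>bar)\<^sup>2) * (1 - \<alpha>bar)\<^sup>2 = D / (1 - \<epsilon>bar)"
      using bars by simp
    then show ?thesis
      unfolding \<kappa>bar_def left_diff_distrib[of "D / ((1 - \<epsilon>bar) * (1 - \<alpha>bar)\<^sup>2)" 1] by simp
  qed
  have "D * (1 - \<epsilon>bar) < D" using D bars by simp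
  then have gap: "D < D / (1 - \<epsilon>bar)" using bars by (simp add: pos_less_divide_eq)
  have D_eq: "D = (1 - \<alpha>bar)\<^sup>2 + \<alpha>bar * (1 + \<alpha>bar)"
    by (simp add: D_def power2_eq_square algebra_simps)
  have excess: "\<kappa>bar * (1 - \<alpha>bar)\<^sup>2 - \<alpha>bar * (1 + \<alpha>bar) > 0"
    unfolding x using gap D_eq by linarith
  have "0 < \<kappa>bar * (1 - \<alpha>bar)\<^sup>2"
    using excess bars by (smt (verit) mult_nonneg_nonneg)
  then have \<kappa>bar: "0 < \<kappa>bar"
    using bars by (simp add: zero_less_mult_iff)
  define l1 where "l1 = \<kappa>bar * (1 - \<alpha>bar) - abar"
  define l2 where "l2 = (1 - \<alpha>bar) / 2"
  define l3 where "l3 = abar - \<alpha>bar * (1 + \<alpha>bar) / (1 - \<alpha>bar)"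
  have "l1 = \<kappa>bar * (1 - \<alpha>bar)\<^sup>2 - \<alpha>bar * (1 + \<alpha>bar)"
    by (simp add: l1_def abar_def power2_eq_square algebra_simps)
  then have l1: "0 < l1" using excess by simp
  have l2: "0 < l2" using bars by (simp add: l2_def)
  \<comment> \<open>Up to the positive factor \<open>\<alpha>bar\<close> this is
    \<open>excess\<close> again, so coercivity and dissipation have the same threshold.\<close>
  have "l3 * (1 - \<alpha>bar) = \<alpha>bar * (\<kappa>bar * (1 - \<alpha>bar)\<^sup>2 - \<alpha>bar * (1 + \<alpha>bar))"
    using bars by (simp add: l3_def abar_def power2_eq_square left_diff_distrib) (simp add: algebra_simps)
  also have "0 < \<dots>" using excess bars by simp
  finally have l3: "0 < l3" using bars by (simp add: zero_less_mult_iff)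
  define \<delta> where "\<delta> = min l1 (min l2 l3) / 2"
  have \<delta>: "0 < \<delta>" "\<delta> < l1" "\<delta> < l2" "\<delta> < l3" using l1 l2 l3 by (auto simp: \<delta>_def min_def)
  have lim1: "(\<lambda>k. \<kappa> k * (1 - \<alpha> k) - a (Suc k)) \<longlonglongrightarrow> l1"
    unfolding l1_def by (intro tendsto_intros \<kappa>_lim \<alpha> LIMSEQ_Suc[OF a_lim])
  have lim2: "(\<lambda>k. (1 - \<alpha> k) / 2) \<longlonglongrightarrow> l2"
    unfolding l2_def by (intro tendsto_intros \<alpha>) auto
  have lim3: "(\<lambda>k. a k - \<alpha> k * (1 + \<alpha> k) / (1 - \<alpha> k)) \<longlonglongrightarrow> l3"
    unfolding l3_def using bars by (intro tendsto_intros \<alpha> a_lim) auto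
  have "\<forall>\<^sub>F k in sequentially. \<alpha> k < 1 \<and> 0 \<le> \<kappa> k \<and> \<delta> \<le> \<kappa> k * (1 - \<alpha> k) - a (Suc k) \<and>
      \<delta> \<le> (1 - \<alpha> k) / 2 \<and> \<alpha> k * (1 + \<alpha> k) / (1 - \<alpha> k) + \<delta> \<le> a k"
    using order_tendstoD(2)[OF \<alpha> bars(2)] order_tendstoD(1)[OF \<kappa>_lim \<kappa>bar]
      order_tendstoD(1)[OF lim1 \<delta>(2)] order_tendstoD(1)[OF lim2 \<delta>(3)] order_tendstoD(1)[OF lim3 \<delta>(4)]
    by eventually_elim simp
  moreover have "convergent a" using a_lim by (auto simp: convergent_def)
  ultimately show ?thesis using that \<delta>(1) by blast
qed

section \<open>From distances to strong convergence\<close>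

text \<open>One point of S is chosen in every basic open set that meets S: density in the whole
  space would not place the points inside S.\<close>

lemma countable_dense_subset:
  fixes S :: "'a::{second_countable_topology} set"
  obtains D where "countable D" "D \<subseteq> S" "S \<subseteq> closure D"
proof -
  obtain \<B> :: "'a set set" where \<B>: "countable \<B>" "topological_basis \<B>"
    using ex_countable_basis by blast
  define D where "D = (\<lambda>U. SOME x. x \<in> U \<inter> S) ` {U\<in>\<B>. U \<inter> S \<noteq> {}}"
  have in_US: "(SOME x. x \<in> U \<inter> S) \<in> U \<inter> S" if "U \<inter> S \<noteq> {}" for U
    using that by (rule some_in_eq[THEN iffD2])
  have "countable D" unfolding D_def using \<B>(1) by auto
  moreover have "D \<subseteq> S" unfolding D_def using in_US by blast
  moreover have "S \<subseteq> closure D"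
  proof
    fix x assume x: "x \<in> S"
    have "\<exists>y\<in>D. y \<in> A" if A: "open A" "x \<in> A" for A
    proof -
      obtain U where U: "U \<in> \<B>" "x \<in> U" "U \<subseteq> A"
        using topological_basisE[OF \<B>(2) A] by blast
      then have "U \<inter> S \<noteq> {}" using x by blast
      with in_US[OF this] U show ?thesis unfolding D_def by blast
    qed
    then show "x \<in> closure D"
      using closure_subset[of D] open_Compl[OF closed_closure[of D]] by (meson ComplI ComplD subsetD)
  qed
  ultimately show ?thesis using that by blast
qed

lemma demiregular_path_limit:
  fixes T :: "'a::{real_inner,banach,second_countable_topology} \<Rightarrow> 'a set"
  assumes T: "maximally_monotone T" and V: "maximally_monotone (op_of_fun V)"
    and lip: "L-lipschitz_on UNIV V" and demi: "demiregular (op_sum T (op_of_fun V))"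
    and S: "D \<noteq> {}" "op_zeros (op_sum T (op_of_fun V)) \<subseteq> closure D"
    and dist: "\<And>p. p \<in> D \<Longrightarrow> convergent (\<lambda>k. norm (X k - p))"
    and lam: "\<And>k. 0 < lam k" "lam \<longlonglongrightarrow> lam_lim" "0 < lam_lim"
    and Y: "\<And>k. (1 / lam k) *\<^sub>R (Z k - lam k *\<^sub>R A k - Y k) \<in> T (Y k)"
    and ZX: "(\<lambda>k. Z k - X k) \<longlonglongrightarrow> 0" and ZY: "(\<lambda>k. Z k - Y k) \<longlonglongrightarrow> 0"
    and W: "(\<lambda>k. A k - V (Z k)) \<longlonglongrightarrow> 0"
  shows "\<exists>x\<in>op_zeros (op_sum T (op_of_fun V)). X \<longlonglongrightarrow> x"
proof -
  \<comment> \<open>The resolvent inclusion at Y k, with the forward term moved from Z k to Y k;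
    every summand vanishes, so these are values of F at Y k that tend to 0.\<close>
  define u where "u k = (1 / lam k) *\<^sub>R (Z k - Y k) - (A k - V (Z k)) - (V (Z k) - V (Y k))" for k
  have u: "u k \<in> op_sum T (op_of_fun V) (Y k)" for k
  proof -
    have "u k - V (Y k) = (1 / lam k) *\<^sub>R (Z k - lam k *\<^sub>R A k - Y k)"
      using lam(1)[of k] by (simp add: u_def algebra_simps)
    then show ?thesis unfolding op_sum_op_of_fun_iff using Y by simp
  qed
  have "(\<lambda>k. V (Z k) - V (Y k)) \<longlonglongrightarrow> 0"
  proof (rule Lim_null_comparison)
    show "\<forall>\<^sub>F k in sequentially. norm (V (Z k) - V (Y k)) \<le> L * norm (Z k - Y k)"
      using lipschitz_onD[OF lip] by (simp add: dist_norm)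
    show "(\<lambda>k. L * norm (Z k - Y k)) \<longlonglongrightarrow> 0"
      using tendsto_mult_left[OF tendsto_norm[OF ZY], of L] by simp
  qed
  then have "u \<longlonglongrightarrow> (1 / lam_lim) *\<^sub>R 0 - 0 - 0"
    unfolding u_def using lam by (intro tendsto_intros ZY W) auto
  then have u_lim: "u \<longlonglongrightarrow> 0" by simp
  have X_Y: "(\<lambda>k. X k - Y k) \<longlonglongrightarrow> 0"
    using tendsto_diff[OF ZY ZX] by simp
  obtain p where "p \<in> D" using S by blast
  obtain C where C: "\<And>k. norm (X k - p) \<le> C"
    using convergent_imp_Bseq[OF dist[OF \<open>p \<in> D\<close>]] by (force simp: Bseq_def)
  obtain C' where C': "\<And>k. norm (X k - Y k) \<le> C'"
    using convergent_imp_Bseq[of "\<lambda>k. X k - Y k"] X_Y by (force simp: Bseq_def convergent_def)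
  have "norm (Y k) \<le> C + C' + norm p" for k
  proof -
    have "Y k = (X k - p) - (X k - Y k) + p" by simp
    also have "norm \<dots> \<le> norm (X k - p) + norm (X k - Y k) + norm p"
      by (meson add_right_mono norm_triangle_ineq norm_triangle_ineq4 order_trans)
    finally show ?thesis using C[of k] C'[of k] by simp
  qed
  then have bounded: "bounded (range Y)" by (auto simp: bounded_iff)
  then obtain x r where r: "strict_mono r" and weak: "weakly_tendsto (Y \<circ> r) x"
    using bounded_imp_weakly_convergent_subseq by blast
  have u_r: "(u \<circ> r) \<longlonglongrightarrow> 0" using u_lim r by (rule LIMSEQ_subseq_LIMSEQ)
  have x: "x \<in> op_zeros (op_sum T (op_of_fun V))"
  proof (rule weak_limit_in_op_zeros[OF T V lip _ u_r weak])
    show "bounded (range (Y \<circ> r))"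
      using bounded by (rule bounded_subset) auto
  qed (use u in auto)
  then have "demiregular_at (op_sum T (op_of_fun V)) x"
    using demi by (auto simp: demiregular_def op_zeros_def op_dom_def)
  moreover have "0 \<in> op_sum T (op_of_fun V) x" using x by (simp add: op_zeros_def)
  moreover have "\<forall>n. (u \<circ> r) n \<in> op_sum T (op_of_fun V) ((Y \<circ> r) n)" using u by simp
  ultimately have Y_r: "(Y \<circ> r) \<longlonglongrightarrow> x"
    using weak u_r unfolding demiregular_at_def by blast
  then have "(\<lambda>n. (X \<circ> r) n - (Y \<circ> r) n + (Y \<circ> r) n) \<longlonglongrightarrow> 0 + x"
    using LIMSEQ_subseq_LIMSEQ[OF X_Y r] by (intro tendsto_add) (auto simp: o_def)
  then have X_r: "(\<lambda>n. X (r n)) \<longlonglongrightarrow> x" by simp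
  have "X \<longlonglongrightarrow> x"
  proof (rule metric_LIMSEQ_I)
    fix e :: real assume e: "0 < e"
    \<comment> \<open>The limit x need not lie in \<open>D\<close>, so its own distance to X is not
      known to converge. A nearby q in \<open>D\<close> serves instead, and the subsequence
      identifies the limit of |X - q| as |x - q|.\<close>
    have "x \<in> closure D" using x S(2) by blast
    then obtain q where q: "q \<in> D" "dist q x < e / 3"
      using e closure_approachable[of x D] by (meson divide_pos_pos zero_less_numeral)
    obtain d where d: "(\<lambda>k. norm (X k - q)) \<longlonglongrightarrow> d"
      using dist[OF q(1)] by (auto simp: convergent_def)
    have "(\<lambda>n. norm (X (r n) - q)) \<longlonglongrightarrow> norm (x - q)"
      by (intro tendsto_intros X_r)
    moreover have "(\<lambda>n. norm (X (r n) - q)) \<longlonglongrightarrow> d"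
      using LIMSEQ_subseq_LIMSEQ[OF d r] by (simp add: o_def)
    ultimately have "d = norm (x - q)" by (rule LIMSEQ_unique[rotated])
    then have "d < e / 3 + e / 3" using q(2) e by (simp add: dist_norm norm_minus_commute)
    from order_tendstoD(2)[OF d this]
    obtain N where N: "\<And>k. N \<le> k \<Longrightarrow> norm (X k - q) < e / 3 + e / 3"
      by (auto simp: eventually_sequentially)
    show "\<exists>N. \<forall>k\<ge>N. dist (X k) x < e"
    proof (intro exI[of _ N] allI impI)
      fix k assume "N \<le> k"
      have "dist (X k) x \<le> dist (X k) q + dist q x" by (rule dist_triangle)
      also have "\<dots> < (e / 3 + e / 3) + e / 3"
        using N[OF \<open>N \<le> k\<close>] q(2) by (intro add_strict_mono) (auto simp: dist_norm)
      finally show "dist (X k) x < e" by simp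
    qed
  qed
  with x show ?thesis by blast
qed

lemma AE_summable_nonneg:
  fixes f :: "nat \<Rightarrow> 'a \<Rightarrow> real"
  assumes int: "\<And>k. integrable M (f k)" and nonneg: "\<And>k x. 0 \<le> f k x"
    and sum: "summable (\<lambda>k. integral\<^sup>L M (f k))"
  shows "AE x in M. summable (\<lambda>k. f k x)"
proof -
  note borel_measurable_integrable[OF int, measurable]
  have "(\<integral>\<^sup>+x. (\<Sum>k. ennreal (f k x)) \<partial>M) = (\<Sum>k. \<integral>\<^sup>+x. ennreal (f k x) \<partial>M)"
    by (intro nn_integral_suminf) measurable
  also have "\<dots> = (\<Sum>k. ennreal (integral\<^sup>L M (f k)))"
    using int nonneg by (simp add: nn_integral_eq_integral)
  also have "\<dots> = ennreal (\<Sum>k. integral\<^sup>L M (f k))"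
    using sum nonneg by (intro suminf_ennreal2) (auto intro: Bochner_Integration.integral_nonneg)
  finally have "(\<integral>\<^sup>+x. (\<Sum>k. ennreal (f k x)) \<partial>M) \<noteq> \<infinity>" by simp
  then have "AE x in M. (\<Sum>k. ennreal (f k x)) \<noteq> \<infinity>"
    by (intro nn_integral_noteq_infinite) measurable
  then show ?thesis
    by eventually_elim (auto intro: summable_suminf_not_top nonneg)
qed

lemma power2_norm_tendsto_0D:
  assumes "(\<lambda>k. (norm (f k))\<^sup>2) \<longlonglongrightarrow> 0"
  shows "f \<longlonglongrightarrow> (0 :: 'a::real_normed_vector)"
  using tendsto_real_sqrt[OF assms] by (simp add: tendsto_norm_zero_iff)

section \<open>The stochastic process\<close>

text \<open>The value at \<open>Initial\<close> is arbitrary: draws are taken only on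
  \<open>sources m - {Initial}\<close>.\<close>

fun source_draw :: "(nat \<Rightarrow> nat \<Rightarrow> 'w \<Rightarrow> 's) \<Rightarrow> (nat \<Rightarrow> nat \<Rightarrow> 'w \<Rightarrow> 's) \<Rightarrow> source \<Rightarrow> 'w \<Rightarrow> 's" where
  "source_draw \<xi> \<eta> Initial = undefined"
| "source_draw \<xi> \<eta> (Draw_Z k t) = \<xi> k t"
| "source_draw \<xi> \<eta> (Draw_Y k t) = \<eta> k t"

locale risfbf =
  stochastic_oracle M "sources m" E N P "sources m - {Initial}" "source_draw \<xi> \<eta>" Vhat V \<sigma>
  for M :: "'w measure" and m and E :: "source \<Rightarrow> 'w set set" and N P :: "'s measure"
    and \<xi> \<eta> :: "nat \<Rightarrow> nat \<Rightarrow> 'w \<Rightarrow> 's"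
    and Vhat :: "'h::{real_inner,banach,second_countable_topology} \<Rightarrow> 's \<Rightarrow> 'h"
    and V :: "'h \<Rightarrow> 'h" and \<sigma> :: real +
  fixes T :: "'h \<Rightarrow> 'h set" and L \<alpha>bar \<epsilon>bar :: real and \<alpha> \<rho> lam :: "nat \<Rightarrow> real"
    and X Z Y A B :: "nat \<Rightarrow> 'w \<Rightarrow> 'h"
  assumes T: "maximally_monotone T"
    and V: "maximally_monotone (op_of_fun V)"
    and L: "0 < L" "L-lipschitz_on UNIV V"
    and m: "\<And>k. 1 \<le> k \<Longrightarrow> 1 \<le> m k" "summable (\<lambda>k. 1 / real (m (Suc k)))"
    and bars: "0 < \<alpha>bar" "\<alpha>bar < 1" "0 < \<epsilon>bar" "\<epsilon>bar < 1"
    and \<alpha>: "\<And>k. 1 \<le> k \<Longrightarrow> 0 \<le> \<alpha> k" "mono_on {1..} \<alpha>" "\<alpha> \<longlonglongrightarrow> \<alpha>bar"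
    and lam: "\<And>k. 1 \<le> k \<Longrightarrow> lam k \<in> {0<..<1 / (4 * L)}"
    and \<rho>: "\<And>k. 1 \<le> k \<Longrightarrow> \<rho> k = 5 * (1 - \<epsilon>bar) * (1 - \<alpha>bar)\<^sup>2
        / (4 * (2 * (\<alpha> k)\<^sup>2 - \<alpha> k + 1) * (1 + L * lam k))"
    and initial: "X 0 \<in> borel_measurable (G {Initial})" "X 1 \<in> borel_measurable (G {Initial})"
    and Z: "\<And>k \<omega>. 1 \<le> k \<Longrightarrow> \<omega> \<in> space M \<Longrightarrow> Z k \<omega> = X k \<omega> + \<alpha> k *\<^sub>R (X k \<omega> - X (k - 1) \<omega>)"
    and A: "\<And>k \<omega>. 1 \<le> k \<Longrightarrow> \<omega> \<in> space M \<Longrightarrow>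
      A k \<omega> = batch_average Vhat (m k) (Z k \<omega>) (\<lambda>t. \<xi> k t \<omega>)"
    and Y: "\<And>k \<omega>. 1 \<le> k \<Longrightarrow> \<omega> \<in> space M \<Longrightarrow>
      Y k \<omega> = resolvent (lam k) T (Z k \<omega> - lam k *\<^sub>R A k \<omega>)"
    and B: "\<And>k \<omega>. 1 \<le> k \<Longrightarrow> \<omega> \<in> space M \<Longrightarrow>
      B k \<omega> = batch_average Vhat (m k) (Y k \<omega>) (\<lambda>t. \<eta> k t \<omega>)"
    and X_Suc: "\<And>k \<omega>. 1 \<le> k \<Longrightarrow> \<omega> \<in> space M \<Longrightarrow>
      X (Suc k) \<omega> = (1 - \<rho> k) *\<^sub>R Z k \<omega> + \<rho> k *\<^sub>R (Y k \<omega> + lam k *\<^sub>R (A k \<omega> - B k \<omega>))"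
begin

section \<open>Measurability of the iterates with respect to the sources\<close>

definition past :: "nat \<Rightarrow> source set"
  where "past k = {Initial} \<union> {Draw_Z j t | j t. 1 \<le> j \<and> j < k \<and> 1 \<le> t \<and> t \<le> m j}
    \<union> {Draw_Y j t | j t. 1 \<le> j \<and> j < k \<and> 1 \<le> t \<and> t \<le> m j}"

text \<open>The information available once Y k is computed and before the batch at Y k is drawn; the
  noise U k is orthogonal to it.\<close>

definition mid :: "nat \<Rightarrow> source set"
  where "mid k = past k \<union> Draw_Z k ` {1..m k}"

lemma past_subset: "past k \<subseteq> sources m"
  by (auto simp: past_def sources_def)

lemma mid_subset: "1 \<le> k \<Longrightarrow> mid k \<subseteq> sources m"
  using past_subset by (auto simp: mid_def sources_def)

lemma past_mono: "j \<le> k \<Longrightarrow> past j \<subseteq> past k"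
  by (auto simp: past_def)

lemma past_Suc:
  assumes "1 \<le> k"
  shows "past (Suc k) = mid k \<union> Draw_Y k ` {1..m k}"
  using assms by (auto simp: past_def mid_def less_Suc_eq)

lemma Draw_Z_new: "1 \<le> k \<Longrightarrow> Draw_Z k ` {1..m k} \<subseteq> sources m - {Initial} - past k"
  by (auto simp: past_def sources_def)

lemma Draw_Y_new: "1 \<le> k \<Longrightarrow> Draw_Y k ` {1..m k} \<subseteq> sources m - {Initial} - mid k"
  by (auto simp: past_def mid_def sources_def)

definition W :: "nat \<Rightarrow> 'w \<Rightarrow> 'h" where "W k \<omega> = A k \<omega> - V (Z k \<omega>)"
definition U :: "nat \<Rightarrow> 'w \<Rightarrow> 'h" where "U k \<omega> = B k \<omega> - V (Y k \<omega>)"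

lemma W_eq: "1 \<le> k \<Longrightarrow> \<omega> \<in> space M \<Longrightarrow>
    W k \<omega> = batch_average Vhat (m k) (Z k \<omega>) (\<lambda>t. source_draw \<xi> \<eta> (Draw_Z k t) \<omega>) - V (Z k \<omega>)"
  by (simp add: W_def A)

lemma U_eq: "1 \<le> k \<Longrightarrow> \<omega> \<in> space M \<Longrightarrow>
    U k \<omega> = batch_average Vhat (m k) (Y k \<omega>) (\<lambda>t. source_draw \<xi> \<eta> (Draw_Y k t) \<omega>) - V (Y k \<omega>)"
  by (simp add: U_def B)

lemma adapted_step:
  assumes k: "1 \<le> k" and X: "X k \<in> borel_measurable (G (past k))" "X (k - 1) \<in> borel_measurable (G (past k))"
  shows "Z k \<in> borel_measurable (G (past k))" "Y k \<in> borel_measurable (G (mid k))"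
    "W k \<in> borel_measurable (G (mid k))" "U k \<in> borel_measurable (G (past (Suc k)))"
    "X (Suc k) \<in> borel_measurable (G (past (Suc k)))"
proof -
  note [measurable] = X
  have "(\<lambda>\<omega>. X k \<omega> + \<alpha> k *\<^sub>R (X k \<omega> - X (k - 1) \<omega>)) \<in> borel_measurable (G (past k))" by measurable
  then show Z_past: "Z k \<in> borel_measurable (G (past k))"
    using Z[OF k] by (subst measurable_cong[where g = "\<lambda>\<omega>. X k \<omega> + \<alpha> k *\<^sub>R (X k \<omega> - X (k - 1) \<omega>)"]) auto
  note W_batch = batch_noise(1)[OF past_subset _ Draw_Z_new[OF k] Z_past m(1)[OF k], folded mid_def]
  show W_mid: "W k \<in> borel_measurable (G (mid k))"
    using W_batch by (subst measurable_cong[OF W_eq[OF k]]) (auto simp: inj_on_def)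
  have Z_mid: "Z k \<in> borel_measurable (G (mid k))"
    using Z_past mid_subset[OF k] by (auto intro: measurable_G_mono simp: mid_def)
  note [measurable] = W_mid Z_mid V_measurable
  have "continuous_on UNIV (resolvent (lam k) T)"
    using lam[OF k] by (intro continuous_on_resolvent T) auto
  then have [measurable]: "resolvent (lam k) T \<in> borel_measurable borel"
    by (rule borel_measurable_continuous_onI)
  \<comment> \<open>A k is written as W k + V (Z k), two terms whose measurability is already
    known.\<close>
  have "(\<lambda>\<omega>. resolvent (lam k) T (Z k \<omega> - lam k *\<^sub>R (W k \<omega> + V (Z k \<omega>)))) \<in> borel_measurable (G (mid k))"
    by measurable
  then show Y_mid: "Y k \<in> borel_measurable (G (mid k))"
    using Y[OF k] by (subst measurable_cong[where
        g = "\<lambda>\<omega>. resolvent (lam k) T (Z k \<omega> - lam k *\<^sub>R (W k \<omega> + V (Z k \<omega>)))"]) (auto simp: W_def)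
  note U_batch = batch_noise(1)[OF mid_subset[OF k] _ Draw_Y_new[OF k] Y_mid m(1)[OF k], folded past_Suc[OF k]]
  show U_past: "U k \<in> borel_measurable (G (past (Suc k)))"
    using U_batch by (subst measurable_cong[OF U_eq[OF k]]) (auto simp: inj_on_def)
  have later: "f \<in> borel_measurable (G (past (Suc k)))" if "f \<in> borel_measurable (G (mid k))" for f :: "'w \<Rightarrow> 'h"
    by (rule measurable_G_mono[OF that _ past_subset]) (simp add: past_Suc[OF k])
  note [measurable] = U_past later[OF Z_mid] later[OF Y_mid] later[OF W_mid]
  have "(\<lambda>\<omega>. (1 - \<rho> k) *\<^sub>R Z k \<omega> + \<rho> k *\<^sub>R (Y k \<omega> + lam k *\<^sub>R
      ((W k \<omega> + V (Z k \<omega>)) - (U k \<omega> + V (Y k \<omega>))))) \<in> borel_measurable (G (past (Suc k)))"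
    by measurable
  then show "X (Suc k) \<in> borel_measurable (G (past (Suc k)))"
    using X_Suc[OF k] by (subst measurable_cong[where g = "\<lambda>\<omega>. (1 - \<rho> k) *\<^sub>R Z k \<omega> + \<rho> k *\<^sub>R (Y k \<omega> + lam k *\<^sub>R
      ((W k \<omega> + V (Z k \<omega>)) - (U k \<omega> + V (Y k \<omega>))))"]) (auto simp: W_def U_def)
qed

lemma adapted_X:
  assumes "1 \<le> k"
  shows "X k \<in> borel_measurable (G (past k)) \<and> X (k - 1) \<in> borel_measurable (G (past k))"
  using assms
proof (induction k rule: dec_induct)
  case base
  have "past 1 = {Initial}" by (auto simp: past_def)
  then show ?case using initial by simp
next
  case (step k)
  then have k: "1 \<le> k" and X: "X k \<in> borel_measurable (G (past k))" "X (k - 1) \<in> borel_measurable (G (past k))"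
    by simp_all
  have "X k \<in> borel_measurable (G (past (Suc k)))"
    by (rule measurable_G_mono[OF X(1) past_mono past_subset]) simp
  then show ?case using adapted_step(5)[OF k X] by simp
qed

lemmas adapted = adapted_step[OF _ adapted_X[THEN conjunct1] adapted_X[THEN conjunct2]]

lemma measurable_X: "X k \<in> borel_measurable M"
proof (cases "k = 0")
  case True
  then show ?thesis using initial(1) by (auto intro!: measurable_G_M simp: sources_def)
next
  case False
  then show ?thesis using adapted_X[of k] past_subset by (auto intro: measurable_G_M)
qed

section \<open>Moments of the batch noise\<close>

lemma W_square:
  assumes k: "1 \<le> k"
  shows "integrable M (\<lambda>\<omega>. (norm (W k \<omega>))\<^sup>2)" "expectation (\<lambda>\<omega>. (norm (W k \<omega>))\<^sup>2) \<le> \<sigma>\<^sup>2 / real (m k)"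
proof -
  have inj: "inj_on (Draw_Z k) {1..m k}" by (auto simp: inj_on_def)
  note batch = batch_noise[OF past_subset inj Draw_Z_new[OF k] adapted(1)[OF k k k] m(1)[OF k]]
  show "integrable M (\<lambda>\<omega>. (norm (W k \<omega>))\<^sup>2)"
    using batch(2) by (subst Bochner_Integration.integrable_cong[OF refl]) (auto simp: W_eq[OF k])
  have "expectation (\<lambda>\<omega>. (norm (W k \<omega>))\<^sup>2) = expectation (\<lambda>\<omega>. (norm (batch_average Vhat (m k) (Z k \<omega>)
      (\<lambda>t. source_draw \<xi> \<eta> (Draw_Z k t) \<omega>) - V (Z k \<omega>)))\<^sup>2)"
    by (rule Bochner_Integration.integral_cong) (auto simp only: W_eq[OF k])
  with batch(3) show "expectation (\<lambda>\<omega>. (norm (W k \<omega>))\<^sup>2) \<le> \<sigma>\<^sup>2 / real (m k)" by linarith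
qed

lemma U_square:
  assumes k: "1 \<le> k"
  shows "integrable M (\<lambda>\<omega>. (norm (U k \<omega>))\<^sup>2)" "expectation (\<lambda>\<omega>. (norm (U k \<omega>))\<^sup>2) \<le> \<sigma>\<^sup>2 / real (m k)"
    and U_orthogonal: "\<And>b. b \<in> borel_measurable (G (mid k)) \<Longrightarrow> integrable M (\<lambda>\<omega>. norm (b \<omega>)) \<Longrightarrow>
      expectation (\<lambda>\<omega>. inner (b \<omega>) (U k \<omega>)) = 0"
proof -
  have inj: "inj_on (Draw_Y k) {1..m k}" by (auto simp: inj_on_def)
  note batch = batch_noise[OF mid_subset[OF k] inj Draw_Y_new[OF k] adapted(2)[OF k k k] m(1)[OF k]]
  show "integrable M (\<lambda>\<omega>. (norm (U k \<omega>))\<^sup>2)"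
    using batch(2) by (subst Bochner_Integration.integrable_cong[OF refl]) (auto simp: U_eq[OF k])
  have "expectation (\<lambda>\<omega>. (norm (U k \<omega>))\<^sup>2) = expectation (\<lambda>\<omega>. (norm (batch_average Vhat (m k) (Y k \<omega>)
      (\<lambda>t. source_draw \<xi> \<eta> (Draw_Y k t) \<omega>) - V (Y k \<omega>)))\<^sup>2)"
    by (rule Bochner_Integration.integral_cong) (auto simp only: U_eq[OF k])
  with batch(3) show "expectation (\<lambda>\<omega>. (norm (U k \<omega>))\<^sup>2) \<le> \<sigma>\<^sup>2 / real (m k)" by linarith
  show "expectation (\<lambda>\<omega>. inner (b \<omega>) (U k \<omega>)) = 0"
    if "b \<in> borel_measurable (G (mid k))" "integrable M (\<lambda>\<omega>. norm (b \<omega>))" for b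
  proof -
    have "expectation (\<lambda>\<omega>. inner (b \<omega>) (U k \<omega>)) = expectation (\<lambda>\<omega>. inner (b \<omega>) (batch_average Vhat (m k) (Y k \<omega>)
        (\<lambda>t. source_draw \<xi> \<eta> (Draw_Y k t) \<omega>) - V (Y k \<omega>)))"
      by (rule Bochner_Integration.integral_cong) (auto simp only: U_eq[OF k])
    then show ?thesis using batch(4)[OF that] by simp
  qed
qed

lemma noise_summable: "AE \<omega> in M. summable (\<lambda>k. (norm (W (Suc k) \<omega>))\<^sup>2 + (norm (U (Suc k) \<omega>))\<^sup>2)"
proof (rule AE_summable_nonneg)
  show "integrable M (\<lambda>\<omega>. (norm (W (Suc k) \<omega>))\<^sup>2 + (norm (U (Suc k) \<omega>))\<^sup>2)" for k
    using W_square(1) U_square(1) by simp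
  have "summable (\<lambda>k. 2 * \<sigma>\<^sup>2 * (1 / real (m (Suc k))))"
    using m(2) by (rule summable_mult)
  then show "summable (\<lambda>k. expectation (\<lambda>\<omega>. (norm (W (Suc k) \<omega>))\<^sup>2 + (norm (U (Suc k) \<omega>))\<^sup>2))"
  proof (rule summable_comparison_test')
    show "norm (expectation (\<lambda>\<omega>. (norm (W (Suc k) \<omega>))\<^sup>2 + (norm (U (Suc k) \<omega>))\<^sup>2))
        \<le> 2 * \<sigma>\<^sup>2 * (1 / real (m (Suc k)))" for k
      using W_square[of "Suc k"] U_square[of "Suc k"] by simp
  qed
qed simp

section \<open>The energy and its decrease\<close>

text \<open>The coefficient 5 / (4 \<rho> (1 + L lam)) - 1 after inserting \<open>\<rho> k\<close>;
  the factor 1 + L lam cancels, so \<kappa> converges through \<alpha> alone.\<close>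

definition \<kappa> :: "nat \<Rightarrow> real"
  where "\<kappa> k = (2 * (\<alpha> k)\<^sup>2 - \<alpha> k + 1) / ((1 - \<epsilon>bar) * (1 - \<alpha>bar)\<^sup>2) - 1"

text \<open>Exactly the weight that \<open>inertial_step\<close> produces for the squared increment,
  so the old increment is fully accounted for in the energy.\<close>

definition a :: "nat \<Rightarrow> real"
  where "a k = \<alpha> k * (1 + \<alpha> k) + \<kappa> k * \<alpha> k * (1 - \<alpha> k)"

definition H :: "'h \<Rightarrow> nat \<Rightarrow> 'w \<Rightarrow> real"
  where "H p k \<omega> = (norm (X k \<omega> - p))\<^sup>2 - \<alpha> k * (norm (X (k - 1) \<omega> - p))\<^sup>2
    + a k * (norm (X k \<omega> - X (k - 1) \<omega>))\<^sup>2"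

text \<open>Unlike \<open>Y k\<close>, the point \<open>Yhat k\<close> depends only on the past and is within \<open>lam k * norm (W k \<omega>)\<close> of
  \<open>Y k\<close>. With it in place of \<open>Y k\<close>, the coefficient of the noise \<open>U k\<close>, divided by \<open>1 + H p k\<close>, is bounded.\<close>

definition Yhat :: "nat \<Rightarrow> 'w \<Rightarrow> 'h"
  where "Yhat k \<omega> = resolvent (lam k) T (Z k \<omega> - lam k *\<^sub>R V (Z k \<omega>))"

text \<open>Nonnegative \<kappa> makes \<open>inertial_step\<close> applicable. The bound with
  \<open>a (Suc k)\<close> pays for the new increment, which enters the next energy with that
  weight, and the last two bounds are the coercivity conditions of
  \<open>lyapunov_lower_bound\<close>. The same \<delta> serves all large k.\<close>

definition good :: "real \<Rightarrow> nat \<Rightarrow> bool"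
  where "good \<delta> k \<longleftrightarrow> 1 \<le> k \<and> \<alpha> k < 1 \<and> 0 \<le> \<kappa> k \<and> \<delta> \<le> \<kappa> k * (1 - \<alpha> k) - a (Suc k) \<and>
      \<delta> \<le> (1 - \<alpha> k) / 2 \<and> \<alpha> k * (1 + \<alpha> k) / (1 - \<alpha> k) + \<delta> \<le> a k"

lemma eventually_good:
  obtains \<delta> where "0 < \<delta>" "convergent a" "\<forall>\<^sub>F k in sequentially. good \<delta> k"
proof -
  obtain \<delta> where \<delta>: "0 < \<delta>" "convergent a" and ev: "\<forall>\<^sub>F k in sequentially. \<alpha> k < 1 \<and> 0 \<le> \<kappa> k \<and>
      \<delta> \<le> \<kappa> k * (1 - \<alpha> k) - a (Suc k) \<and> \<delta> \<le> (1 - \<alpha> k) / 2 \<and> \<alpha> k * (1 + \<alpha> k) / (1 - \<alpha> k) + \<delta> \<le> a k"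
    using risfbf_parameters[OF bars \<alpha>(3)] unfolding a_def \<kappa>_def by blast
  have "\<forall>\<^sub>F k in sequentially. good \<delta> k"
    using ev eventually_ge_at_top[of 1] unfolding good_def by eventually_elim simp
  then show ?thesis using that \<delta> by blast
qed

lemma lam_bounds: "1 \<le> k \<Longrightarrow> 0 < lam k" "1 \<le> k \<Longrightarrow> lam k * L \<le> 1 / 4" "1 \<le> k \<Longrightarrow> lam k \<le> 1 / (4 * L)"
  using lam[of k] L(1) by (auto simp: field_simps)

text \<open>The quadratic attains its minimum 7/8 at 1/4.\<close>

lemma discriminant_bound: "7 / 8 \<le> 2 * (\<alpha> k)\<^sup>2 - \<alpha> k + 1"
proof -
  have "0 \<le> (4 * \<alpha> k - 1)\<^sup>2" by simp
  then show ?thesis by (simp add: power2_diff power_mult_distrib)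
qed

lemma \<rho>_bounds:
  assumes k: "1 \<le> k"
  shows "0 < \<rho> k" "\<rho> k \<le> 2" "\<alpha> k < 1 \<Longrightarrow> 5 / 16 * (1 - \<epsilon>bar) * (1 - \<alpha>bar)\<^sup>2 \<le> \<rho> k"
proof -
  define c where "c = (1 - \<epsilon>bar) * (1 - \<alpha>bar)\<^sup>2"
  define d where "d = (2 * (\<alpha> k)\<^sup>2 - \<alpha> k + 1) * (1 + L * lam k)"
  have c: "0 < c" using bars by (simp add: c_def)
  have "c \<le> 1 * 1" unfolding c_def using bars by (intro mult_mono power_le_one) auto
  have L_lam: "0 < L * lam k" "L * lam k \<le> 1 / 4" using lam_bounds[OF k] L(1) by (auto simp: mult.commute)
  have d: "7 / 8 * 1 \<le> d" unfolding d_def using discriminant_bound[of k] L_lam by (intro mult_mono) auto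
  have \<rho>': "\<rho> k = 5 * c / (4 * d)" unfolding \<rho>[OF k] c_def d_def by (simp only: mult.assoc)
  show "0 < \<rho> k" unfolding \<rho>' using c d by (intro divide_pos_pos) auto
  \<comment> \<open>The value 5 / (4 * 7/8) = 10/7 is rounded up to 2; only some bound is
    needed.\<close>
  have "5 * c / (4 * d) \<le> 5 * 1 / (4 * (7 / 8))"
    using c d \<open>c \<le> 1 * 1\<close> by (intro frac_le) auto
  then show "\<rho> k \<le> 2" unfolding \<rho>' by simp
  show "5 / 16 * (1 - \<epsilon>bar) * (1 - \<alpha>bar)\<^sup>2 \<le> \<rho> k" if "\<alpha> k < 1"
  proof -
    have "(\<alpha> k)\<^sup>2 \<le> \<alpha> k"
      using \<alpha>(1)[OF k] that by (simp add: power2_eq_square mult_left_le)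
    \<comment> \<open>2 \<alpha>^2 - \<alpha> + 1 <= \<alpha> + 1 <= 2 for \<alpha> in [0, 1), and 1
      + L lam <= 5/4.\<close>
    then have "d \<le> 2 * 2"
      unfolding d_def using \<alpha>(1)[OF k] that L_lam discriminant_bound[of k] by (intro mult_mono) auto
    then have "5 * c / (4 * 4) \<le> 5 * c / (4 * d)"
      using c d by (intro divide_left_mono) auto
    moreover have "5 / 16 * (1 - \<epsilon>bar) * (1 - \<alpha>bar)\<^sup>2 = 5 * c / (4 * 4)"
      by (simp add: c_def field_simps)
    ultimately show ?thesis unfolding \<rho>' by simp
  qed
qed

lemma \<kappa>_eq: "1 \<le> k \<Longrightarrow> 5 / (4 * \<rho> k * (1 + L * lam k)) - 1 = \<kappa> k"
proof -
  assume k: "1 \<le> k"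
  define c where "c = (1 - \<epsilon>bar) * (1 - \<alpha>bar)\<^sup>2"
  define d where "d = 2 * (\<alpha> k)\<^sup>2 - \<alpha> k + 1"
  define l where "l = 1 + L * lam k"
  have "c \<noteq> 0" using bars by (simp add: c_def)
  moreover have "d \<noteq> 0" using discriminant_bound[of k] by (simp add: d_def)
  moreover have "0 < L * lam k" using lam_bounds(1)[OF k] L(1) by simp
  then have "l \<noteq> 0" unfolding l_def by linarith
  moreover have "\<rho> k = 5 * c / (4 * d * l)"
    unfolding \<rho>[OF k] c_def d_def l_def by (simp add: mult.assoc)
  ultimately have "5 / (4 * \<rho> k * l) = d / c" by simp
  then show ?thesis by (simp add: \<kappa>_def c_def d_def l_def)
qed

lemma H_lower_bound:
  assumes "good \<delta> k"
  shows "\<delta> * ((norm (X k \<omega> - p))\<^sup>2 + (norm (X k \<omega> - X (k - 1) \<omega>))\<^sup>2) \<le> H p k \<omega>"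
  unfolding H_def using assms \<alpha>(1)[of k] by (intro lyapunov_lower_bound) (auto simp: good_def)

lemma H_nonneg: "good \<delta> k \<Longrightarrow> 0 < \<delta> \<Longrightarrow> 0 \<le> H p k \<omega>"
  by (rule order_trans[OF _ H_lower_bound]) auto

lemma zero_iff: "p \<in> op_zeros (op_sum T (op_of_fun V)) \<longleftrightarrow> - V p \<in> T p"
  by (simp add: op_zeros_def op_sum_op_of_fun_iff)

text \<open>Of the linear noise term only the part with the noise-free point \<open>Yhat\<close>
  survives. The rest is quadratic in the noise, because nonexpansiveness of the resolvent bounds Y -
  Yhat by lam |W|.\<close>

lemma H_step:
  assumes good: "good \<delta> k" and p: "- V p \<in> T p" and \<omega>: "\<omega> \<in> space M"
  shows "H p (Suc k) \<omega> \<le> H p k \<omega>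
    - (\<delta> * (norm (X (Suc k) \<omega> - X k \<omega>))\<^sup>2 + 3 / 8 * \<rho> k * (norm (Z k \<omega> - Y k \<omega>))\<^sup>2)
    + 6 * \<rho> k * (lam k)\<^sup>2 * ((norm (W k \<omega>))\<^sup>2 + (norm (U k \<omega>))\<^sup>2)
    + inner ((- 2 * \<rho> k * lam k) *\<^sub>R (Yhat k \<omega> - p)) (U k \<omega>)"
proof -
  have k: "1 \<le> k" using good by (simp add: good_def)
  note l = lam_bounds[OF k] and r = \<rho>_bounds[OF k]
  have "norm (Y k \<omega> - Yhat k \<omega>)
      \<le> norm ((Z k \<omega> - lam k *\<^sub>R A k \<omega>) - (Z k \<omega> - lam k *\<^sub>R V (Z k \<omega>)))"
    unfolding Y[OF k \<omega>] Yhat_def using l(1) by (rule resolvent_nonexpansive[OF T])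
  also have "(Z k \<omega> - lam k *\<^sub>R A k \<omega>) - (Z k \<omega> - lam k *\<^sub>R V (Z k \<omega>)) = - (lam k *\<^sub>R W k \<omega>)"
    by (simp add: W_def algebra_simps)
  also have "norm \<dots> = lam k * norm (W k \<omega>)"
    using l(1) by (simp only: norm_minus_cancel norm_scaleR)
  finally have Y_Yhat: "norm (Y k \<omega> - Yhat k \<omega>) \<le> lam k * norm (W k \<omega>)" .
  have "- inner (U k \<omega>) (Y k \<omega> - Yhat k \<omega>) \<le> norm (U k \<omega>) * norm (Y k \<omega> - Yhat k \<omega>)"
    using Cauchy_Schwarz_ineq2[of "U k \<omega>" "Y k \<omega> - Yhat k \<omega>"] by linarith
  also have "\<dots> \<le> norm (U k \<omega>) * (lam k * norm (W k \<omega>))"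
    by (intro mult_left_mono Y_Yhat) simp
  also have "\<dots> \<le> lam k * (((norm (W k \<omega>))\<^sup>2 + (norm (U k \<omega>))\<^sup>2) / 2)"
  proof -
    have "0 \<le> (norm (W k \<omega>) - norm (U k \<omega>))\<^sup>2" by simp
    then have "norm (U k \<omega>) * norm (W k \<omega>) \<le> ((norm (W k \<omega>))\<^sup>2 + (norm (U k \<omega>))\<^sup>2) / 2"
      by (simp add: power2_diff mult.commute)
    from mult_left_mono[OF this, of "lam k"] l(1) show ?thesis by (simp add: mult.left_commute)
  qed
  \<comment> \<open>This adds one \<rho> lam^2 (|W|^2 + |U|^2) to the five already in
    \<open>c\<close>, whence the constant 6.\<close>
  finally have cross: "2 * \<rho> k * lam k * - inner (U k \<omega>) (Y k \<omega> - Yhat k \<omega>)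
      \<le> 2 * \<rho> k * lam k * (lam k * (((norm (W k \<omega>))\<^sup>2 + (norm (U k \<omega>))\<^sup>2) / 2))"
    using l(1) r(1) by (intro mult_left_mono) auto
  define c where "c = - 2 * \<rho> k * lam k * inner (U k \<omega>) (Y k \<omega> - p)
    - 3 / 8 * \<rho> k * (norm (Z k \<omega> - Y k \<omega>))\<^sup>2
    + 5 * \<rho> k * (lam k)\<^sup>2 * ((norm (W k \<omega>))\<^sup>2 + (norm (U k \<omega>))\<^sup>2)"
  have "(norm (X (Suc k) \<omega> - p))\<^sup>2 \<le> (norm (Z k \<omega> - p))\<^sup>2
    - 2 * \<rho> k * lam k * inner (B k \<omega> - V (Y k \<omega>)) (Y k \<omega> - p)
    - 3 / 8 * \<rho> k * (norm (Z k \<omega> - Y k \<omega>))\<^sup>2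
    + 5 * \<rho> k * (lam k)\<^sup>2 * ((norm (A k \<omega> - V (Z k \<omega>)))\<^sup>2 + (norm (B k \<omega> - V (Y k \<omega>)))\<^sup>2)
    - (5 / (4 * \<rho> k * (1 + L * lam k)) - 1) * (norm (X (Suc k) \<omega> - Z k \<omega>))\<^sup>2"
    using resolvent_in_graph[OF T l(1), of "Z k \<omega> - lam k *\<^sub>R A k \<omega>", folded Y[OF k \<omega>]]
    by (rule forward_backward_forward_step[OF T V L l(1,2) r(1) p _ X_Suc[OF k \<omega>]])
  then have "(norm (X (Suc k) \<omega> - p))\<^sup>2 \<le> (norm (Z k \<omega> - p))\<^sup>2 + c - \<kappa> k * (norm (X (Suc k) \<omega> - Z k \<omega>))\<^sup>2"
    unfolding \<kappa>_eq[OF k] c_def W_def U_def by simp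
  from inertial_step[OF \<alpha>(1)[OF k] _ Z[OF k \<omega>] this, folded a_def] good
  have step: "(norm (X (Suc k) \<omega> - p))\<^sup>2 \<le> (1 + \<alpha> k) * (norm (X k \<omega> - p))\<^sup>2
      - \<alpha> k * (norm (X (k - 1) \<omega> - p))\<^sup>2 + a k * (norm (X k \<omega> - X (k - 1) \<omega>))\<^sup>2
      - \<kappa> k * (1 - \<alpha> k) * (norm (X (Suc k) \<omega> - X k \<omega>))\<^sup>2 + c"
    by (simp add: good_def)
  \<comment> \<open>The step produces weight \<alpha> k but the next energy subtracts \<alpha> (k +
    1); monotonicity of \<alpha> gives the right direction.\<close>
  have "\<alpha> k * (norm (X k \<omega> - p))\<^sup>2 \<le> \<alpha> (Suc k) * (norm (X k \<omega> - p))\<^sup>2"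
    using k by (intro mult_right_mono mono_onD[OF \<alpha>(2)]) auto
  moreover have "(\<delta> + a (Suc k)) * (norm (X (Suc k) \<omega> - X k \<omega>))\<^sup>2
      \<le> \<kappa> k * (1 - \<alpha> k) * (norm (X (Suc k) \<omega> - X k \<omega>))\<^sup>2"
    using good by (intro mult_right_mono) (auto simp: good_def)
  ultimately have "H p (Suc k) \<omega> \<le> H p k \<omega> - \<delta> * (norm (X (Suc k) \<omega> - X k \<omega>))\<^sup>2 + c"
    using step by (simp add: H_def algebra_simps)
  moreover have "c \<le> - 3 / 8 * \<rho> k * (norm (Z k \<omega> - Y k \<omega>))\<^sup>2
      + 6 * \<rho> k * (lam k)\<^sup>2 * ((norm (W k \<omega>))\<^sup>2 + (norm (U k \<omega>))\<^sup>2)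
      + inner ((- 2 * \<rho> k * lam k) *\<^sub>R (Yhat k \<omega> - p)) (U k \<omega>)"
  proof -
    define i1 i2 where "i1 = inner (Yhat k \<omega> - p) (U k \<omega>)" and "i2 = inner (U k \<omega>) (Y k \<omega> - Yhat k \<omega>)"
    have "inner (U k \<omega>) (Y k \<omega> - p) = i1 + i2"
      unfolding i1_def i2_def by (simp add: inner_diff inner_commute)
    then show ?thesis
      unfolding c_def inner_scaleR_left i1_def[symmetric] using cross[folded i2_def]
      by (simp add: algebra_simps power2_eq_square)
  qed
  ultimately show ?thesis by simp
qed

text \<open>A zero p is a fixed point of the noise-free forward-backward map, which is Lipschitz
  with constant 1 + lam L <= 5/4. The distance from Z to p grows at most like the square root of H,
  so 1 + H dominates it.\<close>

lemma Yhat_bound: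
  assumes good: "good \<delta> k" and \<delta>: "0 < \<delta>" and p: "- V p \<in> T p" and \<omega>: "\<omega> \<in> space M"
  shows "norm (Yhat k \<omega> - p) \<le> 5 / 4 * (1 + 2 / \<delta>) * (1 + H p k \<omega>)"
proof -
  have k: "1 \<le> k" and \<alpha>k: "0 \<le> \<alpha> k" "\<alpha> k < 1" using good \<alpha>(1) by (auto simp: good_def)
  note l = lam_bounds[OF k]
  have "resolvent (lam k) T (p - lam k *\<^sub>R V p) = p"
    using l(1) p by (intro resolvent_eqI[OF T]) auto
  then have "norm (Yhat k \<omega> - p)
      = norm (resolvent (lam k) T (Z k \<omega> - lam k *\<^sub>R V (Z k \<omega>)) - resolvent (lam k) T (p - lam k *\<^sub>R V p))"
    by (simp add: Yhat_def)
  also have "\<dots> \<le> norm ((Z k \<omega> - lam k *\<^sub>R V (Z k \<omega>)) - (p - lam k *\<^sub>R V p))"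
    by (rule resolvent_nonexpansive[OF T l(1)])
  also have "(Z k \<omega> - lam k *\<^sub>R V (Z k \<omega>)) - (p - lam k *\<^sub>R V p) = (Z k \<omega> - p) - lam k *\<^sub>R (V (Z k \<omega>) - V p)"
    by (simp add: algebra_simps)
  also have "norm \<dots> \<le> norm (Z k \<omega> - p) + norm (lam k *\<^sub>R (V (Z k \<omega>) - V p))"
    by (rule norm_triangle_ineq4)
  also have "norm (lam k *\<^sub>R (V (Z k \<omega>) - V p)) \<le> lam k * (L * norm (Z k \<omega> - p))"
    using l(1) lipschitz_onD[OF L(2), of "Z k \<omega>" p] by (simp add: dist_norm mult_left_mono)
  also have "\<dots> \<le> 1 / 4 * norm (Z k \<omega> - p)"
    using mult_right_mono[OF l(2) norm_ge_zero, of "Z k \<omega> - p"] by (simp add: mult.assoc)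
  finally have "norm (Yhat k \<omega> - p) \<le> 5 / 4 * norm (Z k \<omega> - p)" by simp
  also have "norm (Z k \<omega> - p) \<le> 1 + (norm (Z k \<omega> - p))\<^sup>2" by (rule le_one_plus_square)
  also have "Z k \<omega> - p = (X k \<omega> - p) + \<alpha> k *\<^sub>R (X k \<omega> - X (k - 1) \<omega>)"
    by (simp add: Z[OF k \<omega>])
  also have "(norm \<dots>)\<^sup>2 \<le> 2 * (norm (X k \<omega> - p))\<^sup>2 + 2 * (norm (\<alpha> k *\<^sub>R (X k \<omega> - X (k - 1) \<omega>)))\<^sup>2"
    by (rule norm_add_square_le)
  also have "(norm (\<alpha> k *\<^sub>R (X k \<omega> - X (k - 1) \<omega>)))\<^sup>2 \<le> (norm (X k \<omega> - X (k - 1) \<omega>))\<^sup>2"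
    using \<alpha>k by (intro power_mono) (auto intro: mult_left_le_one_le)
  also have "2 * (norm (X k \<omega> - p))\<^sup>2 + 2 * (norm (X k \<omega> - X (k - 1) \<omega>))\<^sup>2 \<le> 2 / \<delta> * H p k \<omega>"
    using H_lower_bound[OF good, of \<omega> p] \<delta> by (simp add: field_simps)
  also have "1 + 2 / \<delta> * H p k \<omega> \<le> (1 + 2 / \<delta>) * (1 + H p k \<omega>)"
    using H_nonneg[OF good \<delta>, of p \<omega>] \<delta> by (simp add: algebra_simps)
  finally show ?thesis by (simp only: mult.assoc)
qed

lemma Yhat_measurable:
  assumes k: "1 \<le> k"
  shows "Yhat k \<in> borel_measurable (G (past k))"
proof -
  have "continuous_on UNIV (resolvent (lam k) T)"
    using lam_bounds(1)[OF k] by (rule continuous_on_resolvent[OF T])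
  then have [measurable]: "resolvent (lam k) T \<in> borel_measurable borel"
    by (rule borel_measurable_continuous_onI)
  note [measurable] = adapted(1)[OF k k k] V_measurable
  show ?thesis unfolding Yhat_def by measurable
qed

lemma H_measurable:
  assumes k: "1 \<le> k"
  shows "H p k \<in> borel_measurable (G (past k))"
proof -
  note [measurable] = adapted_X[OF k, THEN conjunct1] adapted_X[OF k, THEN conjunct2]
  show ?thesis unfolding H_def by measurable
qed

section \<open>Almost sure convergence along the iterates\<close>

text \<open>The normalized coefficient \<open>b\<close> of the noise is known from the past and
  bounded by C, so the variances are at most C^2 \<sigma>^2 / m and
  \<open>martingale_differences.AE_summable\<close> applies.\<close>

lemma AE_summable_perturbation:
  assumes \<delta>: "0 < \<delta>" and good: "\<And>k. K \<le> k \<Longrightarrow> good \<delta> k" and p: "- V p \<in> T p"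
  shows "AE \<omega> in M. summable (\<lambda>i. inner ((- 2 * \<rho> (K + i) * lam (K + i)) *\<^sub>R (Yhat (K + i) \<omega> - p)) (U (K + i) \<omega>)
    / (1 + H p (K + i) \<omega>))"
proof -
  have K: "1 \<le> k" if "K \<le> k" for k using good[OF that] by (simp add: good_def)
  define b where "b k \<omega> = ((- 2 * \<rho> k * lam k) / (1 + H p k \<omega>)) *\<^sub>R (Yhat k \<omega> - p)" for k \<omega>
  \<comment> \<open>1 / L is the bound 2 * 2 * (1 / (4 L)) for 2 \<rho> lam; the other factor comes
    from \<open>Yhat_bound\<close>.\<close>
  define C where "C = 1 / L * (5 / 4 * (1 + 2 / \<delta>))"
  have C: "0 \<le> C" using L \<delta> by (simp add: C_def)
  have b_bound: "norm (b k \<omega>) \<le> C" if k: "K \<le> k" and \<omega>: "\<omega> \<in> space M" for k \<omega>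
  proof -
    note k1 = K[OF k]
    have pos: "0 < 1 + H p k \<omega>" using H_nonneg[OF good[OF k] \<delta>, of p \<omega>] by simp
    have coeff: "0 \<le> 2 * \<rho> k * lam k" "2 * \<rho> k * lam k \<le> 2 * 2 * (1 / (4 * L))"
      using \<rho>_bounds[OF k1] lam_bounds[OF k1] by (simp, intro mult_mono) auto
    have "norm (b k \<omega>) = 2 * \<rho> k * lam k * (norm (Yhat k \<omega> - p) / (1 + H p k \<omega>))"
      using pos coeff(1) \<rho>_bounds(1)[OF k1] lam_bounds(1)[OF k1] by (simp add: b_def abs_mult)
    also have "\<dots> \<le> 2 * 2 * (1 / (4 * L)) * (5 / 4 * (1 + 2 / \<delta>))"
      using Yhat_bound[OF good[OF k] \<delta> p \<omega>] pos coeff L(1)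
      by (intro mult_mono[OF coeff(2)]) (auto simp: pos_divide_le_eq)
    finally show ?thesis by (simp add: C_def)
  qed
  have b_past: "b k \<in> borel_measurable (G (past k))" if "K \<le> k" for k
    unfolding b_def using H_measurable[OF K[OF that], of p] Yhat_measurable[OF K[OF that]] by measurable
  have b_M: "b k \<in> borel_measurable M" if "K \<le> k" for k
    using b_past[OF that] past_subset by (rule measurable_G_M)
  have U_M: "U k \<in> borel_measurable M" if "K \<le> k" for k
    using adapted(4)[OF K[OF that] K[OF that] K[OF that]] past_subset by (rule measurable_G_M)
  define D where "D i \<omega> = inner (b (K + i) \<omega>) (U (K + i) \<omega>)" for i \<omega>
  have D_M: "D i \<in> borel_measurable M" for i
    unfolding D_def using b_M[of "K + i"] U_M[of "K + i"] by (intro borel_measurable_inner) auto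
  have D_sq: "(D i \<omega>)\<^sup>2 \<le> C\<^sup>2 * (norm (U (K + i) \<omega>))\<^sup>2" if \<omega>: "\<omega> \<in> space M" for i \<omega>
  proof -
    have "\<bar>D i \<omega>\<bar> \<le> norm (b (K + i) \<omega>) * norm (U (K + i) \<omega>)"
      unfolding D_def by (rule Cauchy_Schwarz_ineq2)
    also have "\<dots> \<le> C * norm (U (K + i) \<omega>)"
      using b_bound[OF _ \<omega>] by (intro mult_right_mono) auto
    finally have "\<bar>D i \<omega>\<bar>\<^sup>2 \<le> (C * norm (U (K + i) \<omega>))\<^sup>2" by (rule power_mono) simp
    then show ?thesis by (simp add: power_mult_distrib)
  qed
  have D_int: "integrable M (\<lambda>\<omega>. (D i \<omega>)\<^sup>2)" for i
  proof (rule Bochner_Integration.integrable_bound)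
    show "integrable M (\<lambda>\<omega>. C\<^sup>2 * (norm (U (K + i) \<omega>))\<^sup>2)"
      using U_square(1)[OF K, of "K + i"] by simp
    show "AE \<omega> in M. norm ((D i \<omega>)\<^sup>2) \<le> norm (C\<^sup>2 * (norm (U (K + i) \<omega>))\<^sup>2)"
      using D_sq by simp
  qed (use D_M in measurable)
  interpret D: martingale_differences M "\<lambda>i. G (past (K + i))" D
  proof
    show "subalgebra M (G (past (K + i)))" for i
      by (rule subalgebra_G[OF past_subset])
    show "sets (G (past (K + i))) \<subseteq> sets (G (past (K + j)))" if "i \<le> j" for i j
      using that by (intro sets_G_mono past_mono past_subset) simp
    show "D i \<in> borel_measurable (G (past (K + j)))" if "i < j" for i j
    proof -
      have "b (K + i) \<in> borel_measurable (G (past (K + j)))"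
        by (rule measurable_G_mono[OF b_past past_mono past_subset]) (use that in auto)
      moreover have "U (K + i) \<in> borel_measurable (G (past (K + j)))"
        by (rule measurable_G_mono[OF adapted(4) past_mono past_subset]) (use that K[of "K + i"] in auto)
      ultimately show ?thesis unfolding D_def by (rule borel_measurable_inner)
    qed
    show "integrable M (\<lambda>\<omega>. (D i \<omega>)\<^sup>2)" for i by (rule D_int)
    show "expectation (\<lambda>\<omega>. g \<omega> * D i \<omega>) = 0"
      if g: "g \<in> borel_measurable (G (past (K + i)))" "integrable M (\<lambda>\<omega>. (g \<omega>)\<^sup>2)" for i g
    proof -
      have k: "K \<le> K + i" by simp
      have gb: "(\<lambda>\<omega>. g \<omega> *\<^sub>R b (K + i) \<omega>) \<in> borel_measurable (G (past (K + i)))"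
        using g(1) b_past[OF k] by (rule borel_measurable_scaleR)
      \<comment> \<open>Both factors belong to \<open>past\<close>, hence to the larger
        \<open>mid\<close>, to which the noise at Y is orthogonal. A bounded b and a square
        integrable g leave a product with a first moment.\<close>
      have "expectation (\<lambda>\<omega>. inner (g \<omega> *\<^sub>R b (K + i) \<omega>) (U (K + i) \<omega>)) = 0"
      proof (rule U_orthogonal[OF K[OF k]])
        show "(\<lambda>\<omega>. g \<omega> *\<^sub>R b (K + i) \<omega>) \<in> borel_measurable (G (mid (K + i)))"
          by (rule measurable_G_mono[OF gb _ mid_subset[OF K[OF k]]]) (simp add: mid_def)
        show "integrable M (\<lambda>\<omega>. norm (g \<omega> *\<^sub>R b (K + i) \<omega>))"
        proof (rule Bochner_Integration.integrable_bound)
          show "integrable M (\<lambda>\<omega>. (1 + (g \<omega>)\<^sup>2) * C)" using g(2) by simp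
          show "AE \<omega> in M. norm (norm (g \<omega> *\<^sub>R b (K + i) \<omega>)) \<le> norm ((1 + (g \<omega>)\<^sup>2) * C)"
          proof (rule AE_I2)
            fix \<omega> assume \<omega>: "\<omega> \<in> space M"
            have "\<bar>g \<omega>\<bar> * norm (b (K + i) \<omega>) \<le> (1 + (g \<omega>)\<^sup>2) * C"
              using b_bound[OF k \<omega>] le_one_plus_square[of "\<bar>g \<omega>\<bar>"] by (intro mult_mono) auto
            then show "norm (norm (g \<omega> *\<^sub>R b (K + i) \<omega>)) \<le> norm ((1 + (g \<omega>)\<^sup>2) * C)"
              using C by simp
          qed
          show "(\<lambda>\<omega>. norm (g \<omega> *\<^sub>R b (K + i) \<omega>)) \<in> borel_measurable M"
            using measurable_G_M[OF gb past_subset] by measurable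
        qed
      qed
      then show ?thesis by (simp add: D_def)
    qed
  qed
  have "summable (\<lambda>i. expectation (\<lambda>\<omega>. (D i \<omega>)\<^sup>2))"
  proof (rule summable_comparison_test')
    have "summable (\<lambda>i. 1 / real (m (Suc (i + (K - 1)))))"
      using m(2) by (subst summable_iff_shift)
    then have "summable (\<lambda>i. 1 / real (m (K + i)))"
      using K[OF order_refl] by (simp add: add.commute)
    then show "summable (\<lambda>i. C\<^sup>2 * \<sigma>\<^sup>2 * (1 / real (m (K + i))))" by (rule summable_mult)
    show "norm (expectation (\<lambda>\<omega>. (D i \<omega>)\<^sup>2)) \<le> C\<^sup>2 * \<sigma>\<^sup>2 * (1 / real (m (K + i)))" for i
    proof -
      have k: "1 \<le> K + i" by (rule K) simp
      have "expectation (\<lambda>\<omega>. (D i \<omega>)\<^sup>2) \<le> expectation (\<lambda>\<omega>. C\<^sup>2 * (norm (U (K + i) \<omega>))\<^sup>2)"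
        using D_int D_sq U_square(1)[OF k] by (intro integral_mono) auto
      also have "\<dots> \<le> C\<^sup>2 * (\<sigma>\<^sup>2 / real (m (K + i)))"
        using mult_left_mono[OF U_square(2)[OF k], of "C\<^sup>2"] by simp
      finally show ?thesis by simp
    qed
  qed
  then have "AE \<omega> in M. summable (\<lambda>i. D i \<omega>)" by (rule D.AE_summable)
  then show ?thesis by (simp add: D_def b_def)
qed

lemma AE_path:
  assumes p: "- V p \<in> T p"
  shows "AE \<omega> in M. convergent (\<lambda>k. norm (X k \<omega> - p)) \<and> (\<lambda>k. X (Suc k) \<omega> - X k \<omega>) \<longlonglongrightarrow> 0 \<and>
    (\<lambda>k. Z k \<omega> - Y k \<omega>) \<longlonglongrightarrow> 0"
proof -
  obtain \<delta> where \<delta>: "0 < \<delta>" and a: "convergent a" and "\<forall>\<^sub>F k in sequentially. good \<delta> k"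
    using eventually_good by blast
  then obtain K where good: "\<And>k. K \<le> k \<Longrightarrow> good \<delta> k" by (auto simp: eventually_sequentially)
  have K: "1 \<le> k" if "K \<le> k" for k using good[OF that] by (simp add: good_def)
  have Suc_pred: "Suc (K - 1 + i) = K + i" "Suc (i + (K - 1)) = K + i" for i using K[OF order_refl] by auto
  have "AE \<omega> in M. summable (\<lambda>i. inner ((- 2 * \<rho> (K + i) * lam (K + i)) *\<^sub>R (Yhat (K + i) \<omega> - p)) (U (K + i) \<omega>)
    / (1 + H p (K + i) \<omega>))"
    using \<delta> good p by (rule AE_summable_perturbation)
  then show ?thesis
    using noise_summable AE_space
  proof eventually_elim
    fix \<omega>
    assume pert: "summable (\<lambda>i. inner ((- 2 * \<rho> (K + i) * lam (K + i)) *\<^sub>R (Yhat (K + i) \<omega> - p)) (U (K + i) \<omega>)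
      / (1 + H p (K + i) \<omega>))"
      and noise: "summable (\<lambda>k. (norm (W (Suc k) \<omega>))\<^sup>2 + (norm (U (Suc k) \<omega>))\<^sup>2)"
      and \<omega>: "\<omega> \<in> space M"
    define e where "e k = (norm (W k \<omega>))\<^sup>2 + (norm (U k \<omega>))\<^sup>2" for k
    define r where "r i = \<delta> * (norm (X (Suc (K + i)) \<omega> - X (K + i) \<omega>))\<^sup>2
      + 3 / 8 * \<rho> (K + i) * (norm (Z (K + i) \<omega> - Y (K + i) \<omega>))\<^sup>2" for i
    have "summable (\<lambda>i. e (Suc (i + (K - 1))))"
      using noise unfolding e_def by (subst summable_iff_shift)
    then have e: "summable (\<lambda>i. e (K + i))" by (simp only: Suc_pred)
    have r_nonneg: "0 \<le> r i" for i
      using \<delta> \<rho>_bounds(1)[OF K, of "K + i"] by (simp add: r_def)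
    have w: "summable (\<lambda>i. 6 * \<rho> (K + i) * (lam (K + i))\<^sup>2 * e (K + i))"
    proof (rule summable_comparison_test')
      show "summable (\<lambda>i. 6 * 2 * (1 / (4 * L))\<^sup>2 * e (K + i))" using e by (rule summable_mult)
      show "norm (6 * \<rho> (K + i) * (lam (K + i))\<^sup>2 * e (K + i)) \<le> 6 * 2 * (1 / (4 * L))\<^sup>2 * e (K + i)" for i
      proof -
        have k: "1 \<le> K + i" by (rule K) simp
        have "6 * \<rho> (K + i) * (lam (K + i))\<^sup>2 * e (K + i) \<le> 6 * 2 * (1 / (4 * L))\<^sup>2 * e (K + i)"
          using \<rho>_bounds[OF k] lam_bounds[OF k] by (intro mult_mono power_mono) (auto simp: e_def)
        then show ?thesis using \<rho>_bounds(1)[OF k] by (simp add: e_def)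
      qed
    qed
    have w_nonneg: "0 \<le> 6 * \<rho> (K + i) * (lam (K + i))\<^sup>2 * e (K + i)" for i
      using \<rho>_bounds(1)[OF K, of "K + i"] by (simp add: e_def)
    have H_pos: "0 \<le> H p (K + i) \<omega>" for i
      using good \<delta> by (intro H_nonneg[of \<delta>]) auto
    have "H p (K + Suc i) \<omega> \<le> H p (K + i) \<omega> - r i + 6 * \<rho> (K + i) * (lam (K + i))\<^sup>2 * e (K + i)
        + inner ((- 2 * \<rho> (K + i) * lam (K + i)) *\<^sub>R (Yhat (K + i) \<omega> - p)) (U (K + i) \<omega>)" for i
      using H_step[OF good p \<omega>, of "K + i"] by (simp add: r_def e_def)
    note path = almost_supermartingale_path[OF H_pos r_nonneg w_nonneg w pert this]
    have r_0: "r \<longlonglongrightarrow> 0" using path(2) by (rule summable_LIMSEQ_zero)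
    \<comment> \<open>A uniform lower bound for \<rho> recovers |Z - Y|^2 from the dissipation,
      where it carries the factor \<rho>.\<close>
    define \<rho>min where "\<rho>min = 5 / 16 * (1 - \<epsilon>bar) * (1 - \<alpha>bar)\<^sup>2"
    have \<rho>min: "0 < \<rho>min" "\<And>i. \<rho>min \<le> \<rho> (K + i)"
      using bars \<rho>_bounds(3)[OF K] good by (auto simp: \<rho>min_def good_def)
    have "(\<lambda>i. X (Suc (K + i)) \<omega> - X (K + i) \<omega>) \<longlonglongrightarrow> 0"
    proof (rule power2_norm_tendsto_0D, rule Lim_null_comparison)
      show "(\<lambda>i. r i / \<delta>) \<longlonglongrightarrow> 0" using tendsto_divide[OF r_0 tendsto_const, of \<delta>] \<delta> by simp
      have "(norm (X (Suc (K + i)) \<omega> - X (K + i) \<omega>))\<^sup>2 \<le> r i / \<delta>" for i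
        using \<delta> \<rho>_bounds(1)[OF K, of "K + i"] by (simp add: r_def pos_le_divide_eq mult.commute)
      then show "\<forall>\<^sub>F i in sequentially. norm ((norm (X (Suc (K + i)) \<omega> - X (K + i) \<omega>))\<^sup>2) \<le> r i / \<delta>"
        by simp
    qed
    then have "(\<lambda>i. X (Suc (i + K)) \<omega> - X (i + K) \<omega>) \<longlonglongrightarrow> 0" by (simp add: add.commute)
    then have diff: "(\<lambda>k. X (Suc k) \<omega> - X k \<omega>) \<longlonglongrightarrow> 0"
      by (rule LIMSEQ_offset)
    have "(\<lambda>i. Z (K + i) \<omega> - Y (K + i) \<omega>) \<longlonglongrightarrow> 0"
    proof (rule power2_norm_tendsto_0D, rule Lim_null_comparison)
      show "(\<lambda>i. r i / (3 / 8 * \<rho>min)) \<longlonglongrightarrow> 0"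
        using tendsto_divide[OF r_0 tendsto_const, of "3 / 8 * \<rho>min"] \<rho>min by simp
      have "(norm (Z (K + i) \<omega> - Y (K + i) \<omega>))\<^sup>2 \<le> r i / (3 / 8 * \<rho>min)" for i
      proof -
        have "3 / 8 * \<rho>min * (norm (Z (K + i) \<omega> - Y (K + i) \<omega>))\<^sup>2
            \<le> 3 / 8 * \<rho> (K + i) * (norm (Z (K + i) \<omega> - Y (K + i) \<omega>))\<^sup>2"
          using \<rho>min(2)[of i] by (intro mult_right_mono) auto
        also have "\<dots> \<le> r i" using \<delta> by (simp add: r_def)
        finally show ?thesis using \<rho>min(1) by (simp add: pos_le_divide_eq mult.commute)
      qed
      then show "\<forall>\<^sub>F i in sequentially. norm ((norm (Z (K + i) \<omega> - Y (K + i) \<omega>))\<^sup>2) \<le> r i / (3 / 8 * \<rho>min)"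
        by simp
    qed
    then have "(\<lambda>i. Z (i + K) \<omega> - Y (i + K) \<omega>) \<longlonglongrightarrow> 0" by (simp add: add.commute)
    then have Z_Y: "(\<lambda>k. Z k \<omega> - Y k \<omega>) \<longlonglongrightarrow> 0"
      by (rule LIMSEQ_offset)
    \<comment> \<open>\<open>H p K\<close> involves \<open>X (K - 1)\<close>, so the shifted
      sequence starts one index earlier than the energy; K >= 1 makes the subtraction
      genuine.\<close>
    have "convergent (\<lambda>i. norm (X (K - 1 + i) \<omega> - p))"
    proof (rule inertial_distance_convergent[where \<alpha> = "\<lambda>i. \<alpha> (K + i)" and a = "\<lambda>i. a (K + i)"])
      show "(\<lambda>i. \<alpha> (K + i)) \<longlonglongrightarrow> \<alpha>bar"
        using LIMSEQ_ignore_initial_segment[OF \<alpha>(3), of K] by (simp add: add.commute)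
      show "\<alpha>bar < 1" by (rule bars)
      show "convergent (\<lambda>i. a (K + i))"
        using convergent_ignore_initial_segment[of a K] a by (simp add: add.commute)
      show "(\<lambda>i. X (K - 1 + Suc i) \<omega> - X (K - 1 + i) \<omega>) \<longlonglongrightarrow> 0"
        using LIMSEQ_ignore_initial_segment[OF diff, of "K - 1"] by (simp add: add.commute)
      show "convergent (\<lambda>i. (norm (X (K - 1 + Suc i) \<omega> - p))\<^sup>2 - \<alpha> (K + i) * (norm (X (K - 1 + i) \<omega> - p))\<^sup>2
          + a (K + i) * (norm (X (K - 1 + Suc i) \<omega> - X (K - 1 + i) \<omega>))\<^sup>2)"
      proof -
        have "K + i - 1 = K - 1 + i" "K - 1 + Suc i = K + i" for i using K[OF order_refl] by auto
        then show ?thesis using path(1) unfolding H_def by (simp only:)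
      qed
      obtain C where C: "\<And>i. H p (K + i) \<omega> \<le> C"
        using convergent_imp_Bseq[OF path(1)] by (force simp: Bseq_def abs_le_iff)
      have tail: "norm (X (K + i) \<omega>) \<le> 1 + C / \<delta> + norm p" for i
      proof -
        have "\<delta> * ((norm (X (K + i) \<omega> - p))\<^sup>2 + (norm (X (K + i) \<omega> - X (K + i - 1) \<omega>))\<^sup>2) \<le> C"
          using H_lower_bound[OF good, of "K + i" \<omega> p] C[of i] by simp
        then have "(norm (X (K + i) \<omega> - p))\<^sup>2 + (norm (X (K + i) \<omega> - X (K + i - 1) \<omega>))\<^sup>2 \<le> C / \<delta>"
          using \<delta> by (simp add: pos_le_divide_eq mult.commute)
        moreover have "0 \<le> (norm (X (K + i) \<omega> - X (K + i - 1) \<omega>))\<^sup>2" by simp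
        ultimately have "norm (X (K + i) \<omega> - p) \<le> 1 + C / \<delta>"
          using le_one_plus_square[of "norm (X (K + i) \<omega> - p)"] by linarith
        then show ?thesis using norm_triangle_sub[of "X (K + i) \<omega>" p] by linarith
      qed
      show "bounded (range (\<lambda>i. X (K - 1 + i) \<omega>))"
        unfolding bounded_iff
      proof (intro exI ballI)
        fix x assume "x \<in> range (\<lambda>i. X (K - 1 + i) \<omega>)"
        then obtain i where x: "x = X (K - 1 + i) \<omega>" by blast
        show "norm x \<le> max (norm (X (K - 1) \<omega>)) (1 + C / \<delta> + norm p)"
        proof (cases i)
          case (Suc j)
          then have "x = X (K + j) \<omega>" using x Suc_pred(1)[of j] by simp
          then show ?thesis using tail[of j] by simp
        qed (simp add: x)
      qed
    qed
    then have "convergent (\<lambda>k. norm (X k \<omega> - p))"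
      using convergent_ignore_initial_segment[of "\<lambda>k. norm (X k \<omega> - p)" "K - 1"] by (simp add: add.commute)
    with diff Z_Y show "convergent (\<lambda>k. norm (X k \<omega> - p)) \<and> (\<lambda>k. X (Suc k) \<omega> - X k \<omega>) \<longlonglongrightarrow> 0 \<and>
        (\<lambda>k. Z k \<omega> - Y k \<omega>) \<longlonglongrightarrow> 0"
      by blast
  qed
qed

end

section \<open>A common exceptional null set and the measurable limit\<close>

theorem corollary4p6:
  fixes T :: "'h::{real_inner, banach, second_countable_topology} \<Rightarrow> 'h set"
    and V :: "'h \<Rightarrow> 'h"
    and L \<sigma> \<alpha>bar \<epsilon>bar lam_lim :: real
    and M :: "'w measure"
    and \<Xi> :: "(real ^ 'd) set"
    and P :: "(real ^ 'd) measure"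
    and \<xi> :: "'w \<Rightarrow> real ^ 'd"
    and Vhat :: "'h \<Rightarrow> real ^ 'd \<Rightarrow> 'h"
    and \<alpha> \<rho> lam :: "nat \<Rightarrow> real"
    and m :: "nat \<Rightarrow> nat"
    and \<xi>s \<eta>s :: "nat \<Rightarrow> nat \<Rightarrow> 'w \<Rightarrow> real ^ 'd"
    and X :: "nat \<Rightarrow> 'w \<Rightarrow> 'h"
  defines "F \<equiv> op_sum T (op_of_fun V)"
  assumes T: "maximally_monotone T"
    and V: "maximally_monotone (op_of_fun V)"
    and L: "L > 0" "L-lipschitz_on UNIV V"
    and S: "op_zeros F \<noteq> {}"
    and M: "prob_space M" "complete_measure M"
    and Xi: "\<Xi> \<in> sets borel"
    and \<xi>: "\<xi> \<in> measurable M (restrict_space borel \<Xi>)"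
    and P: "P = distr M (restrict_space borel \<Xi>) \<xi>"
    and Vhat: "(\<lambda>(x, s). Vhat x s) \<in> borel_measurable (borel \<Otimes>\<^sub>M restrict_space borel \<Xi>)"
    and unbiased: "\<And>x. has_bochner_integral M (\<lambda>\<omega>. Vhat x (\<xi> \<omega>)) (V x)"
    and \<sigma>: "\<sigma> > 0"
    and variance: "\<And>x. integrable M (\<lambda>\<omega>. (norm (Vhat x (\<xi> \<omega>) - V x))\<^sup>2)"
      "\<And>x. prob_space.expectation M (\<lambda>\<omega>. (norm (Vhat x (\<xi> \<omega>) - V x))\<^sup>2) \<le> \<sigma>\<^sup>2"
    and m: "\<And>k. 1 \<le> k \<Longrightarrow> 1 \<le> m k" "mono_on {1..} m"
      "summable (\<lambda>k. 1 / real (m (Suc k)))"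
    and bars: "0 < \<alpha>bar" "\<alpha>bar < 1" "0 < \<epsilon>bar" "\<epsilon>bar < 1"
    and \<alpha>: "\<And>k. 1 \<le> k \<Longrightarrow> 0 \<le> \<alpha> k" "mono_on {1..} \<alpha>" "\<alpha> \<longlonglongrightarrow> \<alpha>bar"
    and lam: "\<And>k. 1 \<le> k \<Longrightarrow> lam k \<in> {0<..<1 / (4 * L)}"
      "lam_lim \<in> {0<..<1 / (4 * L)}" "lam \<longlonglongrightarrow> lam_lim"
    and \<rho>: "\<And>k. 1 \<le> k \<Longrightarrow> \<rho> k = 5 * (1 - \<epsilon>bar) * (1 - \<alpha>bar)\<^sup>2
        / (4 * (2 * (\<alpha> k)\<^sup>2 - \<alpha> k + 1) * (1 + L * lam k))"
    and X01: "X 0 \<in> borel_measurable M" "X 1 \<in> borel_measurable M"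
      "\<And>\<omega>. \<omega> \<in> space M \<Longrightarrow> X 0 \<omega> \<in> op_dom T" "\<And>\<omega>. \<omega> \<in> space M \<Longrightarrow> X 1 \<omega> \<in> op_dom T"
    and sampling: "risfbf_sampling M (restrict_space borel \<Xi>) P m \<xi>s \<eta>s X"
    and process: "risfbf_process M T Vhat \<alpha> \<rho> lam m \<xi>s \<eta>s X"
    and demiregular: "demiregular F"
  shows "\<exists>Xbar \<in> borel_measurable M. (\<forall>\<omega>\<in>space M. Xbar \<omega> \<in> op_zeros F) \<and>
    (AE \<omega> in M. (\<lambda>k. X k \<omega>) \<longlonglongrightarrow> Xbar \<omega>)"
proof -
  define N where "N = restrict_space borel \<Xi>"
  define E where "E = source_events M N \<xi>s \<eta>s X"
  interpret prob_space M by (rule M)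
  obtain Z Y A B where process':
    "\<And>k \<omega>. 1 \<le> k \<Longrightarrow> \<omega> \<in> space M \<Longrightarrow> Z k \<omega> = X k \<omega> + \<alpha> k *\<^sub>R (X k \<omega> - X (k - 1) \<omega>)"
    "\<And>k \<omega>. 1 \<le> k \<Longrightarrow> \<omega> \<in> space M \<Longrightarrow> A k \<omega> = batch_average Vhat (m k) (Z k \<omega>) (\<lambda>t. \<xi>s k t \<omega>)"
    "\<And>k \<omega>. 1 \<le> k \<Longrightarrow> \<omega> \<in> space M \<Longrightarrow> Y k \<omega> = resolvent (lam k) T (Z k \<omega> - lam k *\<^sub>R A k \<omega>)"
    "\<And>k \<omega>. 1 \<le> k \<Longrightarrow> \<omega> \<in> space M \<Longrightarrow> B k \<omega> = batch_average Vhat (m k) (Y k \<omega>) (\<lambda>t. \<eta>s k t \<omega>)"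
    "\<And>k \<omega>. 1 \<le> k \<Longrightarrow> \<omega> \<in> space M \<Longrightarrow>
      X (Suc k) \<omega> = (1 - \<rho> k) *\<^sub>R Z k \<omega> + \<rho> k *\<^sub>R (Y k \<omega> + lam k *\<^sub>R (A k \<omega> - B k \<omega>))"
    using process unfolding risfbf_process_def by auto
  have draws: "\<xi>s k t \<in> measurable M N" "distr M N (\<xi>s k t) = P"
      "\<eta>s k t \<in> measurable M N" "distr M N (\<eta>s k t) = P"
    if "1 \<le> k" "1 \<le> t" "t \<le> m k" for k t
    using sampling that unfolding risfbf_sampling_def N_def by auto
  have indep: "indep_sets E (sources m)"
    using sampling by (simp add: risfbf_sampling_def E_def N_def)
  have sigma: "sigma_algebra (space M) (E i)" for i
  proof (cases i)
    case Initial
    then show ?thesis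
      using sets.sigma_algebra_axioms[of "vimage_algebra (space M) (\<lambda>\<omega>. (X 0 \<omega>, X 1 \<omega>)) (borel \<Otimes>\<^sub>M borel)"]
      by (simp add: E_def)
  next
    case (Draw_Z k t)
    then show ?thesis
      using sets.sigma_algebra_axioms[of "vimage_algebra (space M) (\<xi>s k t) N"] by (simp add: E_def)
  next
    case (Draw_Y k t)
    then show ?thesis
      using sets.sigma_algebra_axioms[of "vimage_algebra (space M) (\<eta>s k t) N"] by (simp add: E_def)
  qed
  interpret src: independent_sources M "sources m" E
    by (intro independent_sources.intro independent_sources_axioms.intro indep sigma prob_space_axioms)
  have "(\<lambda>\<omega>. (X 0 \<omega>, X 1 \<omega>)) \<in> measurable (src.G {Initial}) (borel \<Otimes>\<^sub>M borel)"
    by (rule src.source_measurable_G[of Initial]) (auto simp: sources_def E_def space_pair_measure)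
  from measurable_compose[OF this measurable_fst] measurable_compose[OF this measurable_snd]
  have initial: "X 0 \<in> borel_measurable (src.G {Initial})" "X 1 \<in> borel_measurable (src.G {Initial})"
    by simp_all
  have Vhat_section: "Vhat x \<in> borel_measurable N" for x
  proof -
    have "(\<lambda>s. (x, s)) \<in> measurable N (borel \<Otimes>\<^sub>M N)" by measurable
    from measurable_compose[OF this Vhat[folded N_def]] show ?thesis by simp
  qed
  note \<xi>_meas [measurable] = \<xi>[folded N_def] and Vhat_section [measurable]
  have P_distr: "P = distr M N \<xi>" by (simp add: P N_def)
  interpret alg: risfbf M m E N P \<xi>s \<eta>s Vhat V \<sigma> T L \<alpha>bar \<epsilon>bar \<alpha> \<rho> lam X Z Y A B
  proof
    show "sources m - {Initial} \<subseteq> sources m" by blast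
    fix i assume i: "i \<in> sources m - {Initial}"
    show "source_draw \<xi>s \<eta>s i \<in> measurable M N" "distr M N (source_draw \<xi>s \<eta>s i) = P"
      "sets (vimage_algebra (space M) (source_draw \<xi>s \<eta>s i) N) \<subseteq> E i"
      using i draws by (auto simp: sources_def E_def)
  next
    show "V \<in> borel_measurable borel"
      using lipschitz_on_continuous_on[OF L(2)] by (rule borel_measurable_continuous_onI)
    show "has_bochner_integral P (Vhat x) (V x)" for x
      using unbiased[of x] unfolding P_distr
      by (simp add: has_bochner_integral_iff integrable_distr_eq integral_distr)
    show "integrable P (\<lambda>s. (norm (Vhat x s - V x))\<^sup>2)"
      "(\<integral>s. (norm (Vhat x s - V x))\<^sup>2 \<partial>P) \<le> \<sigma>\<^sup>2" for x
      using variance[of x] unfolding P_distr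
      by (simp_all add: integrable_distr_eq integral_distr)
  qed (use assms initial process' in \<open>simp_all add: N_def\<close>)
  obtain D where D: "countable D" "D \<subseteq> op_zeros F" "op_zeros F \<subseteq> closure D"
    using countable_dense_subset by blast
  \<comment> \<open>Countability of \<open>D\<close> merges the null sets of the individual zeros
    into one.\<close>
  have "AE \<omega> in M. \<forall>p\<in>D. convergent (\<lambda>k. norm (X k \<omega> - p)) \<and> (\<lambda>k. X (Suc k) \<omega> - X k \<omega>) \<longlonglongrightarrow> 0 \<and>
      (\<lambda>k. Z k \<omega> - Y k \<omega>) \<longlonglongrightarrow> 0"
    unfolding AE_ball_countable[OF D(1)] using D(2) alg.AE_path unfolding F_def alg.zero_iff[symmetric] by blast
  then have limit: "AE \<omega> in M. \<exists>x\<in>op_zeros F. (\<lambda>k. X k \<omega>) \<longlonglongrightarrow> x"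
    using alg.noise_summable AE_space
  proof eventually_elim
    fix \<omega>
    assume paths: "\<forall>p\<in>D. convergent (\<lambda>k. norm (X k \<omega> - p)) \<and> (\<lambda>k. X (Suc k) \<omega> - X k \<omega>) \<longlonglongrightarrow> 0 \<and>
        (\<lambda>k. Z k \<omega> - Y k \<omega>) \<longlonglongrightarrow> 0"
      and noise: "summable (\<lambda>k. (norm (alg.W (Suc k) \<omega>))\<^sup>2 + (norm (alg.U (Suc k) \<omega>))\<^sup>2)"
      and \<omega>: "\<omega> \<in> space M"
    have "D \<noteq> {}" using S D(3) by auto
    then have diff: "(\<lambda>k. X (Suc k) \<omega> - X k \<omega>) \<longlonglongrightarrow> 0" and ZY: "(\<lambda>k. Z k \<omega> - Y k \<omega>) \<longlonglongrightarrow> 0"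
      using paths by auto
    \<comment> \<open>The recursion speaks of Z, Y and A from index 1 on, hence the shift by
      one.\<close>
    have "\<exists>x\<in>op_zeros (op_sum T (op_of_fun V)). (\<lambda>k. X (Suc k) \<omega>) \<longlonglongrightarrow> x"
    proof (rule demiregular_path_limit[where D = D and lam = "\<lambda>k. lam (Suc k)"
          and Z = "\<lambda>k. Z (Suc k) \<omega>" and Y = "\<lambda>k. Y (Suc k) \<omega>" and A = "\<lambda>k. A (Suc k) \<omega>"])
      show "maximally_monotone T" "maximally_monotone (op_of_fun V)" "L-lipschitz_on UNIV V" by fact+
      show "demiregular (op_sum T (op_of_fun V))" using demiregular by (simp add: F_def)
      show "D \<noteq> {}" by fact
      show "op_zeros (op_sum T (op_of_fun V)) \<subseteq> closure D" using D(3) by (simp add: F_def)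
      show "convergent (\<lambda>k. norm (X (Suc k) \<omega> - p))" if "p \<in> D" for p
        using paths that convergent_Suc_iff[of "\<lambda>k. norm (X k \<omega> - p)"] by blast
      show "0 < lam (Suc k)" for k using lam(1)[of "Suc k"] by simp
      show "(\<lambda>k. lam (Suc k)) \<longlonglongrightarrow> lam_lim" using lam(3) by (rule LIMSEQ_Suc)
      show "0 < lam_lim" using lam(2) by simp
      show "(1 / lam (Suc k)) *\<^sub>R (Z (Suc k) \<omega> - lam (Suc k) *\<^sub>R A (Suc k) \<omega> - Y (Suc k) \<omega>) \<in> T (Y (Suc k) \<omega>)" for k
        using resolvent_in_graph[OF T, of "lam (Suc k)" "Z (Suc k) \<omega> - lam (Suc k) *\<^sub>R A (Suc k) \<omega>"]
          lam(1)[of "Suc k"] process'(3)[of "Suc k" \<omega>] \<omega> by simp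
      have "(\<lambda>k. \<alpha> (Suc k) *\<^sub>R (X (Suc k) \<omega> - X k \<omega>)) \<longlonglongrightarrow> \<alpha>bar *\<^sub>R 0"
        by (intro tendsto_intros LIMSEQ_Suc[OF \<alpha>(3)] diff)
      then show "(\<lambda>k. Z (Suc k) \<omega> - X (Suc k) \<omega>) \<longlonglongrightarrow> 0"
        using process'(1)[of "Suc _" \<omega>] \<omega> by simp
      show "(\<lambda>k. Z (Suc k) \<omega> - Y (Suc k) \<omega>) \<longlonglongrightarrow> 0" using ZY by (rule LIMSEQ_Suc)
      show "(\<lambda>k. A (Suc k) \<omega> - V (Z (Suc k) \<omega>)) \<longlonglongrightarrow> 0"
      proof (rule power2_norm_tendsto_0D, rule Lim_null_comparison)
        show "(\<lambda>k. (norm (alg.W (Suc k) \<omega>))\<^sup>2 + (norm (alg.U (Suc k) \<omega>))\<^sup>2) \<longlonglongrightarrow> 0"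
          using noise by (rule summable_LIMSEQ_zero)
      qed (simp add: alg.W_def)
    qed
    then show "\<exists>x\<in>op_zeros F. (\<lambda>k. X k \<omega>) \<longlonglongrightarrow> x"
      using LIMSEQ_imp_Suc[of "\<lambda>k. X k \<omega>"] by (auto simp: F_def)
  qed
  then obtain Q where Q: "Q \<in> null_sets M"
    and conv: "\<And>\<omega>. \<omega> \<in> space M - Q \<Longrightarrow> \<exists>x\<in>op_zeros F. (\<lambda>k. X k \<omega>) \<longlonglongrightarrow> x"
    by (auto elim!: AE_E3)
  obtain p where p: "p \<in> op_zeros F" using S by blast
  \<comment> \<open>On the null set the sequence is replaced by a constant zero p. The modified
    sequence then converges everywhere to a zero, so its limit is measurable and takes its values in
    the zeros at every point.\<close>
  define X' where "X' k \<omega> = (if \<omega> \<in> Q then p else X k \<omega>)" for k \<omega>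
  define Xbar where "Xbar \<omega> = lim (\<lambda>k. X' k \<omega>)" for \<omega>
  have lim: "Xbar \<omega> \<in> op_zeros F \<and> (\<lambda>k. X' k \<omega>) \<longlonglongrightarrow> Xbar \<omega>" if \<omega>: "\<omega> \<in> space M" for \<omega>
  proof (cases "\<omega> \<in> Q")
    case True
    then show ?thesis using p by (simp add: X'_def Xbar_def lim_def)
  next
    case False
    then obtain x where x: "x \<in> op_zeros F" "(\<lambda>k. X k \<omega>) \<longlonglongrightarrow> x" using conv \<omega> by blast
    then have "(\<lambda>k. X' k \<omega>) \<longlonglongrightarrow> x" using False by (simp add: X'_def)
    with x(1) show ?thesis by (simp add: Xbar_def limI)
  qed
  have "Q \<in> sets M" using Q by auto
  have X'_meas: "X' k \<in> borel_measurable M" for k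
    unfolding X'_def using \<open>Q \<in> sets M\<close> alg.measurable_X[of k] by measurable
  have "Xbar \<in> borel_measurable M"
    by (rule borel_measurable_LIMSEQ_metric[OF X'_meas lim[THEN conjunct2]])
  moreover have "AE \<omega> in M. (\<lambda>k. X k \<omega>) \<longlonglongrightarrow> Xbar \<omega>"
    using AE_not_in[OF Q] AE_space
  proof eventually_elim
    fix \<omega> assume "\<omega> \<notin> Q" "\<omega> \<in> space M"
    then show "(\<lambda>k. X k \<omega>) \<longlonglongrightarrow> Xbar \<omega>" using lim[of \<omega>] by (simp add: X'_def)
  qed
  ultimately show ?thesis using lim by blast
qed

end
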